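(* Let $\varphi$ be a PEB-spline of order $m\ge2$ and let $X\subseteq\mathbb{R}$ be a separated set with multiplicity function $\mu_X:X\to\{0,\dots,m-1\}$. If the multiplicity function satisfies $$\mathrm{dist}\big(\{x\in X:\mu_X(x)=m-1\},\ \mathbb{Z}\big)>0$$ and the weighted maximum gap of $(X,\mu_X)$ satisfies $\mathfrak{mg}(X,\mu_X)<1$, then $(X,\mu_X)$ is a sampling set for $V^p(\varphi)$, $1\le p\le\infty$.
   Context: PEB-splines. Let $m\in\mathbb{N}=\{1,2,\dots\}$ and $T_yf(x)=f(x-y)$. For $1\le s\le m$ let $\gamma_s\in\mathbb{R}$, let $r_s\in C^{m-s}(\mathbb{R})$ be strictly positive and $1$-periodic, and put $w_s(x)=e^{\gamma_s x}r_s(x)$. Let $u_1=w_1$ and $u_s(x)=w_1(x)\int_0^x w_2(x_2)\int_0^{x_2}w_3(x_3)\cdots\int_0^{x_{s-1}}w_s(x_s)\,dx_s\cdots dx_2$ for $2\le s\le m$, and $\mathcal{U}_m=\mathrm{span}_{\mathbb{C}}(u_1,\dots,u_m)$. The periodic exponential B-spline (PEB-spline) of order $m$ for these weights is the function $\varphi:\mathbb{R}\to\mathbb{R}$, unique up to a positive scalar factor, with $\varphi\in C^{m-2}(\mathbb{R})$ (no condition if $m=1$), $\mathrm{supp}\,\varphi=[0,m]$, $\varphi>0$ on $(0,m)$, and whose restriction to each interval $(\ell,\ell+1)$, $\ell\in\mathbb{Z}$, is the restriction of an element of $\mathcal{U}_m$. The function $\varphi^{(m-1)}$ may jump at integers;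 values of the $(m-1)$-th derivative at integers are right-sided limits. Shift-invariant space: $V^p(\varphi)=\{\sum_{\ell\in\mathbb{Z}}c_\ell\varphi(\cdot-\ell):(c_\ell)\in\ell^p(\mathbb{Z})\}\subseteq L^p(\mathbb{R})$. Sampling: $X$ is separated if $\inf_{x\ne y\in X}|x-y|>0$; it is labelled as a bi-infinite strictly increasing sequence $X=(x_j)_{j\in\mathbb{Z}}$. $(X,\mu_X)$ is a sampling set for $V^p(\varphi)$ if there are constants $A_p,B_p>0$ with $A_p\|f\|_p^p\le\sum_{x\in X}\sum_{s=0}^{\mu_X(x)}|f^{(s)}(x)|^p\le B_p\|f\|_p^p$ for all $f\in V^p(\varphi)$ (with suprema in place of sums if $p=\infty$). Weighted maximum gap: $\mathfrak{mg}(X,\mu_X)=\max\Big\{\sup_{j\in\mathbb{Z}}\frac{x_{j+1}-x_j}{1+\mu_X(x_j)},\ \sup_{j\in\mathbb{Z}}\frac{x_{j+1}-x_j}{1+\mu_X(x_{j+1})}\Big\}$. The distance condition is regarded as void (satisfied) if $\{x\in X:\mu_X(x)=m-1\}=\emptyset$. *)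

theory Defs
  imports "HOL-Analysis.Analysis" "HOL-Probability.Essential_Supremum"
begin

definition nderiv :: "nat \<Rightarrow> (real \<Rightarrow> 'a::real_normed_vector) \<Rightarrow> real \<Rightarrow> 'a" where
  "nderiv s f = ((\<lambda>g x. vector_derivative g (at x)) ^^ s) f"

definition C_k :: "nat \<Rightarrow> (real \<Rightarrow> 'a::real_normed_vector) \<Rightarrow> bool" where
  "C_k k f \<longleftrightarrow> (\<forall>j<k. \<forall>x. nderiv j f differentiable at x) \<and> continuous_on UNIV (nderiv k f)"

definition PEB_weights :: "nat \<Rightarrow> (nat \<Rightarrow> real \<Rightarrow> real) \<Rightarrow> bool" where
  "PEB_weights m w \<longleftrightarrow> (\<forall>s\<in>{1..m}. \<exists>(\<gamma>::real) (r::real \<Rightarrow> real).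
     C_k (m - s) r \<and> (\<forall>x. r x > 0) \<and> (\<forall>x. r (x + 1) = r x) \<and>
     (\<forall>x. w s x = exp (\<gamma> * x) * r x))"

(* iter_int [v_1, ..., v_k] x is the integral of v_1(t_1) ... v_k(t_k) over
   0 < t_1 < x, 0 < t_2 < t_1, ..., all integrals being oriented (x may be negative). *)
fun iter_int :: "(real \<Rightarrow> real) list \<Rightarrow> real \<Rightarrow> real" where
  "iter_int [] x = 1"
| "iter_int (v # vs) x = (LBINT t=ereal 0..ereal x. v t * iter_int vs t)"

definition u_fun :: "(nat \<Rightarrow> real \<Rightarrow> real) \<Rightarrow> nat \<Rightarrow> real \<Rightarrow> real" where
  "u_fun w s x = w 1 x * iter_int (map w [2..<Suc s]) x"

definition U_space :: "(nat \<Rightarrow> real \<Rightarrow> real) \<Rightarrow> nat \<Rightarrow> (real \<Rightarrow> complex) set" where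
  "U_space w m = {g. \<exists>c :: nat \<Rightarrow> complex. g = (\<lambda>x. \<Sum>s=1..m. c s * complex_of_real (u_fun w s x))}"

definition PEB_spline :: "nat \<Rightarrow> (nat \<Rightarrow> real \<Rightarrow> real) \<Rightarrow> (real \<Rightarrow> real) \<Rightarrow> bool" where
  "PEB_spline m w \<phi> \<longleftrightarrow>
     m \<ge> 1 \<and> PEB_weights m w \<and>
     (m \<ge> 2 \<longrightarrow> C_k (m - 2) \<phi>) \<and>
     closure {x. \<phi> x \<noteq> 0} = {0..real m} \<and>
     (\<forall>x\<in>{0<..<real m}. \<phi> x > 0) \<and>
     (\<forall>l::int. \<exists>g\<in>U_space w m. \<forall>x\<in>{of_int l<..<of_int l + 1}. complex_of_real (\<phi> x) = g x)"

definition in_lp :: "ennreal \<Rightarrow> (int \<Rightarrow> complex) \<Rightarrow> bool" where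
  "in_lp p c \<longleftrightarrow> (if p = \<infinity> then bounded (range c)
                 else (\<lambda>l. norm (c l) powr enn2real p) summable_on UNIV)"

(* The functions are kept pointwise rather than modulo null sets, as they get sampled.
   For compactly supported \<phi>, each of the sums has only finitely many nonzero terms. *)
definition shift_inv_space :: "ennreal \<Rightarrow> (real \<Rightarrow> real) \<Rightarrow> (real \<Rightarrow> complex) set" where
  "shift_inv_space p \<phi> =
     {f. \<exists>c. in_lp p c \<and> f = (\<lambda>x. \<Sum>\<^sub>\<infinity>l::int. c l * complex_of_real (\<phi> (x - of_int l)))}"

(* The p-th power of the L^p norm if p is finite, and the L^\<infinity> norm itself if p = \<infinity>. *)
definition Lp_norm_pow :: "ennreal \<Rightarrow> (real \<Rightarrow> complex) \<Rightarrow> ennreal" where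
  "Lp_norm_pow p f =
     (if p = \<infinity> then esssup lborel (\<lambda>x. ennreal (norm (f x)))
      else (\<integral>\<^sup>+x. ennreal (norm (f x) powr enn2real p) \<partial>lborel))"

(* The derivative of order m - 1 of a spline of order m may jump at integers,
   where its value is taken to be the right-sided limit. *)
definition spline_deriv :: "nat \<Rightarrow> nat \<Rightarrow> (real \<Rightarrow> complex) \<Rightarrow> real \<Rightarrow> complex" where
  "spline_deriv m s f x =
     (if s = m - 1 \<and> x \<in> \<int> then Lim (at_right x) (nderiv s f) else nderiv s f x)"

definition sample_sum ::
    "ennreal \<Rightarrow> nat \<Rightarrow> real set \<Rightarrow> (real \<Rightarrow> nat) \<Rightarrow> (real \<Rightarrow> complex) \<Rightarrow> ennreal" where
  "sample_sum p m X \<mu> f =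
     (if p = \<infinity> then (SUP x\<in>X. SUP s\<in>{0..\<mu> x}. ennreal (norm (spline_deriv m s f x)))
      else (\<Sum>\<^sub>\<infinity>x\<in>X. \<Sum>s=0..\<mu> x. ennreal (norm (spline_deriv m s f x) powr enn2real p)))"

definition sampling_set ::
    "ennreal \<Rightarrow> nat \<Rightarrow> (real \<Rightarrow> real) \<Rightarrow> real set \<Rightarrow> (real \<Rightarrow> nat) \<Rightarrow> bool" where
  "sampling_set p m \<phi> X \<mu> \<longleftrightarrow>
     (\<exists>A B :: real. A > 0 \<and> B > 0 \<and> (\<forall>f\<in>shift_inv_space p \<phi>.
        ennreal A * Lp_norm_pow p f \<le> sample_sum p m X \<mu> f \<and>
        sample_sum p m X \<mu> f \<le> ennreal B * Lp_norm_pow p f))"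

definition max_gap :: "(int \<Rightarrow> real) \<Rightarrow> (real \<Rightarrow> nat) \<Rightarrow> ereal" where
  "max_gap x \<mu> =
     max (SUP j. ereal ((x (j + 1) - x j) / (1 + real (\<mu> (x j)))))
         (SUP j. ereal ((x (j + 1) - x j) / (1 + real (\<mu> (x (j + 1))))))"

end

(* Write f for the sum of the c l * phi(x - l). All bounds in terms of the coefficients are local, so
   the point is to bound norm c by the samples, and to bound norm c by the norm of f.

   Uniqueness. With the weights w_1, ..., w_m one forms the generalised derivatives
   F_0 = f / w_1, F_(j+1) = F_j' / w_(j+2); on each interval between integers F_(m-1) is constant.
   If f starts at the integer a, then Rolle's theorem, applied m - 1 times, turns m - 1 + N zeros of f
   (m - 1 of them at a) into N sign changes of the step function F_(m-1), hence the N-th zero of f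
   beyond a lies beyond a + N. If the weighted gaps are at most rho < 1, then the samples are too dense
   for this to hold for long: a spline with vanishing samples on a long window that starts at 0 must
   have m consecutive zero coefficients, and these propagate to the right because the first sample
   after a zero block comes too early. So c K = 0 for a fixed K that depends only on m and rho.

   Stability. The configurations of samples in a window form a compact set (here the distance condition
   enters: samples of the (m-1)-th derivative stay away from the jumps), so uniqueness yields
   |c K| <= C * (samples) + eta * (sum of the |c l| in the window), with eta as small as desired.
   Summing the p-th powers over all integer shifts of the window, the second term is absorbed. *)

theory Submission
  imports Defs
begin

section \<open>Derivatives of finite order on open sets\<close>

text \<open>The zero count uses a starting point on the left and no boundary condition on the right;
  hence a finite window can be cut out of an infinite series and still yield one vanishing
  coefficient. Zeros may be counted separately only if f is nonzero somewhere between them. Such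
  points exist because a spline that vanishes on a subinterval of (n, n + 1) has all m coefficients
  active there equal to zero; so either separating points are available or a zero block appears and
  propagates. The threshold for K comes from two bounds for a sample y beyond m - 1: if S is the sum
  of the multiplicities of the samples from m - 1 up to and including y, the gaps give y <= m - 1 +
  \<rho> S and the zero count gives y > S, hence y < (m - 1) / (1 - \<rho>), which is false once the
  samples have passed that number. In the compactness argument only the coefficient at K is
  controlled, while those near the ends of the window remain free; the term with eta pays for them.
  The size of the window does not depend on eta, so eta can be chosen in terms of it.\<close>

fun Ck_on :: "nat \<Rightarrow> real set \<Rightarrow> (real \<Rightarrow> real) \<Rightarrow> bool" where
  "Ck_on 0 S f = continuous_on S f"
| "Ck_on (Suc k) S f = (\<exists>f'. (\<forall>x\<in>S. (f has_real_derivative f' x) (at x)) \<and> Ck_on k S f')"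

text \<open>Openness of \<open>S\<close> matters: the derivatives are two-sided and depend on the
  values in a whole neighbourhood of the point.\<close>

lemma Ck_on_cong:
  "\<lbrakk>open S; \<And>x. x \<in> S \<Longrightarrow> f x = g x; Ck_on k S f\<rbrakk> \<Longrightarrow> Ck_on k S g"
proof (induction k)
  case 0
  then show ?case by (metis Ck_on.simps(1) continuous_on_cong)
next
  case (Suc k)
  then show ?case
    by (auto intro: has_field_derivative_transform_within_open)
qed

lemma Ck_on_SucD: "Ck_on (Suc k) S f \<Longrightarrow> Ck_on k S f"
proof (induction k arbitrary: f)
  case 0
  then show ?case
    by (auto intro!: continuous_at_imp_continuous_on dest!: bspec intro: DERIV_isCont)
next
  case (Suc k)
  then show ?case by (metis Ck_on.simps(2))
qed

lemma Ck_on_le: "Ck_on k S f \<Longrightarrow> j \<le> k \<Longrightarrow> Ck_on j S f"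
  by (induction k) (metis le_zero_eq, metis Ck_on_SucD le_Suc_eq)

lemma Ck_on_continuous_on: "Ck_on k S f \<Longrightarrow> continuous_on S f"
  using Ck_on_le[of k S f 0] by simp

lemma Ck_on_subset: "Ck_on k S f \<Longrightarrow> S' \<subseteq> S \<Longrightarrow> Ck_on k S' f"
  by (induction k arbitrary: f) (auto intro: continuous_on_subset)

lemma Ck_on_const: "Ck_on k S (\<lambda>x. a)"
proof (induction k arbitrary: a)
  case (Suc k)
  show ?case by (auto intro!: exI[of _ "\<lambda>_. 0"] Suc)
qed simp

lemma Ck_on_add: "Ck_on k S f \<Longrightarrow> Ck_on k S g \<Longrightarrow> Ck_on k S (\<lambda>x. f x + g x)"
proof (induction k arbitrary: f g)
  case 0
  then show ?case by (simp add: continuous_on_add)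
next
  case (Suc k)
  then obtain f' g' where "\<forall>x\<in>S. (f has_real_derivative f' x) (at x)" "Ck_on k S f'"
    "\<forall>x\<in>S. (g has_real_derivative g' x) (at x)" "Ck_on k S g'" by auto
  with Suc.IH show ?case
    by (auto intro!: exI[of _ "\<lambda>x. f' x + g' x"] DERIV_add)
qed

lemma Ck_on_mult: "Ck_on k S f \<Longrightarrow> Ck_on k S g \<Longrightarrow> Ck_on k S (\<lambda>x. f x * g x)"
proof (induction k arbitrary: f g)
  case 0
  then show ?case by (simp add: continuous_on_mult)
next
  case (Suc k)
  then obtain f' g' where d: "\<forall>x\<in>S. (f has_real_derivative f' x) (at x)" "Ck_on k S f'"
    "\<forall>x\<in>S. (g has_real_derivative g' x) (at x)" "Ck_on k S g'" by auto
  have "Ck_on k S (\<lambda>x. f' x * g x + g' x * f x)"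
    using d Suc.prems by (intro Ck_on_add Suc.IH) (simp_all only: Ck_on_SucD)
  with d show ?case
    by (auto intro!: exI[of _ "\<lambda>x. f' x * g x + g' x * f x"] DERIV_mult)
qed

lemma Ck_on_cmult: "Ck_on k S f \<Longrightarrow> Ck_on k S (\<lambda>x. a * f x)"
  by (intro Ck_on_mult Ck_on_const)

lemma Ck_on_sum: "(\<And>i. i \<in> I \<Longrightarrow> Ck_on k S (f i)) \<Longrightarrow> Ck_on k S (\<lambda>x. \<Sum>i\<in>I. f i x)"
  by (induction I rule: infinite_finite_induct) (auto intro: Ck_on_const Ck_on_add)

lemma Ck_on_inverse:
  "\<lbrakk>Ck_on k S f; \<And>x. x \<in> S \<Longrightarrow> f x \<noteq> 0\<rbrakk> \<Longrightarrow> Ck_on k S (\<lambda>x. inverse (f x))"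
proof (induction k arbitrary: f)
  case 0
  then show ?case by (auto intro!: continuous_intros)
next
  case (Suc k)
  then obtain f' where d: "\<forall>x\<in>S. (f has_real_derivative f' x) (at x)" "Ck_on k S f'"
    by auto
  have "Ck_on k S (\<lambda>x. inverse (f x))"
    using Suc.prems by (intro Suc.IH) (blast dest: Ck_on_SucD)+
  then have "Ck_on k S (\<lambda>x. (- 1) * (inverse (f x) * f' x * inverse (f x)))"
    using d by (intro Ck_on_mult Ck_on_const) auto
  with d Suc.prems show ?case
    by (intro Ck_on.simps(2)[THEN iffD2] exI[of _ "\<lambda>x. (- 1) * (inverse (f x) * f' x * inverse (f x))"])
      (auto intro!: DERIV_inverse'[THEN DERIV_cong])
qed

lemma Ck_on_divide:
  "\<lbrakk>Ck_on k S f; Ck_on k S g; \<And>x. x \<in> S \<Longrightarrow> g x \<noteq> 0\<rbrakk> \<Longrightarrow> Ck_on k S (\<lambda>x. f x / g x)"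
  using Ck_on_mult[OF _ Ck_on_inverse] by (simp add: divide_inverse)

lemma Ck_on_shift:
  "\<lbrakk>Ck_on k S f; \<And>x. x \<in> S' \<Longrightarrow> x - d \<in> S\<rbrakk> \<Longrightarrow> Ck_on k S' (\<lambda>x. f (x - d))"
proof (induction k arbitrary: f)
  case 0
  then show ?case
    by (auto intro!: continuous_on_compose2[of S f] continuous_intros)
next
  case (Suc k)
  then obtain f' where d: "\<forall>x\<in>S. (f has_real_derivative f' x) (at x)" "Ck_on k S f'"
    by auto
  have "((\<lambda>x. f (x - d)) has_real_derivative f' (x - d)) (at x)" if "x \<in> S'" for x
  proof -
    have "(f has_real_derivative f' (x - d)) (at (x - d))" using d Suc.prems that by auto
    then show ?thesis using DERIV_shift[of f "f' (x - d)" x "- d"] by simp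
  qed
  with Suc d show ?case by (auto intro!: exI[of _ "\<lambda>x. f' (x - d)"])
qed

lemma Ck_on_exp: "Ck_on k S (\<lambda>x. exp (a * x))"
proof (induction k)
  case 0
  show ?case by (auto intro!: continuous_intros)
next
  case (Suc k)
  then have "Ck_on k S (\<lambda>x. a * exp (a * x))" by (rule Ck_on_cmult)
  then show ?case
    by (auto intro!: exI[of _ "\<lambda>x. a * exp (a * x)"] derivative_eq_intros)
qed

section \<open>Iterated ordinary derivatives\<close>

lemma nderiv_0 [simp]: "nderiv 0 f = f"
  by (simp add: nderiv_def)

lemma nderiv_Suc: "nderiv (Suc s) f x = vector_derivative (nderiv s f) (at x)"
  by (simp add: nderiv_def)

lemma nderiv_Suc_right: "nderiv (Suc s) f = nderiv s (\<lambda>x. vector_derivative f (at x))"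
  by (simp add: nderiv_def funpow_Suc_right del: funpow.simps)

lemma nderiv_cong_open:
  assumes "open S" "\<And>x. x \<in> S \<Longrightarrow> f x = g x" "x \<in> S"
  shows "nderiv s f x = nderiv s g x"
  using assms(3)
proof (induction s arbitrary: x)
  case (Suc s)
  then have "eventually (\<lambda>y. nderiv s f y = nderiv s g y) (nhds x)"
    using assms(1) by (auto simp: eventually_nhds)
  then show ?case
    unfolding nderiv_Suc by (intro vector_derivative_cong_eq) auto
qed (use assms in auto)

lemma nderiv_Suc_has_derivative:
  assumes "open S" "\<And>x. x \<in> S \<Longrightarrow> (f has_vector_derivative f' x) (at x)" "x \<in> S"
  shows "nderiv (Suc s) f x = nderiv s f' x"
  unfolding nderiv_Suc_right
  by (rule nderiv_cong_open[OF assms(1) _ assms(3)]) (use assms in \<open>auto intro: vector_derivative_at\<close>)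

lemma nderiv_Suc_DERIV:
  assumes "open S" "\<And>x. x \<in> S \<Longrightarrow> (f has_real_derivative f' x) (at x)" "x \<in> S"
  shows "nderiv (Suc s) f x = nderiv s f' x"
  using assms by (intro nderiv_Suc_has_derivative) (auto simp: has_real_derivative_iff_has_vector_derivative)

lemma C_k_imp_Ck_on:
  fixes f :: "real \<Rightarrow> real"
  shows "C_k k f \<Longrightarrow> Ck_on k UNIV f"
proof (induction k arbitrary: f)
  case 0
  then show ?case by (simp add: C_k_def)
next
  case (Suc k)
  define f' where "f' = (\<lambda>x. vector_derivative f (at x))"
  have n: "nderiv j f' = nderiv (Suc j) f" for j
    by (simp add: f'_def nderiv_Suc_right)
  have "f differentiable at x" for x
    using Suc.prems by (auto simp: C_k_def dest: spec[of _ 0])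
  then have "(f has_real_derivative f' x) (at x)" for x
    by (simp add: f'_def has_real_derivative_iff_has_vector_derivative vector_derivative_works)
  moreover have "C_k k f'" using Suc.prems by (auto simp: C_k_def n)
  ultimately show ?case using Suc.IH by auto
qed

lemma Ck_on_nderiv_continuous_on:
  "\<lbrakk>open S; Ck_on k S f; s \<le> k\<rbrakk> \<Longrightarrow> continuous_on S (nderiv s f)"
proof (induction s arbitrary: f k)
  case 0
  then show ?case by (auto intro: Ck_on_continuous_on)
next
  case (Suc s)
  then obtain k' where k: "k = Suc k'" by (cases k) auto
  then obtain f' where d: "\<forall>x\<in>S. (f has_real_derivative f' x) (at x)" "Ck_on k' S f'"
    using Suc.prems by auto
  have "continuous_on S (nderiv s f')"
    using Suc.IH[of k' f'] Suc.prems d k by simp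
  moreover have "\<And>x. x \<in> S \<Longrightarrow> nderiv s f' x = nderiv (Suc s) f x"
    using nderiv_Suc_DERIV[OF Suc.prems(1), of f f'] d by metis
  ultimately show ?case by (metis continuous_on_cong)
qed

text \<open>The functions are real and the coefficients lie in a normed space, so that one statement
  serves real splines and series with complex coefficients.\<close>

lemma nderiv_scaleR_sum:
  fixes b :: "'i \<Rightarrow> 'a::real_normed_vector"
  assumes "open S" "x \<in> S" "\<And>i. i \<in> I \<Longrightarrow> Ck_on s S (f i)"
  shows "nderiv s (\<lambda>x. \<Sum>i\<in>I. f i x *\<^sub>R b i) x = (\<Sum>i\<in>I. nderiv s (f i) x *\<^sub>R b i)"
  using assms(3)
proof (induction s arbitrary: f)
  case (Suc s)
  then have "\<forall>i\<in>I. \<exists>f'. (\<forall>x\<in>S. (f i has_real_derivative f' x) (at x)) \<and> Ck_on s S f'"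
    by simp
  then obtain f' where d: "\<And>i x. i \<in> I \<Longrightarrow> x \<in> S \<Longrightarrow> (f i has_real_derivative f' i x) (at x)"
    "\<And>i. i \<in> I \<Longrightarrow> Ck_on s S (f' i)" by metis
  have "((\<lambda>x. \<Sum>i\<in>I. f i x *\<^sub>R b i) has_vector_derivative (\<Sum>i\<in>I. f' i x *\<^sub>R b i)) (at x)"
    if "x \<in> S" for x
    using d(1)[OF _ that]
    by (intro has_vector_derivative_sum) (auto intro!: derivative_eq_intros)
  then have "nderiv (Suc s) (\<lambda>x. \<Sum>i\<in>I. f i x *\<^sub>R b i) x = nderiv s (\<lambda>x. \<Sum>i\<in>I. f' i x *\<^sub>R b i) x"
    by (rule nderiv_Suc_has_derivative[OF assms(1) _ assms(2)])
  also have "\<dots> = (\<Sum>i\<in>I. nderiv s (f' i) x *\<^sub>R b i)"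
    by (rule Suc.IH) (use d in auto)
  also have "\<dots> = (\<Sum>i\<in>I. nderiv (Suc s) (f i) x *\<^sub>R b i)"
    using nderiv_Suc_DERIV[OF assms(1) d(1) assms(2)] by auto
  finally show ?case .
qed simp

lemma nderiv_add:
  assumes "open S" "x \<in> S" "Ck_on s S f" "Ck_on s S g"
  shows "nderiv s (\<lambda>x. f x + g x :: real) x = nderiv s f x + nderiv s g x"
  using nderiv_scaleR_sum[OF assms(1,2), of "UNIV :: bool set" s "\<lambda>b. if b then f else g" "\<lambda>_. 1 :: real"]
    assms(3,4) by (simp add: UNIV_bool add.commute)

text \<open>A Leibniz argument without binomial coefficients: in \<open>f' * g + f * g'\<close> both
  first factors again vanish at \<open>y\<close> up to order \<open>k\<close>, so the induction
  hypothesis applies to each product.\<close>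

lemma nderiv_mult_eq_0:
  assumes "open S" "y \<in> S"
  shows "\<lbrakk>Ck_on k S f; Ck_on k S g; \<And>s. s \<le> k \<Longrightarrow> nderiv s f y = 0; s \<le> k\<rbrakk>
    \<Longrightarrow> nderiv s (\<lambda>x. f x * g x) y = 0"
proof (induction k arbitrary: f g s)
  case 0
  then show ?case using "0.prems"(3)[of 0] by simp
next
  case (Suc k)
  show ?case
  proof (cases s)
    case 0
    then show ?thesis using Suc.prems(3)[of 0] by simp
  next
    case (Suc s')
    obtain f' g' where d: "\<And>x. x \<in> S \<Longrightarrow> (f has_real_derivative f' x) (at x)" "Ck_on k S f'"
      "\<And>x. x \<in> S \<Longrightarrow> (g has_real_derivative g' x) (at x)" "Ck_on k S g'"
      using Suc.prems(1,2)[unfolded Ck_on.simps] by blast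
    have c: "Ck_on k S f" "Ck_on k S g" using Suc.prems by (simp_all only: Ck_on_SucD)
    have le: "s' \<le> k" using Suc Suc.prems by simp
    have "nderiv s (\<lambda>x. f x * g x) y = nderiv s' (\<lambda>x. f' x * g x + f x * g' x) y"
      unfolding Suc using d
      by (intro nderiv_Suc_DERIV[OF assms(1) _ assms(2)]) (auto intro!: derivative_eq_intros)
    also have "\<dots> = nderiv s' (\<lambda>x. f' x * g x) y + nderiv s' (\<lambda>x. f x * g' x) y"
      by (rule nderiv_add[OF assms Ck_on_le[OF Ck_on_mult[OF d(2) c(2)] le]
            Ck_on_le[OF Ck_on_mult[OF c(1) d(4)] le]])
    also have "\<dots> = 0"
    proof -
      have "nderiv s f' y = 0" if "s \<le> k" for s
        using nderiv_Suc_DERIV[OF assms(1) d(1) assms(2), of s] Suc.prems(3)[of "Suc s"] that by linarith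
      from Suc.IH[OF d(2) c(2) this le] Suc.IH[OF c(1) d(4) Suc.prems(3)[OF le_SucI] le]
      show ?thesis by linarith
    qed
    finally show ?thesis .
  qed
qed

section \<open>Generalised derivatives with respect to a system of weights\<close>

fun wderiv :: "(nat \<Rightarrow> real \<Rightarrow> real) \<Rightarrow> (real \<Rightarrow> real) \<Rightarrow> nat \<Rightarrow> real \<Rightarrow> real" where
  "wderiv v f 0 = (\<lambda>x. f x / v 0 x)"
| "wderiv v f (Suc j) = (\<lambda>x. deriv (wderiv v f j) x / v (Suc j) x)"

context
  fixes v :: "nat \<Rightarrow> real \<Rightarrow> real" and f :: "real \<Rightarrow> real" and S :: "real set" and k :: nat
  assumes S: "open S" and f: "Ck_on k S f"
    and v: "\<And>j. j \<le> k \<Longrightarrow> Ck_on (k - j) S (v j)" and nz: "\<And>j x. j \<le> k \<Longrightarrow> x \<in> S \<Longrightarrow> v j x \<noteq> 0"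
begin

text \<open>Each generalised derivative costs one order of smoothness, which is why weight
  \<open>j\<close> is asked to be of class \<open>k - j\<close> only.\<close>

lemma wderiv_Suc_aux:
  assumes "Ck_on (k - j) S (wderiv v f j)" "Suc j \<le> k"
  shows "Ck_on (k - Suc j) S (deriv (wderiv v f j))"
    and "x \<in> S \<Longrightarrow> (wderiv v f j has_real_derivative v (Suc j) x * wderiv v f (Suc j) x) (at x)"
proof -
  have "k - j = Suc (k - Suc j)" using assms by simp
  then obtain f' where d: "\<forall>x\<in>S. (wderiv v f j has_real_derivative f' x) (at x)" "Ck_on (k - Suc j) S f'"
    using assms(1) by auto
  then have e: "f' x = deriv (wderiv v f j) x" if "x \<in> S" for x
    using that DERIV_imp_deriv by metis
  show "Ck_on (k - Suc j) S (deriv (wderiv v f j))"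
    using Ck_on_cong[OF S e d(2)] by simp
  show "x \<in> S \<Longrightarrow> (wderiv v f j has_real_derivative v (Suc j) x * wderiv v f (Suc j) x) (at x)"
    using d(1) e nz[OF assms(2)] by auto
qed

lemma Ck_on_wderiv: "j \<le> k \<Longrightarrow> Ck_on (k - j) S (wderiv v f j)"
proof (induction j)
  case 0
  then show ?case using Ck_on_divide[of k S f "v 0"] f v[of 0] nz[of 0] by simp
next
  case (Suc j)
  then show ?case
    using wderiv_Suc_aux(1)[of j] nz by (auto intro!: Ck_on_divide v)
qed

lemma DERIV_wderiv:
  "j < k \<Longrightarrow> x \<in> S \<Longrightarrow> (wderiv v f j has_real_derivative v (Suc j) x * wderiv v f (Suc j) x) (at x)"
  using wderiv_Suc_aux(2) Ck_on_wderiv by simp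

text \<open>Transfers vanishing samples to the generalised derivatives. The induction carries the
  stronger claim that the ordinary derivatives of \<open>wderiv v f j\<close> vanish at
  \<open>y\<close> up to order \<open>k - j\<close>: division by a weight keeps this,
  differentiation shifts it by one.\<close>

lemma wderiv_eq_0:
  assumes y: "y \<in> S" "\<And>s. s \<le> k \<Longrightarrow> nderiv s f y = 0" and "j \<le> k"
  shows "wderiv v f j y = 0"
proof -
  have divz: "nderiv s (\<lambda>x. h x / v j x) y = 0"
    if j: "j \<le> k" and h: "Ck_on (k - j) S h" "\<And>s. s \<le> k - j \<Longrightarrow> nderiv s h y = 0" and s: "s \<le> k - j"
    for h s j
    unfolding divide_inverse
    by (rule nderiv_mult_eq_0[OF S y(1) h(1) Ck_on_inverse[OF v[OF j] nz[OF j]] h(2) s])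
  have "\<forall>s\<le>k - j. nderiv s (wderiv v f j) y = 0" using assms(3)
  proof (induction j)
    case 0
    have "Ck_on (k - 0) S f" using f by simp
    from divz[OF _ this] y(2) show ?case by simp
  next
    case (Suc j)
    have j: "Suc j \<le> k" using Suc by simp
    have n: "nderiv s (deriv (wderiv v f j)) y = 0" if "s \<le> k - Suc j" for s
    proof -
      have d: "(wderiv v f j has_real_derivative deriv (wderiv v f j) x) (at x)" if "x \<in> S" for x
      proof -
        have "j < k" using j by simp
        from DERIV_wderiv[OF this that] show ?thesis using DERIV_imp_deriv by metis
      qed
      have "nderiv (Suc s) (wderiv v f j) y = nderiv s (deriv (wderiv v f j)) y"
        by (rule nderiv_Suc_DERIV[OF S d y(1)])
      moreover have "Suc s \<le> k - j" using that j by simp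
      then have "nderiv (Suc s) (wderiv v f j) y = 0"
        using Suc.IH Suc_leD[OF j] by blast
      ultimately show ?thesis by simp
    qed
    have "Ck_on (k - Suc j) S (deriv (wderiv v f j))"
      by (rule wderiv_Suc_aux(1)[OF Ck_on_wderiv j]) (use j in simp)
    from divz[OF j this n] show ?case unfolding wderiv.simps by blast
  qed
  then show ?thesis by (auto dest: spec[of _ 0])
qed

end

text \<open>\<open>wderiv\<close> applies the last weight outermost, whereas \<open>ECT\<close>
  strips the first one; this identity reconciles the two recursions.\<close>

lemma wderiv_Suc_left: "wderiv v f (Suc j) = wderiv (\<lambda>i. v (Suc i)) (deriv (\<lambda>x. f x / v 0 x)) j"
proof (induction j)
  case (Suc j)
  show ?case unfolding wderiv.simps(2)[of v f "Suc j"] Suc by simp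
qed simp

lemma deriv_cong_open:
  assumes "open S" "\<And>x. x \<in> S \<Longrightarrow> f x = g x" "x \<in> S"
  shows "deriv f x = deriv g x"
  by (rule deriv_cong_ev) (use assms in \<open>auto simp: eventually_nhds\<close>)

lemma wderiv_cong_open:
  assumes "open S" "\<And>x. x \<in> S \<Longrightarrow> f x = g x"
  shows "x \<in> S \<Longrightarrow> wderiv v f j x = wderiv v g j x"
proof (induction j arbitrary: x)
  case (Suc j)
  then show ?case
    using deriv_cong_open[OF assms(1), of "wderiv v f j" "wderiv v g j" x] by simp
qed (use assms in simp)

text \<open>Local membership in the span of the system \<open>u_1, ..., u_(n+1)\<close> (an extended complete
  Chebyshev system) with weights \<open>v 0, ..., v n\<close>, phrased by iterated integration.\<close>

fun ECT :: "(nat \<Rightarrow> real \<Rightarrow> real) \<Rightarrow> nat \<Rightarrow> real set \<Rightarrow> (real \<Rightarrow> real) \<Rightarrow> bool" where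
  "ECT v 0 S f = (\<exists>k. \<forall>x\<in>S. f x = v 0 x * k)"
| "ECT v (Suc n) S f = (\<exists>F G. (\<forall>x\<in>S. f x = v 0 x * F x \<and> (F has_real_derivative G x) (at x)) \<and>
     ECT (\<lambda>i. v (Suc i)) n S G)"

lemma ECT_SucI:
  "\<lbrakk>\<And>x. x \<in> S \<Longrightarrow> f x = v 0 x * F x; \<And>x. x \<in> S \<Longrightarrow> (F has_real_derivative G x) (at x);
    ECT (\<lambda>i. v (Suc i)) n S G\<rbrakk> \<Longrightarrow> ECT v (Suc n) S f"
  unfolding ECT.simps by blast

lemma ECT_cong: "\<lbrakk>\<And>x. x \<in> S \<Longrightarrow> f x = g x; ECT v n S f\<rbrakk> \<Longrightarrow> ECT v n S g"
  by (cases n) auto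

lemma ECT_zero: "ECT v n S (\<lambda>x. 0)"
proof (induction n arbitrary: v)
  case (Suc n)
  show ?case by (rule ECT_SucI[where F = "\<lambda>_. 0" and G = "\<lambda>_. 0"]) (simp_all add: Suc)
qed auto

lemma ECT_add: "ECT v n S f \<Longrightarrow> ECT v n S g \<Longrightarrow> ECT v n S (\<lambda>x. f x + g x)"
proof (induction n arbitrary: v f g)
  case 0
  then obtain k l where "\<forall>x\<in>S. f x = v 0 x * k" "\<forall>x\<in>S. g x = v 0 x * l" by auto
  then show ?case by (auto intro!: exI[of _ "k + l"] simp: algebra_simps)
next
  case (Suc n)
  then obtain F G F' G' where
    *: "\<forall>x\<in>S. f x = v 0 x * F x \<and> (F has_real_derivative G x) (at x)" "ECT (\<lambda>i. v (Suc i)) n S G"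
    "\<forall>x\<in>S. g x = v 0 x * F' x \<and> (F' has_real_derivative G' x) (at x)" "ECT (\<lambda>i. v (Suc i)) n S G'"
    unfolding ECT.simps by blast
  have "ECT (\<lambda>i. v (Suc i)) n S (\<lambda>x. G x + G' x)" using Suc.IH * by blast
  with * show ?case unfolding ECT.simps
    by (intro exI[of _ "\<lambda>x. F x + F' x"] exI[of _ "\<lambda>x. G x + G' x"])
      (auto intro!: DERIV_add simp: algebra_simps)
qed

lemma ECT_cmult: "ECT v n S f \<Longrightarrow> ECT v n S (\<lambda>x. a * f x)"
proof (induction n arbitrary: v f)
  case 0
  then obtain k where "\<forall>x\<in>S. f x = v 0 x * k" by auto
  then show ?case by (auto intro!: exI[of _ "a * k"])
next
  case (Suc n)
  then obtain F G where
    *: "\<forall>x\<in>S. f x = v 0 x * F x \<and> (F has_real_derivative G x) (at x)" "ECT (\<lambda>i. v (Suc i)) n S G"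
    unfolding ECT.simps by blast
  have "ECT (\<lambda>i. v (Suc i)) n S (\<lambda>x. a * G x)" using Suc.IH * by blast
  with * show ?case unfolding ECT.simps
    by (intro exI[of _ "\<lambda>x. a * F x"] exI[of _ "\<lambda>x. a * G x"])
      (auto intro!: DERIV_cmult)
qed

lemma ECT_sum: "(\<And>i. i \<in> I \<Longrightarrow> ECT v n S (f i)) \<Longrightarrow> ECT v n S (\<lambda>x. \<Sum>i\<in>I. f i x)"
  by (induction I rule: infinite_finite_induct) (simp_all add: ECT_zero ECT_add)

text \<open>The factor \<open>l j\<close> by which the shift multiplies weight \<open>j\<close>
  moves into the inner function, because the class is closed under scalar multiples. Exponential
  times periodic weights have such factors for integer shifts.\<close>

lemma ECT_shift:
  "\<lbrakk>ECT v n S f; \<And>x. x \<in> S' \<Longrightarrow> x - d \<in> S; \<And>j x. v j (x - d) = l j * v j x\<rbrakk>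
    \<Longrightarrow> ECT v n S' (\<lambda>x. f (x - d))"
proof (induction n arbitrary: v f l)
  case 0
  then obtain k where k: "\<forall>x\<in>S. f x = v 0 x * k" by auto
  have "f (x - d) = v 0 x * (l 0 * k)" if "x \<in> S'" for x
    using k 0(2)[OF that] 0(3)[of 0 x] by simp
  then show ?case by auto
next
  case (Suc n)
  then obtain F G where
    *: "\<And>x. x\<in>S \<Longrightarrow> f x = v 0 x * F x" "\<And>x. x\<in>S \<Longrightarrow> (F has_real_derivative G x) (at x)"
    "ECT (\<lambda>i. v (Suc i)) n S G"
    unfolding ECT.simps by blast
  have "ECT (\<lambda>i. v (Suc i)) n S' (\<lambda>x. G (x - d))"
    by (rule Suc.IH[OF *(3) Suc.prems(2), of "\<lambda>j. l (Suc j)"]) (use Suc.prems(3) in auto)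
  then have "ECT (\<lambda>i. v (Suc i)) n S' (\<lambda>x. l 0 * G (x - d))" by (rule ECT_cmult)
  moreover have "f (x - d) = v 0 x * (l 0 * F (x - d)) \<and>
      ((\<lambda>x. l 0 * F (x - d)) has_real_derivative l 0 * G (x - d)) (at x)" if "x \<in> S'" for x
  proof
    show "f (x - d) = v 0 x * (l 0 * F (x - d))"
      using *(1)[OF Suc.prems(2)[OF that]] Suc.prems(3)[of 0 x] by simp
    show "((\<lambda>x. l 0 * F (x - d)) has_real_derivative l 0 * G (x - d)) (at x)"
      using DERIV_shift[of F "G (x - d)" x "- d"] *(2)[OF Suc.prems(2)[OF that]]
      by (intro DERIV_cmult) simp
  qed
  ultimately show ?case by (intro ECT_SucI[where F = "\<lambda>x. l 0 * F (x - d)"]) simp_all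
qed

lemma ECT_Ck_on:
  "\<lbrakk>open S; \<And>j. j \<le> n \<Longrightarrow> Ck_on (n - j) S (v j); ECT v n S f\<rbrakk> \<Longrightarrow> Ck_on n S f"
proof (induction n arbitrary: v f)
  case 0
  then obtain k where k: "\<And>x. x \<in> S \<Longrightarrow> f x = v 0 x * k" by auto
  have "continuous_on S (\<lambda>x. v 0 x * k)" using 0(2)[of 0] by (simp add: continuous_on_mult_right)
  then show ?case using k by (simp cong: continuous_on_cong)
next
  case (Suc n)
  then obtain F G where
    *: "\<And>x. x\<in>S \<Longrightarrow> f x = v 0 x * F x" "\<And>x. x\<in>S \<Longrightarrow> (F has_real_derivative G x) (at x)"
    "ECT (\<lambda>i. v (Suc i)) n S G"
    unfolding ECT.simps by blast
  have "Ck_on n S G" using Suc.prems(2)[of "Suc _"] by (intro Suc.IH[OF Suc.prems(1) _ *(3)]) simp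
  then have "Ck_on (Suc n) S F" using *(2) unfolding Ck_on.simps by blast
  then have "Ck_on (Suc n) S (\<lambda>x. v 0 x * F x)" using Suc.prems(2)[of 0] by (intro Ck_on_mult) simp_all
  then show ?case by (rule Ck_on_cong[OF Suc.prems(1), rotated]) (use * in simp)
qed

text \<open>The generalised derivatives undo the integrations one weight at a time, until only the
  innermost constant is left.\<close>

lemma ECT_wderiv_const:
  "\<lbrakk>open S; \<And>j x. j \<le> n \<Longrightarrow> x \<in> S \<Longrightarrow> v j x \<noteq> 0; ECT v n S f\<rbrakk> \<Longrightarrow> \<exists>k. \<forall>x\<in>S. wderiv v f n x = k"
proof (induction n arbitrary: v f)
  case 0
  then obtain k where k: "\<And>x. x \<in> S \<Longrightarrow> f x = v 0 x * k" by auto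
  then show ?case using 0(2)[of 0] by auto
next
  case (Suc n)
  then obtain F G where
    *: "\<And>x. x\<in>S \<Longrightarrow> f x = v 0 x * F x" "\<And>x. x\<in>S \<Longrightarrow> (F has_real_derivative G x) (at x)"
    "ECT (\<lambda>i. v (Suc i)) n S G"
    unfolding ECT.simps by blast
  have "\<exists>k. \<forall>x\<in>S. wderiv (\<lambda>i. v (Suc i)) G n x = k"
    using Suc.prems(2)[of "Suc _"] by (intro Suc.IH[OF Suc.prems(1) _ *(3)]) simp
  then obtain k where k: "\<And>x. x \<in> S \<Longrightarrow> wderiv (\<lambda>i. v (Suc i)) G n x = k" by blast
  have "deriv (\<lambda>x. f x / v 0 x) x = G x" if "x \<in> S" for x
  proof -
    have "deriv (\<lambda>x. f x / v 0 x) x = deriv F x"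
      by (rule deriv_cong_open[OF Suc.prems(1) _ that]) (use * Suc.prems(2)[of 0] in auto)
    also have "\<dots> = G x" using *(2)[OF that] DERIV_imp_deriv by blast
    finally show ?thesis .
  qed
  then have "wderiv v f (Suc n) x = k" if "x \<in> S" for x
    unfolding wderiv_Suc_left using k[OF that]
      wderiv_cong_open[OF Suc.prems(1) _ that, of "deriv (\<lambda>x. f x / v 0 x)" G] by metis
  then show ?case by blast
qed

text \<open>The fundamental theorem needs a continuous integrand, and the inner integral is
  continuous because it is differentiable by induction.\<close>

lemma DERIV_iter_int:
  assumes "\<And>u. u \<in> set (v # vs) \<Longrightarrow> continuous_on UNIV u"
  shows "(iter_int (v # vs) has_real_derivative v x * iter_int vs x) (at x)"
  using assms
proof (induction vs arbitrary: v x)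
  have FTC: "((\<lambda>x. LBINT t=ereal 0..ereal x. h t) has_real_derivative h x) (at x)"
    if "continuous_on UNIV h" for h :: "real \<Rightarrow> real" and x
  proof -
    \<comment> \<open>The interval contains the base point 0 and has \<open>x\<close> in its
      interior, so the derivative within it is the two-sided one.\<close>
    let ?a = "min 0 x - 1" and ?b = "max 0 x + 1"
    have "((\<lambda>u. LBINT y=ereal 0..ereal u. h y) has_vector_derivative (h x)) (at x within {?a..?b})"
      by (rule interval_integral_FTC2[where a = ?a and b = ?b and c = 0]) (auto intro: continuous_on_subset[OF that])
    then have "((\<lambda>u. LBINT y=ereal 0..ereal u. h y) has_vector_derivative (h x)) (at x)"
      by (subst (asm) at_within_Icc_at) auto
    then show ?thesis by (simp add: has_real_derivative_iff_has_vector_derivative zero_ereal_def)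
  qed
  {
    case Nil
    have e: "iter_int [v] = (\<lambda>x. LBINT t=ereal 0..ereal x. v t * iter_int [] t)" by auto
    show ?case using FTC[of v x] Nil by (simp add: e del: iter_int.simps(2))
  next
    case (Cons u vs)
    have c: "continuous_on UNIV w" if "w \<in> set (u # vs)" for w
      using that by (intro Cons.prems) simp
    have "continuous_on UNIV (iter_int (u # vs))"
      by (intro continuous_at_imp_continuous_on ballI) (rule DERIV_isCont[OF Cons.IH[OF c]])
    then have "continuous_on UNIV (\<lambda>t. v t * iter_int (u # vs) t)"
      using Cons.prems by (intro continuous_on_mult) (auto simp del: iter_int.simps)
    from FTC[OF this, of x]
    have "((\<lambda>x. LBINT t=ereal 0..ereal x. v t * iter_int (u # vs) t) has_real_derivative
      v x * iter_int (u # vs) x) (at x)" .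
    moreover have "iter_int (v # u # vs) = (\<lambda>x. LBINT t=ereal 0..ereal x. v t * iter_int (u # vs) t)"
      by (rule ext) (rule iter_int.simps(2))
    ultimately show ?case by metis
  }
qed

text \<open>Differentiating the outermost integral gives weight 1 times an integral of the same
  shape over the shifted weights, which is the recursion of \<open>ECT\<close>. When the list is
  exhausted before level \<open>n\<close>, the derivative is 0 and \<open>ECT_zero\<close> fills the
  remaining levels.\<close>

lemma ECT_iter_int:
  "\<lbrakk>\<And>j. continuous_on UNIV (v j); k \<le> n\<rbrakk> \<Longrightarrow> ECT v n S (\<lambda>x. v 0 x * iter_int (map v [1..<Suc k]) x)"
proof (induction n arbitrary: v k)
  case 0
  then show ?case by auto
next
  case (Suc n)
  show ?case
  proof (cases k)
    case 0
    show ?thesis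
      by (rule ECT_SucI[where F = "\<lambda>_. 1" and G = "\<lambda>_. 0"]) (simp_all add: 0 ECT_zero)
  next
    case (Suc k')
    define vs where "vs = map (\<lambda>i. v (Suc i)) [1..<Suc k']"
    have e: "map v [1..<Suc k] = v 1 # vs"
    proof -
      have "1 < Suc k" using Suc by simp
      from upt_conv_Cons[OF this] have "[1..<Suc k] = 1 # map Suc [1..<k]"
        unfolding map_Suc_upt .
      then have "map v [1..<Suc k] = v 1 # map v (map Suc [1..<k])" by (rule arg_cong[THEN trans]) (rule list.map(2))
      then show ?thesis unfolding vs_def map_map comp_def Suc .
    qed
    have c: "continuous_on UNIV u" if "u \<in> set (v 1 # vs)" for u
      using that Suc.prems(1) by (auto simp: vs_def)
    have "\<forall>x\<in>S. v 0 x * iter_int (map v [1..<Suc k]) x = v 0 x * iter_int (v 1 # vs) x \<and>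
        (iter_int (v 1 # vs) has_real_derivative v 1 x * iter_int vs x) (at x)"
      unfolding e by (intro ballI conjI refl DERIV_iter_int[OF c])
    moreover have "ECT (\<lambda>i. v (Suc i)) n S (\<lambda>x. v (Suc 0) x * iter_int vs x)"
      unfolding vs_def by (rule Suc.IH[OF Suc.prems(1)]) (use Suc.prems(2) Suc in simp)
    ultimately show ?thesis unfolding One_nat_def by (intro ECT_SucI[where F = "iter_int (v (Suc 0) # vs)"]) blast+
  qed
qed

section \<open>Rolle chains\<close>

text \<open>A mean value argument that tolerates corners at the integers: finitely many exceptional
  points do not disturb the fundamental theorem, so a derivative that is nonpositive elsewhere would
  give \<open>F b \<le> F a\<close>.\<close>

lemma exists_pos_derivative_nonint:
  fixes F :: "real \<Rightarrow> real"
  assumes "a < b" "continuous_on {a..b} F" "F a < F b"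
    and d: "\<And>x. a < x \<Longrightarrow> x < b \<Longrightarrow> x \<notin> \<int> \<Longrightarrow> (F has_real_derivative F' x) (at x)"
  obtains x where "a < x" "x < b" "x \<notin> \<int>" "F' x > 0"
proof (rule ccontr)
  assume "\<not> thesis"
  with that have n: "F' x \<le> 0" if "a < x" "x < b" "x \<notin> \<int>" for x
    using that by force
  define S where "S = {a..b} \<inter> \<int>"
  have "finite S" unfolding S_def using finite_int_segment[of a b]
    by (rule finite_subset[rotated]) auto
  moreover define G where "G x = (if x \<in> S \<or> x \<notin> {a<..<b} then 0 else F' x)" for x
  ultimately have "(G has_integral (F b - F a)) {a..b}"
    using assms
    by (intro fundamental_theorem_of_calculus_interior_strong[where S = S])
      (auto simp: S_def G_def has_real_derivative_iff_has_vector_derivative[symmetric])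
  then have "F b - F a \<le> 0"
    by (rule has_integral_le[OF _ has_integral_0]) (use n in \<open>auto simp: G_def S_def\<close>)
  with assms show False by simp
qed

text \<open>\<open>F j\<close> abstracts the \<open>j\<close>-th generalised derivative of a spline of order \<open>m\<close> with
  integer knots that vanishes to the left of the integer \<open>a\<close>.\<close>

locale rolle_system =
  fixes m :: nat and a :: int and F v :: "nat \<Rightarrow> real \<Rightarrow> real"
  assumes m: "m \<ge> 1"
    and cont: "\<And>j. Suc j < m \<Longrightarrow> continuous_on UNIV (F j)"
    and deriv: "\<And>j x. Suc j < m \<Longrightarrow> x \<notin> \<int> \<Longrightarrow>
      (F j has_real_derivative v (Suc j) x * F (Suc j) x) (at x)"
    and weight_pos: "\<And>j x. j < m \<Longrightarrow> v j x > 0"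
    and step: "\<And>x y. x \<notin> \<int> \<Longrightarrow> y \<notin> \<int> \<Longrightarrow> \<lfloor>x\<rfloor> = \<lfloor>y\<rfloor> \<Longrightarrow> F (m - 1) x = F (m - 1) y"
    and start: "\<And>j. Suc j < m \<Longrightarrow> F j (of_int a) = 0"
begin

text \<open>\<open>chain j N t\<close> counts \<open>N\<close> zeros of \<open>F j\<close> in \<open>[a, t)\<close>: \<open>m - 1 - j\<close> at \<open>a\<close>, and then sign
  changes and multiple zeros, which are separated by points where \<open>F j\<close> does not vanish.\<close>

inductive chain :: "nat \<Rightarrow> nat \<Rightarrow> real \<Rightarrow> bool" for j where
  base: "\<lbrakk>of_int a < t; t \<notin> \<int>; F j t \<noteq> 0\<rbrakk> \<Longrightarrow> chain j (m - 1 - j) t"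
| sign: "\<lbrakk>chain j N s; s < t; t \<notin> \<int>; F j s * F j t < 0\<rbrakk> \<Longrightarrow> chain j (Suc N) t"
| zero: "\<lbrakk>chain j N s; s < z; z < t; t \<notin> \<int>; F j t \<noteq> 0; j + n \<le> m; j + n = m \<longrightarrow> z \<notin> \<int>;
    \<And>i. i < n \<Longrightarrow> F (j + i) z = 0\<rbrakk> \<Longrightarrow> chain j (N + n) t"

lemma chainD: "chain j N t \<Longrightarrow> of_int a < t \<and> t \<notin> \<int> \<and> F j t \<noteq> 0 \<and> N \<ge> m - 1 - j"
  by (induction rule: chain.induct) auto

text \<open>A \<open>zero\<close> step of multiplicity 0 moves the end point without changing the
  count; its fictitious zero is the midpoint, and \<open>j < m\<close> keeps it clear of the
  restriction at integers.\<close>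

lemma chain_skip: "\<lbrakk>chain j N s; s < t; t \<notin> \<int>; F j t \<noteq> 0; j < m\<rbrakk> \<Longrightarrow> chain j N t"
  using chain.zero[of j N s "(s + t) / 2" t 0] by auto

text \<open>The factor \<open>e\<close> carries the wanted sign, so that increase and decrease are
  treated together; positive weights pass the sign of the derivative on to
  \<open>F (Suc j)\<close>.\<close>

lemma mvt_sign:
  assumes j: "Suc j < m" and "s < t" and "e * F j s < e * F j t"
  obtains x where "s < x" "x < t" "x \<notin> \<int>" "e * F (Suc j) x > 0"
proof -
  have "continuous_on {s..t} (\<lambda>x. e * F j x)"
    using cont[OF j] by (intro continuous_on_mult_left) (auto intro: continuous_on_subset)
  then obtain x where "s < x" "x < t" "x \<notin> \<int>" "e * (v (Suc j) x * F (Suc j) x) > 0"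
    using exists_pos_derivative_nonint[of s t "\<lambda>x. e * F j x" "\<lambda>x. e * (v (Suc j) x * F (Suc j) x)"]
      assms deriv[OF j] by (metis DERIV_cmult)
  moreover from this have "e * F (Suc j) x > 0" 
    using weight_pos[OF j, of x] by (simp add: zero_less_mult_iff) (auto simp: mult_less_0_iff)
  ultimately show ?thesis using that by blast
qed

text \<open>Rolle's theorem costs one zero. The induction works because of the second conjunct: the
  new chain ends with the sign that \<open>F j\<close> has at the end of the old one, so a sign
  change of \<open>F j\<close> becomes a sign change of \<open>F (Suc j)\<close>.\<close>

lemma chain_Rolle:
  assumes "chain j N t" "Suc j < m"
  shows "\<exists>s<t. chain (Suc j) (N - 1) s \<and> F (Suc j) s * F j t > 0"
  using assms(1)
proof (induction rule: chain.induct)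
  case (base t)
  have "F j t * F j (of_int a) < F j t * F j t"
    using start[OF assms(2)] base by (auto simp: zero_less_mult_iff)
  from mvt_sign[OF assms(2) base(1) this] obtain x where
    x: "of_int a < x" "x < t" "x \<notin> \<int>" "F j t * F (Suc j) x > 0" by blast
  have "chain (Suc j) (m - 1 - Suc j) x" using x by (intro chain.base) auto
  moreover have "m - 1 - Suc j = m - 1 - j - 1" by simp
  ultimately show ?case using x by (auto intro!: exI[of _ x] simp: mult.commute)
next
  case (sign N s t)
  then obtain s' where s': "s' < s" "chain (Suc j) (N - 1) s'" "F (Suc j) s' * F j s > 0" by blast
  have "F j t * F j s < F j t * F j t"
    using sign by (smt (verit) mult.commute not_real_square_gt_zero mult_eq_0_iff)
  from mvt_sign[OF assms(2) sign(2) this] obtain x where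
    x: "s < x" "x < t" "x \<notin> \<int>" "F j t * F (Suc j) x > 0" by blast
  show ?case
  proof (cases "N = 0")
    case True
    have "chain (Suc j) (N - 1) x"
      by (rule chain_skip[OF s'(2)]) (use x s' assms in auto)
    then show ?thesis using x True by (auto intro!: exI[of _ x] simp: mult.commute)
  next
    case False
    have "F (Suc j) s' * F (Suc j) x < 0"
      using s'(3) x(4) sign(4) by (auto simp: zero_less_mult_iff mult_less_0_iff)
    from chain.sign[OF s'(2) _ x(3) this] have "chain (Suc j) N x" using s' x False by auto
    then show ?thesis using x by (auto intro!: exI[of _ x] simp: mult.commute)
  qed
next
  case (zero N s z t n)
  then obtain s' where s': "s' < s" "chain (Suc j) (N - 1) s'" "F (Suc j) s' * F j s > 0" by blast
  have N: "N \<ge> 1" using chainD[OF zero(1)] assms(2) by auto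
  show ?case
  proof (cases n)
    case 0
    show ?thesis
    proof (cases "F j s * F j t > 0")
      case True
      then have "F (Suc j) s' * F j t > 0" using s'(3)
        by (auto simp: zero_less_mult_iff)
      then show ?thesis using s' zero 0 by (auto intro!: exI[of _ s'])
    next
      \<comment> \<open>A sign change that the chain did not count: only the sign at the end point
        has to be repaired, while the count stays.\<close>
      case False
      have "F j s \<noteq> 0" using s'(3) by auto
      with False zero.hyps(5) have "F j s * F j t < 0" by (auto simp: not_less le_less)
      then have "F j t * F j s < F j t * F j t"
        by (smt (verit) mult.commute not_real_square_gt_zero mult_eq_0_iff)
      from mvt_sign[OF assms(2) _ this] obtain x where
        x: "s < x" "x < t" "x \<notin> \<int>" "F j t * F (Suc j) x > 0" using zero by auto
      have "chain (Suc j) (N - 1) x"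
        by (rule chain_skip[OF s'(2)]) (use x s' assms in auto)
      then show ?thesis using x 0 by (auto intro!: exI[of _ x] simp: mult.commute)
    qed
  next
    case (Suc k)
    have z0: "F j z = 0" using zero.hyps(8)[of 0] Suc by simp
    have "F j s \<noteq> 0" using s'(3) by auto
    \<comment> \<open>On the way to its zero \<open>z\<close>, \<open>F j\<close> moves against the
      sign of \<open>F j s\<close>, and behind \<open>z\<close> it moves towards
      \<open>F j t\<close>. So the next level has a sign change before \<open>z\<close>, which makes
      up for the one zero lost, and still a zero of multiplicity \<open>n - 1\<close> at
      \<open>z\<close>.\<close>
    then have "(- F j s) * F j s < (- F j s) * F j z"
      using z0 by (auto simp: zero_less_mult_iff)
    from mvt_sign[OF assms(2) zero(2) this] obtain x where
      x: "s < x" "x < z" "x \<notin> \<int>" "(- F j s) * F (Suc j) x > 0" by blast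
    have "F j t * F j z < F j t * F j t"
      using z0 zero.hyps(5) by (auto simp: zero_less_mult_iff)
    from mvt_sign[OF assms(2) zero(3) this] obtain y where
      y: "z < y" "y < t" "y \<notin> \<int>" "F j t * F (Suc j) y > 0" by blast
    have "F (Suc j) s' * F (Suc j) x < 0"
      using s'(3) x(4) by (auto simp: zero_less_mult_iff mult_less_0_iff)
    from chain.sign[OF s'(2) _ x(3) this] have "chain (Suc j) N x" using s' x N by auto
    then have "chain (Suc j) (N + k) y"
    proof (rule chain.zero[OF _ x(2) y(1) y(3)])
      show "F (Suc j + i) z = 0" if "i < k" for i
        using zero.hyps(8)[of "Suc i"] that Suc by simp
    qed (use y zero Suc in auto)
    then show ?thesis using y Suc by (auto intro!: exI[of _ y] simp: mult.commute)
  qed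
qed

text \<open>The last level is constant between consecutive integers, so every sign change and every
  non-integer zero next to a nonzero value forces the chain across an integer.\<close>

lemma chain_last:
  assumes "chain (m - 1) N t"
  shows "\<lfloor>t\<rfloor> \<ge> a + int N"
  using assms
proof (induction rule: chain.induct)
  case (base t)
  then show ?case by simp linarith
next
  case (sign N s t)
  have "\<lfloor>s\<rfloor> \<noteq> \<lfloor>t\<rfloor>"
    using step[of s t] chainD[OF sign(1)] sign(3,4) by (metis not_square_less_zero)
  moreover have "\<lfloor>s\<rfloor> \<le> \<lfloor>t\<rfloor>" using sign by (simp add: floor_mono)
  ultimately show ?case using sign by simp
next
  case (zero N s z t n)
  have mono: "\<lfloor>s\<rfloor> \<le> \<lfloor>z\<rfloor>" "\<lfloor>z\<rfloor> \<le> \<lfloor>t\<rfloor>" using zero by (simp_all add: floor_mono)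
  consider "n = 0" | "n = 1" using zero.hyps m by linarith
  then show ?case
  proof cases
    case 1
    then show ?thesis using zero mono by simp
  next
    case 2
    then have "F (m - 1) z = 0" "z \<notin> \<int>" using zero m by (auto dest: spec[of _ 0])
    then have "\<lfloor>z\<rfloor> \<noteq> \<lfloor>s\<rfloor>" using step[of z s] chainD[OF zero(1)] by auto
    then show ?thesis using zero mono 2 by simp
  qed
qed

text \<open>A final zero \<open>y\<close> cannot enter a chain, as no nonvanishing point behind it
  is known. It is carried along instead: at each application of Rolle's theorem the approach to
  \<open>y\<close> creates a further sign change, so \<open>N\<close> grows by one while the
  multiplicity \<open>n\<close> drops by one.\<close>

lemma chain_end:
  assumes "chain j (m - 1 - j + N) t" "t < y" "j + n \<le> m" "j + n = m \<longrightarrow> y \<notin> \<int>" "j < m"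
    "\<And>i. i < n \<Longrightarrow> F (j + i) y = 0"
  shows "y > of_int a + real N + real n"
  using assms
proof (induction "m - 1 - j" arbitrary: j N t n)
  case 0
  then have j: "j = m - 1" by simp
  have t: "\<lfloor>t\<rfloor> \<ge> a + int N" "\<lfloor>t\<rfloor> \<le> \<lfloor>y\<rfloor>" using chain_last 0 j by (auto intro: floor_mono)
  consider "n = 0" | "n = 1" using 0 by linarith
  then show ?case
  proof cases
    case 1
    then show ?thesis using t 0(3) by simp linarith
  next
    case 2
    then have z: "F (m - 1) y = 0" "y \<notin> \<int>" using 0 j by auto
    then have "\<lfloor>y\<rfloor> \<noteq> \<lfloor>t\<rfloor>" using step[of y t] chainD[OF 0(2)] j by auto
    then have "\<lfloor>y\<rfloor> \<ge> a + int N + 1" using t by linarith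
    moreover have "y \<noteq> of_int \<lfloor>y\<rfloor>" using z(2) by (metis Ints_of_int)
    ultimately show ?thesis using 2 by simp linarith
  qed
next
  case (Suc d)
  have j: "Suc j < m" using Suc(2) by linarith
  obtain s where s: "s < t" "chain (Suc j) (m - 1 - j + N - 1) s" "F (Suc j) s * F j t > 0"
    using chain_Rolle[OF Suc.prems(1) j] by blast
  have e: "m - 1 - j + N - 1 = m - 1 - Suc j + N" using j by simp
  show ?case
  proof (cases n)
    case 0
    have "y > of_int a + real N + real 0"
      by (rule Suc(1)[of "Suc j" N s 0]) (use Suc.hyps s e j Suc.prems 0 in auto)
    then show ?thesis using 0 by simp
  next
    case n: (Suc k)
    have z0: "F j y = 0" using Suc.prems(6)[of 0] n by simp
    have "F j t \<noteq> 0" using s by auto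
    then have "(- F j t) * F j t < (- F j t) * F j y"
      using z0 by (auto simp: zero_less_mult_iff)
    from mvt_sign[OF j Suc.prems(2) this] obtain x where
      x: "t < x" "x < y" "x \<notin> \<int>" "(- F j t) * F (Suc j) x > 0" by blast
    have "F (Suc j) s * F (Suc j) x < 0"
      using s(3) x(4) by (auto simp: zero_less_mult_iff mult_less_0_iff)
    from chain.sign[OF s(2) _ x(3) this] have c: "chain (Suc j) (m - 1 - Suc j + Suc N) x"
      using s x e by auto
    have "y > of_int a + real (Suc N) + real k"
    proof (rule Suc(1)[of "Suc j" "Suc N" x k])
      show "F (Suc j + i) y = 0" if "i < k" for i
        using Suc.prems(6)[of "Suc i"] that n by simp
    qed (use Suc.hyps c x j Suc.prems n in auto)
    then show ?thesis using n by simp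
  qed
qed

end

section \<open>Zeros of splines and uniqueness\<close>

lemma nonint_floor:
  fixes x :: real
  assumes "x \<notin> \<int>"
  shows "of_int \<lfloor>x\<rfloor> < x" "x < of_int \<lfloor>x\<rfloor> + 1"
proof -
  have "x \<noteq> of_int \<lfloor>x\<rfloor>" using assms by (metis Ints_of_int)
  then show "of_int \<lfloor>x\<rfloor> < x" "x < of_int \<lfloor>x\<rfloor> + 1" by linarith+
qed

abbreviation seg :: "int \<Rightarrow> real set" where
  "seg n \<equiv> {of_int n<..<of_int n + 1}"

lemma seg_nonint: "x \<in> seg n \<Longrightarrow> x \<notin> \<int>"
  by (auto elim!: Ints_cases)

lemma nderiv_const_0: "nderiv s (\<lambda>x::real. 0::real) = (\<lambda>x. 0)"
  by (induction s) (auto simp: nderiv_Suc)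

lemma nderiv_eq_0_of_left:
  fixes f :: "real \<Rightarrow> real"
  assumes "continuous_on UNIV (nderiv s f)" "\<And>x. x < a \<Longrightarrow> f x = 0"
  shows "nderiv s f a = 0"
proof -
  have "nderiv s f x = 0" if "x < a" for x
    using nderiv_cong_open[of "{..<a}" f "\<lambda>_. 0" x s] assms(2) that by (simp add: nderiv_const_0)
  moreover have "closed {x. nderiv s f x = 0}"
    by (rule closed_Collect_eq[OF assms(1)]) auto
  ultimately have "closure {..<a} \<subseteq> {x. nderiv s f x = 0}"
    by (intro closure_minimal) auto
  then show ?thesis by (auto simp: closure_lessThan)
qed

section \<open>The B-spline and finite combinations of its integer shifts\<close>

locale peb =
  fixes m :: nat and w :: "nat \<Rightarrow> real \<Rightarrow> real" and \<phi> :: "real \<Rightarrow> real"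
  assumes m2: "m \<ge> 2" and spline: "PEB_spline m w \<phi>"
begin

text \<open>The tail is padded by constants so that positivity and smoothness hold for all indices.\<close>

definition v :: "nat \<Rightarrow> real \<Rightarrow> real" where
  "v j = (if j < m then w (Suc j) else (\<lambda>_. 1))"

lemma weight:
  assumes "j < m"
  obtains g r where "Ck_on (m - 1 - j) UNIV r" "\<And>x. r x > 0" "\<And>x. r (x + 1) = r x"
    "\<And>x. v j x = exp (g * x) * r x"
proof -
  have "Suc j \<in> {1..m}" using assms by simp
  then obtain g r where *: "C_k (m - Suc j) r" "\<forall>x. r x > 0" "\<forall>x. r (x + 1) = r x"
    "\<forall>x. w (Suc j) x = exp (g * x) * r x"
    using spline unfolding PEB_spline_def PEB_weights_def by blast
  show ?thesis
    by (rule that[of r g]) (use * assms C_k_imp_Ck_on in \<open>auto simp: v_def\<close>)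
qed

lemma v_pos: "v j x > 0"
proof (cases "j < m")
  case True
  then show ?thesis by (rule weight) simp
qed (simp add: v_def)

lemma v_Ck_on: "k \<le> m - 1 - j \<Longrightarrow> Ck_on k S (v j)"
proof (cases "j < m")
  case True
  assume k: "k \<le> m - 1 - j"
  from True obtain g r where *: "Ck_on (m - 1 - j) UNIV r" "\<And>x. v j x = exp (g * x) * r x"
    using weight by metis
  have "Ck_on (m - 1 - j) UNIV (v j)"
    unfolding *(2)[abs_def] by (intro Ck_on_mult Ck_on_exp *)
  then show ?thesis using Ck_on_le[OF _ k] Ck_on_subset by blast
qed (simp add: v_def Ck_on_const)

lemma v_continuous_on: "continuous_on S (v j)"
  using v_Ck_on[of 0] by simp

lemma v_shift: "\<exists>l. \<forall>j x. v j (x - of_int n) = l j * v j x"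
proof -
  have "\<exists>l. \<forall>x. v j (x - of_int n) = l * v j x" for j
  proof (cases "j < m")
    case True
    then obtain g r where *: "\<And>x. r (x + 1) = r x" "\<And>x. v j x = exp (g * x) * r x"
      using weight by metis
    have p: "r (x - of_int n) = r x" for x n
    proof (induction n rule: int_induct[of _ 0])
      case (step1 i)
      then show ?case using *(1)[of "x - of_int (i + 1)"] by simp
    next
      case (step2 i)
      then show ?case using *(1)[of "x - of_int i"] by (simp add: algebra_simps)
    qed simp
    show ?thesis
      by (rule exI[of _ "exp (- g * of_int n)"])
        (simp add: * p exp_add[symmetric] algebra_simps)
  qed (auto simp: v_def)
  then show ?thesis by metis
qed

lemma \<phi>_pos: "0 < x \<Longrightarrow> x < real m \<Longrightarrow> \<phi> x > 0"
  using spline unfolding PEB_spline_def by auto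

lemma \<phi>_Ck_on: "Ck_on (m - 2) UNIV \<phi>"
  using spline m2 unfolding PEB_spline_def by (auto intro: C_k_imp_Ck_on)

lemma \<phi>_continuous_on: "continuous_on S \<phi>"
  using Ck_on_continuous_on[OF \<phi>_Ck_on] continuous_on_subset by blast

text \<open>The support settles the points outside \<open>[0, m]\<close>; at 0 and \<open>m\<close>
  the value is 0 by continuity, which \<open>m \<ge> 2\<close> guarantees.\<close>

lemma \<phi>_eq_0: "x \<le> 0 \<or> x \<ge> real m \<Longrightarrow> \<phi> x = 0"
proof -
  have s: "\<phi> x = 0" if "x < 0 \<or> x > real m" for x
    using spline closure_subset[of "{x. \<phi> x \<noteq> 0}"] that unfolding PEB_spline_def by force
  have c: "closed {x. \<phi> x = 0}"
    by (rule closed_Collect_eq) (auto simp: \<phi>_continuous_on)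
  have "closure {..<0} \<subseteq> {x. \<phi> x = 0}" "closure {real m<..} \<subseteq> {x. \<phi> x = 0}"
    by (rule closure_minimal[OF _ c]; use s in auto)+
  then show "x \<le> 0 \<or> x \<ge> real m \<Longrightarrow> \<phi> x = 0"
    by (auto simp: closure_lessThan closure_greaterThan)
qed

lemma \<phi>_ECT: "ECT v (m - 1) (seg n) \<phi>"
proof -
  obtain g where g: "g \<in> U_space w m" "\<forall>x\<in>seg n. complex_of_real (\<phi> x) = g x"
    using spline unfolding PEB_spline_def by blast
  then obtain c :: "nat \<Rightarrow> complex" where
    c: "g = (\<lambda>x. \<Sum>s=1..m. c s * complex_of_real (u_fun w s x))"
    unfolding U_space_def by blast
  have u: "ECT v (m - 1) (seg n) (u_fun w s)" if s: "s \<in> {1..m}" for s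
  proof -
    obtain k where k: "s = Suc k" using s by (cases s) auto
    have "map w [2..<Suc s] = map v [1..<Suc k]"
    proof -
      have "[2..<Suc s] = map Suc [1..<Suc k]" unfolding map_Suc_upt k by (simp add: numeral_2_eq_2)
      then have "map w [2..<Suc s] = map w (map Suc [1..<Suc k])" by (rule arg_cong)
      also have "\<dots> = map (w \<circ> Suc) [1..<Suc k]" by (rule map_map)
      also have "\<dots> = map v [1..<Suc k]"
        by (rule map_cong[OF refl]) (use s k in \<open>auto simp: v_def simp del: upt_Suc\<close>)
      finally show ?thesis .
    qed
    then have e: "u_fun w s = (\<lambda>x. v 0 x * iter_int (map v [1..<Suc k]) x)"
      unfolding u_fun_def using m2 by (simp add: v_def del: upt_Suc)
    show ?thesis unfolding e
      by (rule ECT_iter_int[OF v_continuous_on]) (use s k in auto)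
  qed
  \<comment> \<open>As \<open>\<phi>\<close> and the functions \<open>u_fun w s\<close> are real,
    the complex coefficients may be replaced by their real parts.\<close>
  have "ECT v (m - 1) (seg n) (\<lambda>x. \<Sum>s=1..m. Re (c s) * u_fun w s x)"
    by (intro ECT_sum ECT_cmult u)
  moreover have "(\<Sum>s=1..m. Re (c s) * u_fun w s x) = \<phi> x" if "x \<in> seg n" for x
  proof -
    have "\<phi> x = Re (g x)" using g that by (metis Re_complex_of_real)
    then show ?thesis by (simp add: c)
  qed
  ultimately show ?thesis by (rule ECT_cong[rotated])
qed

definition spl :: "int set \<Rightarrow> (int \<Rightarrow> real) \<Rightarrow> real \<Rightarrow> real" where
  "spl A c x = (\<Sum>l\<in>A. c l * \<phi> (x - of_int l))"

lemma \<phi>_shift_Ck_on: "Ck_on (m - 2) UNIV (\<lambda>x. \<phi> (x - of_int l))"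
  by (rule Ck_on_shift[OF \<phi>_Ck_on]) auto

lemma \<phi>_shift_ECT: "ECT v (m - 1) (seg n) (\<lambda>x. \<phi> (x - of_int l))"
proof -
  from v_shift[of l] obtain k where "\<And>j x. v j (x - of_int l) = k j * v j x" by blast
  then show ?thesis by (intro ECT_shift[OF \<phi>_ECT[of "n - l"], of _ _ k]) auto
qed

lemma \<phi>_shift_Ck_on_seg: "Ck_on (m - 1) (seg n) (\<lambda>x. \<phi> (x - of_int l))"
  by (rule ECT_Ck_on[OF _ _ \<phi>_shift_ECT]) (auto intro: v_Ck_on)

lemma spl_Ck_on: "Ck_on (m - 2) UNIV (spl A c)"
  unfolding spl_def[abs_def] by (intro Ck_on_sum Ck_on_cmult \<phi>_shift_Ck_on)

lemma spl_Ck_on_seg: "Ck_on (m - 1) (seg n) (spl A c)"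
  unfolding spl_def[abs_def] by (intro Ck_on_sum Ck_on_cmult \<phi>_shift_Ck_on_seg)

lemma spl_ECT: "ECT v (m - 1) (seg n) (spl A c)"
  unfolding spl_def[abs_def] by (intro ECT_sum ECT_cmult \<phi>_shift_ECT)

text \<open>Every shift involved starts at or after \<open>a\<close>, so the spline vanishes on the
  left of \<open>a\<close> and, being of class m - 2, has a zero of order m - 1 there. Global
  smoothness controls all levels but the last; smoothness on the unit segments gives the last
  one.\<close>

lemma spl_rolle_system:
  assumes "\<And>l. l \<in> A \<Longrightarrow> a \<le> l"
  shows "rolle_system m a (wderiv v (spl A c)) v"
proof
  show "m \<ge> 1" using m2 by simp
  show "continuous_on UNIV (wderiv v (spl A c) j)" if "Suc j < m" for j
  proof -
    have "Ck_on (m - 2 - j) UNIV (wderiv v (spl A c) j)"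
      by (rule Ck_on_wderiv[OF _ spl_Ck_on])
        (use that v_pos in \<open>auto intro!: v_Ck_on simp: less_imp_neq[THEN not_sym]\<close>)
    then show ?thesis by (rule Ck_on_continuous_on)
  qed
  show "(wderiv v (spl A c) j has_real_derivative v (Suc j) x * wderiv v (spl A c) (Suc j) x) (at x)"
    if "Suc j < m" "x \<notin> \<int>" for j x
    by (rule DERIV_wderiv[OF _ spl_Ck_on_seg[of "\<lfloor>x\<rfloor>"]])
      (use that v_pos nonint_floor in \<open>auto intro!: v_Ck_on simp: less_imp_neq[THEN not_sym]\<close>)
  show "v j x > 0" for j x by (rule v_pos)
  show "wderiv v (spl A c) (m - 1) x = wderiv v (spl A c) (m - 1) y"
    if "x \<notin> \<int>" "y \<notin> \<int>" "\<lfloor>x\<rfloor> = \<lfloor>y\<rfloor>" for x y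
  proof -
    have "\<exists>k. \<forall>z\<in>seg \<lfloor>x\<rfloor>. wderiv v (spl A c) (m - 1) z = k"
      by (rule ECT_wderiv_const[OF _ _ spl_ECT]) (use v_pos in \<open>auto simp: less_imp_neq[THEN not_sym]\<close>)
    moreover have "x \<in> seg \<lfloor>x\<rfloor>" "y \<in> seg \<lfloor>x\<rfloor>"
      using nonint_floor[OF that(1)] nonint_floor[OF that(2)] that(3) by auto
    ultimately show ?thesis by metis
  qed
  show "wderiv v (spl A c) j (of_int a) = 0" if "Suc j < m" for j
  proof (rule wderiv_eq_0[OF _ spl_Ck_on])
    show "nderiv s (spl A c) (of_int a) = 0" if "s \<le> m - 2" for s
    proof (rule nderiv_eq_0_of_left)
      show "continuous_on UNIV (nderiv s (spl A c))"
        by (rule Ck_on_nderiv_continuous_on[OF _ spl_Ck_on that]) simp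
      show "spl A c x = 0" if "x < of_int a" for x
        unfolding spl_def using that assms by (intro sum.neutral) (force intro!: \<phi>_eq_0)
    qed
  qed (use that v_pos in \<open>auto intro!: v_Ck_on simp: less_imp_neq[THEN not_sym]\<close>)
qed

text \<open>Order \<open>m\<close> involves the derivative of order m - 1, which may jump at
  integers; hence the restriction on \<open>y\<close>.\<close>

definition zero_order :: "(real \<Rightarrow> real) \<Rightarrow> nat \<Rightarrow> real \<Rightarrow> bool" where
  "zero_order f n y \<longleftrightarrow> n \<le> m \<and> (n = m \<longrightarrow> y \<notin> \<int>) \<and> (\<forall>s<n. nderiv s f y = 0)"

lemma zero_order_cong:
  assumes "open S" "\<And>x. x \<in> S \<Longrightarrow> f x = g x" "y \<in> S"
  shows "zero_order f n y \<longleftrightarrow> zero_order g n y"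
  unfolding zero_order_def using nderiv_cong_open[OF assms] by simp

text \<open>For \<open>n = m\<close> the smoothness on the unit segment around \<open>y\<close> is
  used; for smaller \<open>n\<close> global smoothness suffices, and \<open>y\<close> may be an
  integer.\<close>

lemma zero_order_wderiv:
  assumes "zero_order (spl A c) n y" "i < n"
  shows "wderiv v (spl A c) i y = 0"
proof (cases "n = m")
  case True
  then have y: "y \<notin> \<int>" using assms by (simp add: zero_order_def)
  show ?thesis
    by (rule wderiv_eq_0[OF _ spl_Ck_on_seg[of "\<lfloor>y\<rfloor>"]])
      (use assms True nonint_floor[OF y] v_pos in
        \<open>auto intro!: v_Ck_on simp: zero_order_def less_imp_neq[THEN not_sym]\<close>)
next
  case False
  then have "n - 1 \<le> m - 2" using assms unfolding zero_order_def by linarith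
  then show ?thesis
    by (intro wderiv_eq_0[OF _ Ck_on_le[OF spl_Ck_on], of "n - 1"])
      (use v_pos assms in \<open>auto intro!: v_Ck_on simp: zero_order_def less_imp_neq[THEN not_sym]\<close>)
qed

lemma spl_first:
  assumes "finite A" "a \<in> A" "\<And>l. l \<in> A \<Longrightarrow> a \<le> l" "x \<in> seg a"
  shows "spl A c x = c a * \<phi> (x - of_int a)"
proof -
  have "\<phi> (x - of_int l) = 0" if "l \<in> A" "l \<noteq> a" for l
  proof -
    have "l \<ge> a + 1" using that assms(3)[of l] by simp
    then have "of_int l \<ge> (of_int (a + 1) :: real)" by (simp only: of_int_le_iff)
    then show ?thesis using assms(4) by (intro \<phi>_eq_0) auto
  qed
  then have "spl A c x = (\<Sum>l\<in>A. if l = a then c a * \<phi> (x - of_int a) else 0)"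
    unfolding spl_def by (intro sum.cong) auto
  then show ?thesis using assms(1,2) by simp
qed

text \<open>The zero count with a single zero behind the start. It serves twice: with
  \<open>n = m\<close> for local linear independence, and with the multiplicity of a sample for the
  propagation of zero blocks.\<close>

lemma spl_no_early_zero:
  assumes "finite A" "a \<in> A" "\<And>l. l \<in> A \<Longrightarrow> a \<le> l" "c a \<noteq> 0"
    and z: "zero_order (spl A c) n y" and y: "y > of_int a"
  shows "y > of_int a + real n"
proof -
  interpret rolle_system m a "wderiv v (spl A c)" v by (rule spl_rolle_system) (use assms in auto)
  \<comment> \<open>A point before \<open>y\<close> in the first unit segment, where only the shift
    by \<open>a\<close> is active and the spline is therefore nonzero.\<close>
  define t where "t = (of_int a + min y (of_int a + 1)) / 2"
  have t: "t \<in> seg a" "t < y" "of_int a < t" unfolding t_def using y by (auto simp: min_def)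
  have "spl A c t \<noteq> 0"
    using spl_first[OF assms(1-3) t(1)] assms(4) \<phi>_pos[of "t - of_int a"] t(1) m2 by auto
  then have "chain 0 (m - 1 - 0) t"
    using t seg_nonint[OF t(1)] v_pos[of 0 t] by (intro base) auto
  then have "y > of_int a + real 0 + real n"
    by (intro chain_end[of 0 0 t y n])
      (use z t m2 zero_order_wderiv[OF z] in \<open>auto simp: zero_order_def\<close>)
  then show ?thesis by simp
qed

lemma spl_eq_subset:
  assumes "finite A" "B \<subseteq> A" "\<And>l. l \<in> A - B \<Longrightarrow> c l = 0 \<or> x \<le> of_int l \<or> x \<ge> of_int l + real m"
  shows "spl A c x = spl B c x"
  unfolding spl_def
proof (rule sum.mono_neutral_right[OF assms(1,2)], rule ballI)
  fix l assume "l \<in> A - B"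
  from assms(3)[OF this] show "c l * \<phi> (x - of_int l) = 0" by (auto intro: \<phi>_eq_0)
qed

text \<open>Shifts that are not active on \<open>seg n\<close> are dropped, as are zero
  coefficients. If \<open>a\<close> is the first index left, then a point \<open>y\<close> of the
  interval is a zero of order \<open>m\<close>, hence \<open>y > a + m \<ge> n + 1\<close>, beyond
  the segment.\<close>

lemma spl_local_independence:
  assumes A: "finite A" and ab: "\<alpha> < \<beta>" "{\<alpha><..<\<beta>} \<subseteq> seg n"
    and z: "\<And>x. x \<in> {\<alpha><..<\<beta>} \<Longrightarrow> spl A c x = 0"
    and l: "l \<in> A" "n - int m < l" "l \<le> n"
  shows "c l = 0"
proof (rule ccontr)
  assume "c l \<noteq> 0"
  define B where "B = {l \<in> A. n - int m < l \<and> l \<le> n \<and> c l \<noteq> 0}"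
  have B: "finite B" "B \<noteq> {}" using A l \<open>c l \<noteq> 0\<close> by (auto simp: B_def)
  define a where "a = Min B"
  have a: "a \<in> B" "\<And>l. l \<in> B \<Longrightarrow> a \<le> l" using B by (auto simp: a_def)
  have e: "spl A c x = spl B c x" if "x \<in> seg n" for x
  proof (rule spl_eq_subset[OF A])
    fix l assume "l \<in> A - B"
    then have "c l = 0 \<or> l \<le> n - int m \<or> l \<ge> n + 1" by (auto simp: B_def)
    then have "c l = 0 \<or> real_of_int l \<le> real_of_int (n - int m) \<or> real_of_int l \<ge> real_of_int (n + 1)"
      by (simp only: of_int_le_iff)
    then show "c l = 0 \<or> x \<le> of_int l \<or> x \<ge> of_int l + real m" using that by auto
  qed (auto simp: B_def)
  define y where "y = (\<alpha> + \<beta>) / 2"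
  have y: "y \<in> {\<alpha><..<\<beta>}" using ab by (auto simp: y_def)
  with ab have "y \<in> seg n" by blast
  note y = y this
  have "zero_order (\<lambda>_. 0) m y"
    using seg_nonint[OF y(2)] by (auto simp: zero_order_def nderiv_const_0)
  then have "zero_order (spl B c) m y"
  proof (subst zero_order_cong[of "{\<alpha><..<\<beta>}" _ "\<lambda>_. 0"])
    show "spl B c x = 0" if "x \<in> {\<alpha><..<\<beta>}" for x
      using that e[of x] z[of x] ab(2) by auto
  qed (use y in auto)
  moreover have "of_int a < y"
  proof -
    have "a \<le> n" using a by (auto simp: B_def)
    then have "real_of_int a \<le> of_int n" by simp
    then show ?thesis using y by auto
  qed
  ultimately have "y > of_int a + real m"
    using a B by (intro spl_no_early_zero[of B a c]) (auto simp: B_def)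
  moreover have "a + int m \<ge> n + 1" using a by (auto simp: B_def)
  then have "real_of_int (a + int m) \<ge> real_of_int (n + 1)" by (simp only: of_int_le_iff)
  ultimately show False using y by auto
qed

text \<open>Induction on the right end \<open>k\<close> of the block. The shifts to the left of the
  block have ended by \<open>k\<close>, so a nonzero \<open>c (k + 1)\<close> would make the spline
  agree, to the right of \<open>k\<close>, with one that starts at \<open>k + 1\<close>; the next
  sample comes too early for that.\<close>

lemma zero_propagation:
  fixes y :: "nat \<Rightarrow> real" and \<nu> :: "nat \<Rightarrow> nat"
  assumes A: "finite A" and c: "\<And>l. l \<notin> A \<Longrightarrow> c l = 0"
    and \<rho>: "\<rho> < 1" and y0: "y 0 \<le> 0" and yJ: "y J > of_int K"
    and gap: "\<And>j. j < J \<Longrightarrow> y (Suc j) - y j \<le> \<rho> * real (\<nu> (Suc j)) \<and> \<nu> (Suc j) \<ge> 1"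
    and z: "\<And>j. j < J \<Longrightarrow> zero_order (spl A c) (\<nu> (Suc j)) (y (Suc j))"
    and i: "0 \<le> i" "i \<le> K" and blk: "\<And>l. i - int m < l \<Longrightarrow> l \<le> i \<Longrightarrow> c l = 0"
  shows "c K = 0"
proof -
  have "k \<le> K \<longrightarrow> (\<forall>l. i - int m < l \<longrightarrow> l \<le> k \<longrightarrow> c l = 0)" if "i \<le> k" for k
    using that
  proof (induction k rule: int_ge_induct)
    case base
    then show ?case using blk by blast
  next
    case (step k)
    have "c (k + 1) = 0" if k: "k + 1 \<le> K"
    proof (rule ccontr)
      assume nz: "c (k + 1) \<noteq> 0"
      define B where "B = A \<inter> {k + 1..}"
      have B: "finite B" "k + 1 \<in> B" using A nz c by (auto simp: B_def)
      have e: "spl A c x = spl B c x" if x: "x \<in> {of_int k<..}" for x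
      proof (rule spl_eq_subset[OF A])
        fix l assume "l \<in> A - B"
        then have "l \<le> k" by (auto simp: B_def)
        then consider "c l = 0" | "l + int m \<le> k" using step k i by force
        then show "c l = 0 \<or> x \<le> of_int l \<or> x \<ge> of_int l + real m"
        proof cases
          case 2
          then have "real_of_int (l + int m) \<le> of_int k" by (simp only: of_int_le_iff)
          then show ?thesis using x by auto
        qed simp
      qed (auto simp: B_def)
      \<comment> \<open>The first sample beyond \<open>k + 1\<close>. It has a predecessor since
        \<open>y 0 \<le> 0\<close>, and that predecessor is at most \<open>k + 1\<close>; so the
        sample lies within \<open>\<rho> * \<nu> j < \<nu> j\<close> of
        \<open>k + 1\<close>.\<close>
      define j where "j = (LEAST j. y j > of_int (k + 1))"
      have "real_of_int (k + 1) \<le> of_int K" using k by (simp only: of_int_le_iff)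
      then have ex: "y J > of_int (k + 1)" using yJ by simp
      have j: "y j > of_int (k + 1)" "j \<le> J"
        unfolding j_def using ex by (rule LeastI, rule Least_le)
      have k0: "0 \<le> real_of_int (k + 1)" using step i by (simp only: of_int_0_le_iff)
      then have "j \<noteq> 0" using j y0 by (metis not_less order_trans)
      then obtain j' where j': "j = Suc j'" by (cases j) auto
      have "y j' \<le> of_int (k + 1)" using not_less_Least[of j' "\<lambda>j. y j > of_int (k + 1)"]
        unfolding j_def[symmetric] j' by simp
      moreover have "y j - y j' \<le> \<rho> * real (\<nu> j)" "\<nu> j \<ge> 1" using gap[of j'] j j' by auto
      moreover have "\<rho> * real (\<nu> j) < real (\<nu> j)" using \<rho> \<open>\<nu> j \<ge> 1\<close> by simp
      moreover have "y j > of_int (k + 1) + real (\<nu> j)"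
      proof (rule spl_no_early_zero[where A = B and c = c])
        have "zero_order (spl A c) (\<nu> j) (y j)" using z[of j'] j j' by simp
        then show "zero_order (spl B c) (\<nu> j) (y j)"
          by (subst (asm) zero_order_cong[of "{of_int k<..}" _ "spl B c"]) (use e j in auto)
      qed (use B nz j in \<open>auto simp: B_def\<close>)
      ultimately show False by linarith
    qed
    then show ?case using step by (metis add_le_imp_le_right int_le_real_less less_le_not_le linorder_not_less zless_add1_eq)
  qed
  from this[OF i(2)] show ?thesis using i m2 by auto
qed

text \<open>A nonzero spline starting at \<open>a\<close> has its zero number \<open>N\<close> beyond \<open>a + N\<close>, while
  the gap condition forces the zeros to be denser than that in the long run.\<close>

lemma sample_uniqueness:
  fixes y :: "nat \<Rightarrow> real" and \<nu> :: "nat \<Rightarrow> nat"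
  assumes A: "finite A" and c: "\<And>l. l \<notin> A \<Longrightarrow> c l = 0"
    and \<rho>: "0 < \<rho>" "\<rho> < 1" and y0: "y 0 \<le> 0" and yJ: "y J > of_int K"
    and mono: "\<And>j. j < J \<Longrightarrow> y j < y (Suc j)"
    and gap: "\<And>j. j < J \<Longrightarrow> y (Suc j) - y j \<le> \<rho> * real (\<nu> (Suc j)) \<and> \<nu> (Suc j) \<ge> 1"
    and z: "\<And>j. j < J \<Longrightarrow> zero_order (spl A c) (\<nu> (Suc j)) (y (Suc j))"
    and K: "of_int K \<ge> (real m - 1) / (1 - \<rho>)"
  shows "c K = 0"
proof (rule ccontr)
  assume nz: "c K \<noteq> 0"
  define R where "R = (real m - 1) / (1 - \<rho>)"
  have R: "real m - 1 \<le> R"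
  proof -
    have "(real m - 1) * (1 - \<rho>) \<le> (real m - 1) * 1" using \<rho> m2 by (intro mult_left_mono) auto
    then show ?thesis unfolding R_def using \<rho> by (simp add: pos_le_divide_eq)
  qed
  have "real m - 1 \<le> of_int K" using R K R_def by linarith
  then have mK: "int m - 1 \<le> K" by linarith
  have no_blk: "\<exists>l. i - int m < l \<and> l \<le> i \<and> c l \<noteq> 0" if "0 \<le> i" "i \<le> K" for i
    using zero_propagation[OF A c \<rho>(2) y0 yJ gap z that] nz by blast
  \<comment> \<open>Shifts with a negative index have ended by m - 1. The coefficients at 0, ..., m
    - 1 do not all vanish, and the first nonzero one of them, at \<open>a\<close>, starts the spline
    whose zeros are counted.\<close>
  define D where "D = {l. 0 \<le> l \<and> l \<le> int m - 1 \<and> c l \<noteq> 0}"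
  have D: "finite D" "D \<noteq> {}" using no_blk[of "int m - 1"] mK m2 by (auto simp: D_def intro: finite_subset[of _ "{0..int m - 1}"])
  define a where "a = Min D"
  have aD: "a \<in> D" "\<And>l. l \<in> D \<Longrightarrow> a \<le> l" using D by (auto simp: a_def)
  then have a: "0 \<le> a" "a \<le> int m - 1" "c a \<noteq> 0" by (auto simp: D_def)
  have am: "0 \<le> real_of_int a" "real_of_int a \<le> real m - 1"
  proof -
    show "0 \<le> real_of_int a" using a by simp
    have "real_of_int a \<le> of_int (int m - 1)" using a by (simp only: of_int_le_iff)
    then show "real_of_int a \<le> real m - 1" by simp
  qed
  define B where "B = A \<inter> {a..}"
  have e: "spl A c x = spl B c x" if x: "x \<in> {real m - 1<..}" for x
  proof (rule spl_eq_subset[OF A])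
    fix l assume l: "l \<in> A - B"
    show "c l = 0 \<or> x \<le> of_int l \<or> x \<ge> of_int l + real m"
    proof (cases "l \<ge> 0")
      case True
      then have "l \<notin> D" "l < a" using l aD by (auto simp: B_def)
      then show ?thesis using True a by (auto simp: D_def)
    next
      case False
      then have "real_of_int l \<le> - 1" by linarith
      then show ?thesis using x by auto
    qed
  qed (auto simp: B_def)
  \<comment> \<open>The points that separate the zeros: without one, local independence would
    produce \<open>m\<close> consecutive zero coefficients, in conflict with
    \<open>no_blk\<close>.\<close>
  have nonzero: "\<exists>t. \<alpha> < t \<and> t < \<beta> \<and> t \<notin> \<int> \<and> spl B c t \<noteq> 0"
    if "\<alpha> < \<beta>" "real m - 1 \<le> \<alpha>" "\<alpha> \<le> of_int K" for \<alpha> \<beta>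
  proof (rule ccontr)
    assume n: "\<nexists>t. \<alpha> < t \<and> t < \<beta> \<and> t \<notin> \<int> \<and> spl B c t \<noteq> 0"
    define n where "n = \<lfloor>\<alpha>\<rfloor>"
    have fl: "of_int n \<le> \<alpha>" "\<alpha> < of_int n + 1" unfolding n_def by linarith+
    have "0 \<le> n" "n \<le> K" unfolding n_def using that m2 by (auto simp: le_floor_iff floor_le_iff)
    then obtain l where l: "n - int m < l" "l \<le> n" "c l \<noteq> 0" using no_blk by blast
    have "c l = 0"
    proof (rule spl_local_independence[OF A _ _ _ _ l(1,2)])
      show "\<alpha> < min \<beta> (of_int n + 1)" using that fl by simp
      show sub: "{\<alpha><..<min \<beta> (of_int n + 1)} \<subseteq> seg n" using fl by auto
      show "spl A c x = 0" if x: "x \<in> {\<alpha><..<min \<beta> (of_int n + 1)}" for x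
      proof -
        have "x \<in> seg n" using x sub by blast
        then have "x \<notin> \<int>" by (rule seg_nonint)
        then show ?thesis using n x e[of x] \<open>real m - 1 \<le> \<alpha>\<close> by auto
      qed
      show "l \<in> A" using l c by blast
    qed
    then show False using l by simp
  qed
  interpret rolle_system m a "wderiv v (spl B c)" v
    by (rule spl_rolle_system) (auto simp: B_def)
  define j0 where "j0 = (LEAST j. y j > real m - 1)"
  have ex: "y J > real m - 1" using yJ \<open>real m - 1 \<le> of_int K\<close> by simp
  have j0: "y j0 > real m - 1" "j0 \<le> J"
    unfolding j0_def using ex by (rule LeastI, rule Least_le)
  have "j0 \<noteq> 0" using j0 y0 m2 by (intro notI) simp
  then obtain j1 where j1: "j0 = Suc j1" by (cases j0) auto
  have y1: "y j1 \<le> real m - 1" using not_less_Least[of j1 "\<lambda>j. y j > real m - 1"]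
    unfolding j0_def[symmetric] j1 by simp
  have ym: "y i \<le> y j" if "i \<le> j" "j \<le> J" for i j
    using that
  proof (induction rule: dec_induct)
    case (step n)
    then show ?case using mono[of n] by simp
  qed simp
  \<comment> \<open>\<open>S d\<close> adds the multiplicities of the first \<open>d\<close> samples
    beyond m - 1; \<open>\<alpha> d\<close> is the left neighbour of the sample that follows them,
    with m - 1 in this role for the first.\<close>
  define S where "S d = (\<Sum>i<d. \<nu> (j0 + i))" for d
  define \<alpha> where "\<alpha> d = (if d = 0 then real m - 1 else y (j1 + d))" for d
  have zB: "zero_order (spl B c) (\<nu> (j0 + d)) (y (j0 + d))" if "j0 + d \<le> J" for d
  proof -
    have "y (j0 + d) > real m - 1" using ym[of j0 "j0 + d"] that j0 by simp
    moreover have "zero_order (spl A c) (\<nu> (j0 + d)) (y (j0 + d))" using z[of "j1 + d"] that j1 by simp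
    ultimately show ?thesis
      by (subst (asm) zero_order_cong[of "{real m - 1<..}" _ "spl B c"]) (use e in auto)
  qed
  have \<alpha>: "\<alpha> d < y (j0 + d)" "real m - 1 \<le> \<alpha> d" if "j0 + d \<le> J" for d
  proof -
    show "\<alpha> d < y (j0 + d)" using j0 mono[of "j1 + d"] j1 that by (auto simp: \<alpha>_def)
    show "real m - 1 \<le> \<alpha> d" using ym[of j0 "j1 + d"] j0 j1 that by (auto simp: \<alpha>_def)
  qed
  have P: "\<exists>t. \<alpha> d < t \<and> t < y (j0 + d) \<and> chain 0 (m - 1 - 0 + S d) t"
    if "j0 + d \<le> J" "\<alpha> d \<le> of_int K" for d
    using that
  proof (induction d)
    case 0
    from nonzero[OF \<alpha>(1)[OF 0(1)] \<alpha>(2)[OF 0(1)] 0(2)] obtain t where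
      t: "\<alpha> 0 < t" "t < y (j0 + 0)" "t \<notin> \<int>" "spl B c t \<noteq> 0" by blast
    have "chain 0 (m - 1 - 0) t"
      using t \<alpha>(2)[OF 0(1)] am v_pos[of 0 t] by (intro base) auto
    then show ?case using t by (auto simp: S_def)
  next
    case (Suc d)
    have d: "j0 + d \<le> J" using Suc by simp
    have aS: "\<alpha> (Suc d) = y (j0 + d)" by (simp add: \<alpha>_def j1)
    then have "\<alpha> d \<le> of_int K" using Suc.prems(2) \<alpha>(1)[OF d] by simp
    with Suc d obtain s where s: "s < y (j0 + d)" "chain 0 (m - 1 - 0 + S d) s" by blast
    from nonzero[OF \<alpha>(1)[OF Suc(2)] \<alpha>(2)[OF Suc(2)] Suc(3)] obtain t where
      t: "y (j0 + d) < t" "t < y (j0 + Suc d)" "t \<notin> \<int>" "spl B c t \<noteq> 0"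
      using aS by auto
    have "chain 0 (m - 1 - 0 + S d + \<nu> (j0 + d)) t"
    proof (rule chain.zero[OF s(2,1) t(1,3)])
      show "wderiv v (spl B c) 0 t \<noteq> 0" using t v_pos[of 0 t] by simp
      show "wderiv v (spl B c) (0 + i) (y (j0 + d)) = 0" if "i < \<nu> (j0 + d)" for i
        using zero_order_wderiv[OF zB[OF d] that] by simp
    qed (use zB[OF d] in \<open>auto simp: zero_order_def\<close>)
    then show ?case using t aS by (auto simp: S_def add.assoc)
  qed
  have lower: "y (j0 + d) > real (S (Suc d))" if d: "j0 + d \<le> J" "\<alpha> d \<le> of_int K" for d
  proof -
    from P[OF d] obtain t where t: "t < y (j0 + d)" "chain 0 (m - 1 - 0 + S d) t" by blast
    have "y (j0 + d) > of_int a + real (S d) + real (\<nu> (j0 + d))"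
      by (rule chain_end[OF t(2,1)])
        (use zB[OF d(1)] zero_order_wderiv[OF zB[OF d(1)]] m2 in \<open>auto simp: zero_order_def\<close>)
    then show ?thesis using am by (simp add: S_def)
  qed
  have upper: "y (j0 + d) \<le> real m - 1 + \<rho> * real (S (Suc d))" if "j0 + d \<le> J" for d
    using that
  proof (induction d)
    case 0
    then show ?case using gap[of j1] y1 j1 by (simp add: S_def)
  next
    case (Suc d)
    then show ?case using gap[of "j0 + d"] by (simp add: S_def algebra_simps)
  qed
  \<comment> \<open>The first counted sample at or beyond \<open>R\<close>. Its left neighbour is at
    most \<open>K\<close>, so the separating points are still available up to it, and
    \<open>lower\<close> contradicts \<open>upper\<close> there.\<close>
  define d where "d = (LEAST d. y (j0 + d) \<ge> R)"
  have exd: "y (j0 + (J - j0)) \<ge> R" using yJ K j0 R_def by simp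
  have d: "y (j0 + d) \<ge> R" "d \<le> J - j0"
    unfolding d_def using exd by (rule LeastI, rule Least_le)
  have "\<alpha> d \<le> of_int K"
  proof (cases d)
    case 0
    then show ?thesis using \<open>real m - 1 \<le> of_int K\<close> by (simp add: \<alpha>_def)
  next
    case (Suc d')
    have "y (j0 + d') < R" using not_less_Least[of d' "\<lambda>d. y (j0 + d) \<ge> R"]
      unfolding d_def[symmetric] Suc by simp
    then show ?thesis using K Suc j1 by (simp add: \<alpha>_def R_def)
  qed
  with lower[of d] upper[of d] d j0 have l: "y (j0 + d) > real (S (Suc d))"
    and u: "y (j0 + d) \<le> real m - 1 + \<rho> * real (S (Suc d))" by auto
  have "\<rho> * real (S (Suc d)) < \<rho> * y (j0 + d)" using l \<rho> by simp
  with u have "y (j0 + d) * (1 - \<rho>) < real m - 1" by (simp add: algebra_simps)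
  then have "y (j0 + d) < R" unfolding R_def using \<rho> by (simp add: pos_less_divide_eq)
  with d show False by simp
qed

end

section \<open>The local estimate by compactness\<close>

lemma finite_family_convergent_subsequence:
  fixes X :: "'i \<Rightarrow> nat \<Rightarrow> 'a::heine_borel"
  assumes "finite I" "\<And>i. i \<in> I \<Longrightarrow> bounded (range (X i))"
  shows "\<exists>r l. strict_mono r \<and> (\<forall>i\<in>I. (\<lambda>n. X i (r n)) \<longlonglongrightarrow> l i)"
  using assms
proof (induction I)
  case empty
  show ?case by (intro exI[of _ id]) (auto simp: strict_mono_def)
next
  case (insert i I)
  then obtain r l where r: "strict_mono r" "\<And>k. k \<in> I \<Longrightarrow> (\<lambda>n. X k (r n)) \<longlonglongrightarrow> l k" by auto
  have "bounded (range (X i \<circ> r))"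
    using insert.prems[of i] by (rule bounded_subset) auto
  from bounded_imp_convergent_subsequence[OF this] obtain q s where
    q: "strict_mono s" "((X i \<circ> r) \<circ> s) \<longlonglongrightarrow> q" by blast
  have "(\<lambda>n. X k ((r \<circ> s) n)) \<longlonglongrightarrow> (l(i := q)) k" if "k \<in> insert i I" for k
  proof (cases "k = i")
    case True
    then show ?thesis using q(2) by (simp add: o_def)
  next
    case False
    then show ?thesis using LIMSEQ_subseq_LIMSEQ[OF r(2) q(1), of k] that by (simp add: o_def)
  qed
  moreover have "strict_mono (r \<circ> s)" using r(1) q(1) by (rule strict_mono_o)
  ultimately show ?case by blast
qed

lemma nderiv_shift:
  fixes f :: "real \<Rightarrow> real"
  assumes "open S"
  shows "\<lbrakk>Ck_on s S f; x - d \<in> S\<rbrakk> \<Longrightarrow> nderiv s (\<lambda>x. f (x - d)) x = nderiv s f (x - d)"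
proof (induction s arbitrary: f)
  case (Suc s)
  then obtain f' where f': "\<And>x. x \<in> S \<Longrightarrow> (f has_real_derivative f' x) (at x)" "Ck_on s S f'"
    by auto
  have "open ((\<lambda>x. x - d) -` S)"
    by (rule open_vimage[OF assms]) (auto intro!: continuous_intros)
  moreover have "((\<lambda>x. f (x - d)) has_real_derivative f' (x - d)) (at x)" if "x - d \<in> S" for x
    using DERIV_shift[of f "f' (x - d)" x "- d"] f'(1)[OF that] by simp
  ultimately have "nderiv (Suc s) (\<lambda>x. f (x - d)) x = nderiv s (\<lambda>x. f' (x - d)) x"
    using Suc.prems(2) by (intro nderiv_Suc_DERIV[of "(\<lambda>x. x - d) -` S"]) auto
  also have "\<dots> = nderiv s f' (x - d)" by (rule Suc.IH[OF f'(2) Suc.prems(2)])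
  also have "\<dots> = nderiv (Suc s) f (x - d)"
    using nderiv_Suc_DERIV[OF assms f'(1) Suc.prems(2)] by simp
  finally show ?case .
qed simp

context peb
begin

text \<open>Points at which the derivative of order \<open>s\<close> of a spline exists and is continuous.\<close>

definition regular :: "nat \<Rightarrow> real \<Rightarrow> bool" where
  "regular s x \<longleftrightarrow> s < m \<and> (s = m - 1 \<longrightarrow> x \<notin> \<int>)"

lemma regular_shift: "regular s (x - of_int l) \<longleftrightarrow> regular s x"
proof -
  have "x - of_int l \<in> \<int> \<longleftrightarrow> x \<in> \<int>"
    by (metis Ints_of_int Ints_diff Ints_add diff_add_cancel)
  then show ?thesis by (simp add: regular_def)
qed

lemma regular_nbhd:
  assumes "regular s x"
  obtains S where "open S" "x \<in> S" "\<And>l. Ck_on s S (\<lambda>x. \<phi> (x - of_int l))"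
proof (cases "s = m - 1")
  case True
  then have "x \<notin> \<int>" using assms by (simp add: regular_def)
  then have "x \<in> seg \<lfloor>x\<rfloor>" using nonint_floor by simp
  with True show ?thesis using that[of "seg \<lfloor>x\<rfloor>"] \<phi>_shift_Ck_on_seg by simp
next
  case False
  then have "s \<le> m - 2" using assms unfolding regular_def by linarith
  then show ?thesis using that[of UNIV] Ck_on_le[OF \<phi>_shift_Ck_on] by simp
qed

lemma isCont_nderiv_\<phi>:
  assumes "regular s x"
  shows "isCont (nderiv s \<phi>) x"
proof -
  obtain S where S: "open S" "x \<in> S" "\<And>l. Ck_on s S (\<lambda>x. \<phi> (x - of_int l))"
    using regular_nbhd[OF assms] by blast
  have "continuous_on S (nderiv s \<phi>)"
    using Ck_on_nderiv_continuous_on[OF S(1) S(3)[of 0] order_refl] by simp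
  then show ?thesis using S continuous_on_eq_continuous_at by blast
qed

lemma nderiv_\<phi>_sum:
  fixes c :: "int \<Rightarrow> 'a::real_normed_vector"
  assumes "regular s x"
  shows "nderiv s (\<lambda>x. \<Sum>l\<in>A. \<phi> (x - of_int l) *\<^sub>R c l) x = (\<Sum>l\<in>A. nderiv s \<phi> (x - of_int l) *\<^sub>R c l)"
proof -
  obtain S where S: "open S" "x \<in> S" "\<And>l. Ck_on s S (\<lambda>x. \<phi> (x - of_int l))"
    using regular_nbhd[OF assms] by blast
  have "nderiv s (\<lambda>x. \<phi> (x - of_int l)) x = nderiv s \<phi> (x - of_int l)" for l
  proof -
    obtain S where S: "open S" "x - of_int l \<in> S" "\<And>l. Ck_on s S (\<lambda>x. \<phi> (x - of_int l))"
      using regular_nbhd[of s "x - of_int l"] assms unfolding regular_shift by blast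
    show ?thesis using nderiv_shift[OF S(1) _ S(2), of s \<phi>] S(3)[of 0] by simp
  qed
  then show ?thesis using nderiv_scaleR_sum[OF S(1,2), of A s "\<lambda>l x. \<phi> (x - of_int l)" c] S(3)
    by simp
qed

text \<open>\<open>J\<close> consecutive sampling points, seen from a window that starts at the origin.\<close>

definition config :: "real \<Rightarrow> real \<Rightarrow> real \<Rightarrow> int \<Rightarrow> nat \<Rightarrow> (nat \<Rightarrow> real) \<Rightarrow> (nat \<Rightarrow> nat) \<Rightarrow> bool" where
  "config \<rho> e \<delta> K J y \<nu> \<longleftrightarrow> - real m \<le> y 0 \<and> y 0 \<le> 0 \<and> y J \<ge> of_int K + 1 \<and>
    (\<forall>j<J. y j + e \<le> y (Suc j) \<and> y (Suc j) - y j \<le> \<rho> * real (\<nu> (Suc j)) \<and>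
       1 \<le> \<nu> (Suc j) \<and> \<nu> (Suc j) \<le> m \<and>
       (\<nu> (Suc j) = m \<longrightarrow> (\<forall>n::int. \<bar>y (Suc j) - of_int n\<bar> \<ge> \<delta>)))"

lemma config_nonint:
  assumes "config \<rho> e \<delta> K J y \<nu>" "0 < \<delta>" "j < J" "\<nu> (Suc j) = m"
  shows "y (Suc j) \<notin> \<int>"
proof
  assume "y (Suc j) \<in> \<int>"
  then obtain n where "y (Suc j) = of_int n" by (elim Ints_cases)
  moreover have "\<bar>y (Suc j) - of_int n\<bar> \<ge> \<delta>" using assms unfolding config_def by blast
  ultimately show False using assms(2) by simp
qed

lemma config_bounds:
  assumes "config \<rho> e \<delta> K J y \<nu>" "0 < \<rho>" "\<rho> < 1" "0 < e" "j \<le> J"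
  shows "\<bar>y j\<bar> \<le> real m * (real J + 1)"
proof -
  have "- real m \<le> y j \<and> y j \<le> real m * real j" using assms(5)
  proof (induction j)
    case 0
    then show ?case using assms(1) by (simp add: config_def)
  next
    case (Suc j)
    then have j: "y j + e \<le> y (Suc j)" "y (Suc j) - y j \<le> \<rho> * real (\<nu> (Suc j))" "\<nu> (Suc j) \<le> m"
      using assms(1) by (auto simp: config_def)
    have "\<rho> * real (\<nu> (Suc j)) \<le> 1 * real m" using j(3) assms by (intro mult_mono) auto
    then show ?case using Suc j assms by (auto simp: algebra_simps)
  qed
  moreover have "real m * real j \<le> real m * real J" using assms(5) by (intro mult_left_mono) auto
  moreover have "real m * real J \<ge> 0" by simp
  ultimately show ?thesis unfolding distrib_left mult_1_right by linarith
qed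

text \<open>The samples are written through the derivatives of \<open>\<phi>\<close> at the shifted
  points, so that limits can be taken in coefficients and points at the same time.\<close>

definition sample_vals :: "int set \<Rightarrow> (int \<Rightarrow> complex) \<Rightarrow> nat \<Rightarrow> (nat \<Rightarrow> real) \<Rightarrow> (nat \<Rightarrow> nat) \<Rightarrow> real" where
  "sample_vals A c J y \<nu> = (\<Sum>j<J. \<Sum>s<\<nu> (Suc j).
     cmod (\<Sum>l\<in>A. c l * complex_of_real (nderiv s \<phi> (y (Suc j) - of_int l))))"

lemma sample_vals_nonneg: "sample_vals A c J y \<nu> \<ge> 0"
  unfolding sample_vals_def by (intro sum_nonneg) auto

text \<open>The sampling conditions are linear with real coefficients, so the real and the imaginary
  parts of \<open>c\<close> satisfy them separately.\<close>

lemma config_uniqueness: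
  assumes "config \<rho> e \<delta> K J y \<nu>" "0 < \<rho>" "\<rho> < 1" "0 < e" "0 < \<delta>" "finite A" "K \<in> A"
    and K: "of_int K \<ge> (real m - 1) / (1 - \<rho>)"
    and z: "\<And>j s. j < J \<Longrightarrow> s < \<nu> (Suc j) \<Longrightarrow>
      (\<Sum>l\<in>A. c l * complex_of_real (nderiv s \<phi> (y (Suc j) - of_int l))) = 0"
  shows "c K = 0"
proof -
  have real: "d K = 0" if d: "\<And>j s. j < J \<Longrightarrow> s < \<nu> (Suc j) \<Longrightarrow>
      (\<Sum>l\<in>A. d l * nderiv s \<phi> (y (Suc j) - of_int l)) = 0" for d
  proof -
    \<comment> \<open>\<open>sample_uniqueness\<close> asks for coefficients that vanish off
      \<open>A\<close>; sums over \<open>A\<close> do not see the change.\<close>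
    define d' where "d' l = (if l \<in> A then d l else 0)" for l
    have z: "zero_order (spl A d') (\<nu> (Suc j)) (y (Suc j))" if j: "j < J" for j
      unfolding zero_order_def
    proof (intro conjI allI impI)
      show "\<nu> (Suc j) \<le> m" using assms(1) j by (auto simp: config_def)
      show ni: "y (Suc j) \<notin> \<int>" if "\<nu> (Suc j) = m"
        using config_nonint[OF assms(1) \<open>0 < \<delta>\<close> j that] .
      fix s assume s: "s < \<nu> (Suc j)"
      then have r: "regular s (y (Suc j))"
        using ni \<open>\<nu> (Suc j) \<le> m\<close> by (auto simp: regular_def)
      have "spl A d' = (\<lambda>x. \<Sum>l\<in>A. \<phi> (x - of_int l) *\<^sub>R d l)"
        by (auto simp: spl_def d'_def intro!: sum.cong ext)
      then show "nderiv s (spl A d') (y (Suc j)) = 0"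
        using nderiv_\<phi>_sum[OF r, where A = A and c = d] d[OF j s] by (simp add: mult.commute)
    qed
    have cfg: "y 0 \<le> 0" "y J \<ge> of_int K + 1" "j < J \<Longrightarrow> y j + e \<le> y (Suc j)"
      "j < J \<Longrightarrow> y (Suc j) - y j \<le> \<rho> * real (\<nu> (Suc j)) \<and> \<nu> (Suc j) \<ge> 1" for j
      using assms(1) unfolding config_def by blast+
    have "y J > of_int K" "j < J \<Longrightarrow> y j < y (Suc j)" for j
      using cfg(2) cfg(3)[of j] \<open>0 < e\<close> by linarith+
    note cfg = cfg(1) this cfg(4)
    have "d' K = 0"
      by (rule sample_uniqueness[OF \<open>finite A\<close> _ \<open>0 < \<rho>\<close> \<open>\<rho> < 1\<close> cfg z K])
        (simp_all add: d'_def)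
    then show ?thesis using \<open>K \<in> A\<close> by (simp add: d'_def)
  qed
  have "Re (c K) = 0"
  proof (rule real)
    show "(\<Sum>l\<in>A. Re (c l) * nderiv s \<phi> (y (Suc j) - of_int l)) = 0" if "j < J" "s < \<nu> (Suc j)" for j s
      using arg_cong[OF z[OF that], of Re] by simp
  qed
  moreover have "Im (c K) = 0"
  proof (rule real)
    show "(\<Sum>l\<in>A. Im (c l) * nderiv s \<phi> (y (Suc j) - of_int l)) = 0" if "j < J" "s < \<nu> (Suc j)" for j s
      using arg_cong[OF z[OF that], of Im] by simp
  qed
  ultimately show ?thesis by (simp add: complex_eq_iff)
qed

text \<open>All conditions on the points are non-strict inequalities with fixed margins
  \<open>e\<close> and \<open>\<delta>\<close>, hence closed.\<close>

lemma config_limit: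
  assumes "\<And>n. config \<rho> e \<delta> K J (Y n) \<nu>" "\<And>j. j \<le> J \<Longrightarrow> (\<lambda>n. Y n j) \<longlonglongrightarrow> y j"
  shows "config \<rho> e \<delta> K J y \<nu>"
proof -
  note lim = assms(2)
  have c: "- real m \<le> Y n 0" "Y n 0 \<le> 0" "of_int K + 1 \<le> Y n J"
    "j < J \<Longrightarrow> Y n j + e \<le> Y n (Suc j)"
    "j < J \<Longrightarrow> Y n (Suc j) - Y n j \<le> \<rho> * real (\<nu> (Suc j))"
    "j < J \<Longrightarrow> \<nu> (Suc j) = m \<Longrightarrow> \<delta> \<le> \<bar>Y n (Suc j) - of_int k\<bar>" for n j k
    using assms(1)[of n] unfolding config_def by auto
  show ?thesis unfolding config_def
  proof (intro conjI allI impI)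
    show "- real m \<le> y 0" by (rule LIMSEQ_le_const[OF lim]) (use c in auto)
    show "y 0 \<le> 0" by (rule LIMSEQ_le_const2[OF lim]) (use c in auto)
    show "of_int K + 1 \<le> y J" by (rule LIMSEQ_le_const[OF lim]) (use c in auto)
    fix j assume j: "j < J"
    have l: "(\<lambda>n. Y n j) \<longlonglongrightarrow> y j" "(\<lambda>n. Y n (Suc j)) \<longlonglongrightarrow> y (Suc j)" using lim j by auto
    show "y j + e \<le> y (Suc j)"
      by (rule LIMSEQ_le[OF tendsto_add[OF l(1) tendsto_const] l(2)]) (use c j in auto)
    show "y (Suc j) - y j \<le> \<rho> * real (\<nu> (Suc j))"
      by (rule LIMSEQ_le_const2[OF tendsto_diff[OF l(2) l(1)]]) (use c j in auto)
    show "1 \<le> \<nu> (Suc j)" "\<nu> (Suc j) \<le> m" using assms(1)[of 0] j by (auto simp: config_def)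
    show "\<delta> \<le> \<bar>y (Suc j) - of_int k\<bar>" if "\<nu> (Suc j) = m" for k
      by (rule LIMSEQ_le_const[OF tendsto_rabs[OF tendsto_diff[OF l(2) tendsto_const]]])
        (use c j that in auto)
  qed
qed

text \<open>There are finitely many patterns of multiplicities for \<open>J\<close> points, so one
  of them recurs infinitely often.\<close>

lemma config_constant_multiplicity_subsequence:
  assumes "\<And>n. config \<rho> e \<delta> K J (Y n) (N n)"
  shows "\<exists>(r :: nat \<Rightarrow> nat) \<nu>. strict_mono r \<and> (\<forall>n. \<forall>j<J. N (r n) (Suc j) = \<nu> (Suc j))"
proof -
  define g where "g n = (\<lambda>j\<in>{..<J}. N n (Suc j))" for n
  have "g n \<in> {..<J} \<rightarrow>\<^sub>E {..m}" for n
    using assms[of n] by (auto simp: g_def config_def)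
  then have "finite (range g)"
    by (intro finite_subset[OF _ finite_PiE[of "{..<J}" "\<lambda>_. {..m}"]]) auto
  from pigeonhole_infinite[OF infinite_UNIV_nat this] obtain n0 where
    "infinite {n. g n = g n0}" by auto
  from infinite_enumerate[OF this] obtain r :: "nat \<Rightarrow> nat" where
    r: "strict_mono r" "\<And>n. g (r n) = g n0" by blast
  have "N (r n) (Suc j) = N n0 (Suc j)" if "j < J" for n j
    using fun_cong[OF r(2), of n j] that by (simp add: g_def)
  then have "strict_mono r \<and> (\<forall>n. \<forall>j<J. N (r n) (Suc j) = N n0 (Suc j))" using r(1) by simp
  then show ?thesis by (rule exI[of _ "N n0", THEN exI[of _ r]])
qed

text \<open>If no constant worked, \<open>C = n + 1\<close> would fail for every \<open>n\<close>.
  Dividing the coefficients by the sum \<open>M n\<close> of their moduli puts them into a compact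
  set, the failure keeps the normalised coefficient at \<open>K\<close> above
  \<open>\<epsilon>\<close>, and the normalised samples tend to 0. A limit contradicts
  uniqueness.\<close>

lemma local_estimate:
  assumes \<rho>: "0 < \<rho>" "\<rho> < 1" and e: "0 < e" and \<delta>: "0 < \<delta>" and A: "finite A" "K \<in> A"
    and K: "of_int K \<ge> (real m - 1) / (1 - \<rho>)" and \<epsilon>: "\<epsilon> > 0"
  shows "\<exists>C>0. \<forall>y \<nu> c. config \<rho> e \<delta> K J y \<nu> \<longrightarrow>
    cmod (c K) \<le> C * sample_vals A c J y \<nu> + \<epsilon> * (\<Sum>l\<in>A. cmod (c l))"
proof (rule ccontr)
  assume neg: "\<not> ?thesis"
  have "\<exists>y \<nu> c. config \<rho> e \<delta> K J y \<nu> \<and>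
    cmod (c K) > (real n + 1) * sample_vals A c J y \<nu> + \<epsilon> * (\<Sum>l\<in>A. cmod (c l))" for n
    using neg[unfolded not_ex, rule_format, of "real n + 1"] by (force simp: not_le)
  then obtain Y N c where cfg: "\<And>n. config \<rho> e \<delta> K J (Y n) (N n)"
    and big: "\<And>n. cmod (c n K) > (real n + 1) * sample_vals A (c n) J (Y n) (N n) + \<epsilon> * (\<Sum>l\<in>A. cmod (c n l))"
    by metis
  define M where "M n = (\<Sum>l\<in>A. cmod (c n l))" for n
  have leM: "cmod (c n l) \<le> M n" if "l \<in> A" for l n
    unfolding M_def using A that by (intro member_le_sum) auto
  have Mpos: "M n > 0" for n
  proof -
    have "0 \<le> (real n + 1) * sample_vals A (c n) J (Y n) (N n)"
      by (intro mult_nonneg_nonneg sample_vals_nonneg) auto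
    moreover have "0 \<le> \<epsilon> * M n" using \<epsilon> unfolding M_def by (intro mult_nonneg_nonneg sum_nonneg) auto
    ultimately have "0 < cmod (c n K)" using big[of n] unfolding M_def by linarith
    then show ?thesis using leM[OF A(2), of n] by linarith
  qed
  define b where "b n l = c n l / of_real (M n)" for n l
  have b1: "cmod (b n l) \<le> 1" if "l \<in> A" for n l
    using leM[OF that, of n] Mpos[of n] by (simp add: b_def norm_divide)
  have sv: "sample_vals A (b n) J (Y n) (N n) = sample_vals A (c n) J (Y n) (N n) / M n" for n
  proof -
    have "(\<Sum>l\<in>A. b n l * complex_of_real (h l)) = (\<Sum>l\<in>A. c n l * complex_of_real (h l)) / of_real (M n)" for h
      by (simp add: b_def sum_divide_distrib)
    then have "cmod (\<Sum>l\<in>A. b n l * complex_of_real (h l)) = cmod (\<Sum>l\<in>A. c n l * complex_of_real (h l)) / M n" for h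
      using Mpos[of n] by (simp only: norm_divide norm_of_real abs_of_pos)
    then show ?thesis unfolding sample_vals_def sum_divide_distrib by presburger
  qed
  have bK: "cmod (b n K) > (real n + 1) * sample_vals A (b n) J (Y n) (N n) + \<epsilon>" for n
  proof -
    have "cmod (c n K) / M n > ((real n + 1) * sample_vals A (c n) J (Y n) (N n) + \<epsilon> * M n) / M n"
      using big[of n] Mpos[of n] unfolding M_def[symmetric] by (intro divide_strict_right_mono) auto
    then show ?thesis using Mpos[of n] by (simp add: sv b_def norm_divide add_divide_distrib)
  qed
  from config_constant_multiplicity_subsequence[of \<rho> e \<delta> K J Y N, OF cfg]
  obtain r0 :: "nat \<Rightarrow> nat" and \<nu> where r0: "strict_mono r0" "\<forall>n. \<forall>j<J. N (r0 n) (Suc j) = \<nu> (Suc j)"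
    by (elim exE conjE)
  have "\<exists>r y. strict_mono r \<and> (\<forall>j\<in>{..J}. (\<lambda>n. Y (r0 (r n)) j) \<longlonglongrightarrow> y j)"
  proof (rule finite_family_convergent_subsequence[where X = "\<lambda>j n. Y (r0 n) j"])
    show "bounded (range (\<lambda>n. Y (r0 n) j))" if "j \<in> {..J}" for j
      by (rule boundedI[of _ "real m * (real J + 1)"])
        (use config_bounds[OF cfg \<rho> e, of j] that in auto)
  qed simp
  then obtain r1 y where r1: "strict_mono r1" "\<forall>j\<in>{..J}. (\<lambda>n. Y (r0 (r1 n)) j) \<longlonglongrightarrow> y j"
    by (elim exE conjE)
  have "\<exists>r b'. strict_mono r \<and> (\<forall>l\<in>A. (\<lambda>n. b (r0 (r1 (r n))) l) \<longlonglongrightarrow> b' l)"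
  proof (rule finite_family_convergent_subsequence[where X = "\<lambda>l n. b (r0 (r1 n)) l", OF A(1)])
    show "bounded (range (\<lambda>n. b (r0 (r1 n)) l))" if "l \<in> A" for l
      by (rule boundedI[of _ 1]) (use b1[OF that] in auto)
  qed
  then obtain r2 b' where r2: "strict_mono r2" "\<forall>l\<in>A. (\<lambda>n. b (r0 (r1 (r2 n))) l) \<longlonglongrightarrow> b' l"
    by (elim exE conjE)
  define r where "r = r0 \<circ> r1 \<circ> r2"
  have r: "strict_mono r" unfolding r_def by (intro strict_mono_o r0(1) r1(1) r2(1))
  have Yl: "(\<lambda>n. Y (r n) j) \<longlonglongrightarrow> y j" if "j \<le> J" for j
  proof -
    have "(\<lambda>n. Y (r0 (r1 n)) j) \<longlonglongrightarrow> y j" using r1(2) that by blast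
    from LIMSEQ_subseq_LIMSEQ[OF this r2(1)] show ?thesis by (simp add: r_def o_def)
  qed
  have bl: "(\<lambda>n. b (r n) l) \<longlonglongrightarrow> b' l" if "l \<in> A" for l
    using r2(2) that by (simp add: r_def)
  have Nr: "N (r n) (Suc j) = \<nu> (Suc j)" if "j < J" for n j
    using r0(2) that by (simp add: r_def)
  have cfg': "config \<rho> e \<delta> K J (Y (r n)) \<nu>" for n
    using cfg[of "r n"] Nr[of _ n] by (simp add: config_def)
  have cfgl: "config \<rho> e \<delta> K J y \<nu>"
    by (rule config_limit[OF cfg' Yl])
  have "b' K = 0"
  proof (rule config_uniqueness[OF cfgl \<rho> e \<delta> A K])
    fix j s assume j: "j < J" and s: "s < \<nu> (Suc j)"
    let ?T = "\<lambda>n. \<Sum>l\<in>A. b (r n) l * complex_of_real (nderiv s \<phi> (Y (r n) (Suc j) - of_int l))"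
    \<comment> \<open>A limit point of multiplicity \<open>m\<close> keeps the distance
      \<open>\<delta>\<close> from the integers, so all sampled derivatives of \<open>\<phi>\<close>
      are continuous there.\<close>
    have "\<nu> (Suc j) \<le> m" using cfgl j by (auto simp: config_def)
    moreover have "y (Suc j) \<notin> \<int>" if "\<nu> (Suc j) = m"
      using config_nonint[OF cfgl \<delta> j that] .
    ultimately have reg: "regular s (y (Suc j))" using s by (auto simp: regular_def)
    have "?T \<longlonglongrightarrow> (\<Sum>l\<in>A. b' l * complex_of_real (nderiv s \<phi> (y (Suc j) - of_int l)))"
    proof (intro tendsto_sum tendsto_mult bl tendsto_of_real)
      fix l
      have "(\<lambda>n. Y (r n) (Suc j) - of_int l) \<longlonglongrightarrow> y (Suc j) - of_int l"
        using Yl[of "Suc j"] j by (intro tendsto_diff tendsto_const) auto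
      moreover have "isCont (nderiv s \<phi>) (y (Suc j) - of_int l)"
        using reg by (intro isCont_nderiv_\<phi>) (simp add: regular_shift)
      ultimately show "(\<lambda>n. nderiv s \<phi> (Y (r n) (Suc j) - of_int l)) \<longlonglongrightarrow> nderiv s \<phi> (y (Suc j) - of_int l)"
        by (rule isCont_tendsto_compose[rotated])
    qed
    \<comment> \<open>By \<open>bK\<close> and \<open>b1\<close>, \<open>r n + 1\<close> times the
      sample values is at most 1, and \<open>n \<le> r n\<close>.\<close>
    moreover have "?T \<longlonglongrightarrow> 0"
    proof (rule Lim_null_comparison[OF _ LIMSEQ_inverse_real_of_nat], rule always_eventually, rule allI)
      fix n
      have "cmod (?T n) \<le> (\<Sum>s<N (r n) (Suc j). cmod (\<Sum>l\<in>A. b (r n) l * complex_of_real (nderiv s \<phi> (Y (r n) (Suc j) - of_int l))))"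
        using s j Nr by (intro member_le_sum[where i = s and f = "\<lambda>s. cmod (\<Sum>l\<in>A. b (r n) l * complex_of_real (nderiv s \<phi> (Y (r n) (Suc j) - of_int l)))"]) auto
      also have "\<dots> \<le> sample_vals A (b (r n)) J (Y (r n)) (N (r n))"
        unfolding sample_vals_def using j
        by (intro member_le_sum[where i = j and f = "\<lambda>j. \<Sum>s<N (r n) (Suc j). cmod (\<Sum>l\<in>A. b (r n) l * complex_of_real (nderiv s \<phi> (Y (r n) (Suc j) - of_int l)))"])
          (auto intro!: sum_nonneg)
      also have "\<dots> \<le> inverse (real (Suc n))"
      proof -
        let ?S = "sample_vals A (b (r n)) J (Y (r n)) (N (r n))"
        have "(real n + 1) * ?S \<le> (real (r n) + 1) * ?S"
          using seq_suble[OF r, of n] by (intro mult_right_mono sample_vals_nonneg) auto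
        also have "\<dots> \<le> 1" using bK[of "r n"] b1[OF A(2), of "r n"] \<epsilon> by linarith
        finally show ?thesis by (simp add: field_simps)
      qed
      finally show "norm (?T n) \<le> inverse (real (Suc n))" .
    qed
    ultimately show "(\<Sum>l\<in>A. b' l * complex_of_real (nderiv s \<phi> (y (Suc j) - of_int l))) = 0"
      using LIMSEQ_unique by blast
  qed
  moreover have "\<epsilon> \<le> cmod (b' K)"
  proof (rule LIMSEQ_le_const[OF tendsto_norm[OF bl[OF A(2)]]])
    have "\<epsilon> \<le> cmod (b (r n) K)" for n
    proof -
      have "0 \<le> (real (r n) + 1) * sample_vals A (b (r n)) J (Y (r n)) (N (r n))"
        by (intro mult_nonneg_nonneg sample_vals_nonneg) auto
      then show ?thesis using bK[of "r n"] by linarith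
    qed
    then show "\<exists>N. \<forall>n\<ge>N. \<epsilon> \<le> cmod (b (r n) K)" by blast
  qed
  ultimately show False using \<epsilon> by simp
qed

end

section \<open>Local bounds for series of shifts\<close>

text \<open>Fatou's lemma; the limit of the integrands equals their limes inferior.\<close>

lemma nn_integral_limit_eq_0:
  assumes "\<And>n. f n \<in> borel_measurable M" "\<And>x. (\<lambda>n. f n x) \<longlonglongrightarrow> g x"
    "(\<lambda>n. \<integral>\<^sup>+x. f n x \<partial>M) \<longlonglongrightarrow> 0"
  shows "(\<integral>\<^sup>+x. g x \<partial>M) = 0"
proof -
  have "(\<integral>\<^sup>+x. g x \<partial>M) = (\<integral>\<^sup>+x. liminf (\<lambda>n. f n x) \<partial>M)"
    by (intro nn_integral_cong) (metis assms(2) lim_imp_Liminf sequentially_bot)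
  also have "\<dots> \<le> liminf (\<lambda>n. \<integral>\<^sup>+x. f n x \<partial>M)"
    by (rule nn_integral_liminf[OF assms(1)])
  also have "\<dots> = 0" using assms(3) by (metis lim_imp_Liminf sequentially_bot)
  finally show ?thesis by simp
qed

lemma AE_zero_open_interval:
  fixes f :: "real \<Rightarrow> complex"
  assumes "AE x in lborel. x \<in> {a<..<b} \<longrightarrow> f x = 0" "continuous_on UNIV f" "x \<in> {a<..<b}"
  shows "f x = 0"
proof (rule ccontr)
  assume "f x \<noteq> 0"
  define S where "S = {a<..<b} \<inter> f -` (- {0})"
  have "open S" unfolding S_def
    by (intro open_Int open_vimage assms(2)) auto
  moreover have "x \<in> S" using assms(3) \<open>f x \<noteq> 0\<close> by (simp add: S_def)
  moreover have "S \<in> null_sets lborel"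
  proof -
    have "AE x in lborel. x \<notin> S" using assms(1) by eventually_elim (auto simp: S_def)
    then show ?thesis using \<open>open S\<close> by (subst AE_iff_null_sets) auto
  qed
  then have "negligible S" by (simp add: negligible_iff_null_sets null_sets_completionI)
  ultimately show False using open_not_negligible by blast
qed

text \<open>Comparison with the largest term. The constant is crude, but it covers all exponents
  \<open>q \<ge> 0\<close>, without convexity.\<close>

lemma sum_powr_le:
  fixes t :: "'i \<Rightarrow> real"
  assumes "finite I" "\<And>i. i \<in> I \<Longrightarrow> 0 \<le> t i" "0 \<le> q"
  shows "(\<Sum>i\<in>I. t i) powr q \<le> real (card I) powr q * (\<Sum>i\<in>I. t i powr q)"
proof (cases "I = {}")
  case False
  define M where "M = Max (t ` I)"
  have "M \<in> t ` I" unfolding M_def using assms(1) False by (intro Max_in) auto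
  then obtain i where i: "i \<in> I" "t i = M" by blast
  have le: "t j \<le> M" if "j \<in> I" for j using that assms(1) by (auto simp: M_def)
  have "(\<Sum>i\<in>I. t i) \<le> real (card I) * M" using sum_bounded_above[of I t M] le by simp
  then have "(\<Sum>i\<in>I. t i) powr q \<le> (real (card I) * M) powr q"
    using assms by (intro powr_mono2 sum_nonneg) auto
  also have "\<dots> = real (card I) powr q * M powr q" by (rule powr_mult)
  also have "\<dots> \<le> real (card I) powr q * (\<Sum>i\<in>I. t i powr q)"
    using i assms(1) by (intro mult_left_mono) (auto intro!: member_le_sum[of i I "\<lambda>i. t i powr q", THEN order_trans[rotated]])
  finally show ?thesis .
qed simp

context peb
begin

section \<open>Series of shifts with arbitrary coefficients\<close>

definition lift :: "(int \<Rightarrow> complex) \<Rightarrow> real \<Rightarrow> complex" where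
  "lift c x = (\<Sum>\<^sub>\<infinity>l::int. c l * complex_of_real (\<phi> (x - of_int l)))"

lemma lift_eq_sum:
  assumes "finite A" "\<And>l. of_int l < x \<Longrightarrow> x < of_int l + real m \<Longrightarrow> l \<in> A"
  shows "lift c x = (\<Sum>l\<in>A. c l * complex_of_real (\<phi> (x - of_int l)))"
proof -
  have "\<phi> (x - of_int l) = 0" if "l \<notin> A" for l
    using assms(2)[of l] that by (intro \<phi>_eq_0) force
  then have "lift c x = (\<Sum>\<^sub>\<infinity>l\<in>A. c l * complex_of_real (\<phi> (x - of_int l)))"
    unfolding lift_def by (intro infsum_cong_neutral) auto
  then show ?thesis using assms(1) by simp
qed

lemma lift_eq_window:
  assumes x: "of_int a < x" "x < of_int b" and A: "finite A" "{a - int m..b} \<subseteq> A"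
  shows "lift c x = (\<Sum>l\<in>A. c l * complex_of_real (\<phi> (x - of_int l)))"
proof (rule lift_eq_sum[OF A(1)])
  fix l :: int assume "of_int l < x" "x < of_int l + real m"
  then have "real_of_int l < of_int b" "real_of_int a < of_int (l + int m)" using x by auto
  then have "l \<in> {a - int m..b}" unfolding of_int_less_iff by simp
  then show "l \<in> A" using A by blast
qed

text \<open>At a regular point the branch of \<open>spline_deriv\<close> with the one-sided limit is
  not taken, and near \<open>x\<close> the series is a finite sum that can be differentiated term by
  term.\<close>

lemma spline_deriv_lift:
  assumes x: "of_int a < x" "x < of_int b" and A: "finite A" "{a - int m..b} \<subseteq> A" and r: "regular s x"
  shows "spline_deriv m s (lift c) x = (\<Sum>l\<in>A. c l * complex_of_real (nderiv s \<phi> (x - of_int l)))"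
proof -
  have "spline_deriv m s (lift c) x = nderiv s (lift c) x"
    using r by (auto simp: spline_deriv_def regular_def)
  also have "\<dots> = nderiv s (\<lambda>x. \<Sum>l\<in>A. \<phi> (x - of_int l) *\<^sub>R c l) x"
    by (rule nderiv_cong_open[of "{of_int a<..<of_int b}"])
      (use x lift_eq_window[OF _ _ A] in \<open>auto simp: scaleR_conv_of_real mult.commute\<close>)
  also have "\<dots> = (\<Sum>l\<in>A. nderiv s \<phi> (x - of_int l) *\<^sub>R c l)" by (rule nderiv_\<phi>_sum[OF r])
  finally show ?thesis by (simp add: scaleR_conv_of_real mult.commute)
qed

lemma lift_continuous_on: "continuous_on UNIV (lift c)"
proof (rule continuous_at_imp_continuous_on, rule ballI)
  fix x :: real
  define a b where "a = \<lfloor>x\<rfloor> - 1" and "b = \<lfloor>x\<rfloor> + 2"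
  have x: "x \<in> {of_int a<..<of_int b}" unfolding a_def b_def by simp linarith
  have "continuous_on {of_int a<..<of_int b} (\<lambda>x. \<Sum>l\<in>{a - int m..b}. c l * complex_of_real (\<phi> (x - of_int l)))"
    by (intro continuous_intros continuous_on_compose2[OF \<phi>_continuous_on[of UNIV]]) auto
  then have "continuous_on {of_int a<..<of_int b} (lift c)"
    by (rule continuous_on_eq) (auto simp: lift_eq_window[OF _ _ _ order_refl])
  then show "isCont (lift c) x" using x by (simp add: continuous_on_eq_continuous_at)
qed

text \<open>A superset of the indices of the shifts that do not vanish in a neighbourhood of \<open>x\<close>.\<close>

definition near :: "real \<Rightarrow> int set" where
  "near x = {\<lfloor>x\<rfloor> - 1 - int m..\<lfloor>x\<rfloor> + 2}"

lemma near_window: "of_int (\<lfloor>x\<rfloor> - 1) < x" "x < of_int (\<lfloor>x\<rfloor> + 2)" "finite (near x)"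
    "{\<lfloor>x\<rfloor> - 1 - int m..\<lfloor>x\<rfloor> + 2} \<subseteq> near x"
  unfolding near_def by (simp_all, linarith+)

lemma card_near: "card (near x) = m + 4"
  by (simp add: near_def)

text \<open>The quantitative form of \<open>regular\<close>: a closed condition, invariant under
  integer shifts, which makes the bounds on derivatives uniform.\<close>

definition away :: "real \<Rightarrow> nat \<Rightarrow> real \<Rightarrow> bool" where
  "away \<delta> s x \<longleftrightarrow> s < m \<and> (s = m - 1 \<longrightarrow> (\<forall>n::int. \<bar>x - of_int n\<bar> \<ge> \<delta>))"

lemma away_regular: "away \<delta> s x \<Longrightarrow> 0 < \<delta> \<Longrightarrow> regular s x"
proof -
  assume h: "away \<delta> s x" "0 < \<delta>"
  have "x \<notin> \<int>" if "s = m - 1"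
  proof
    assume "x \<in> \<int>"
    then obtain n where "x = of_int n" by (elim Ints_cases)
    moreover have "\<delta> \<le> \<bar>x - of_int n\<bar>" using h(1) that unfolding away_def by blast
    ultimately show False using h(2) by simp
  qed
  then show ?thesis using h unfolding away_def regular_def by blast
qed

lemma away_shift: "away \<delta> s x \<Longrightarrow> away \<delta> s (x - of_int l)"
proof -
  have "\<bar>x - of_int l - of_int n\<bar> = \<bar>x - of_int (n + l)\<bar>" for n
    by (simp add: algebra_simps)
  then show "away \<delta> s x \<Longrightarrow> away \<delta> s (x - of_int l)" unfolding away_def by metis
qed

lemma nderiv_\<phi>_outside:
  assumes "x < 0 \<or> x > real m"
  shows "nderiv s \<phi> x = 0"
proof -
  have "nderiv s \<phi> x = nderiv s (\<lambda>_. 0) x"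
    by (rule nderiv_cong_open[of "{..<0} \<union> {real m<..}"]) (use assms \<phi>_eq_0 in auto)
  then show ?thesis by (simp add: nderiv_const_0)
qed

text \<open>On the compact part of \<open>[0, m]\<close> where \<open>away\<close> holds the
  derivative is continuous, and outside \<open>[0, m]\<close> it vanishes. Summing the bounds over
  \<open>s < m\<close> makes \<open>M\<close> independent of \<open>s\<close>.\<close>

lemma nderiv_\<phi>_bounded:
  assumes "0 < \<delta>"
  shows "\<exists>M>0. \<forall>s x. away \<delta> s x \<longrightarrow> \<bar>nderiv s \<phi> x\<bar> \<le> M"
proof -
  have "\<exists>M. \<forall>x. away \<delta> s x \<longrightarrow> \<bar>nderiv s \<phi> x\<bar> \<le> M" for s
  proof -
    define Z where "Z = {0..real m} \<inter> {x. away \<delta> s x}"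
    have "closed {x. away \<delta> s x}" unfolding away_def
      by (intro closed_Collect_conj closed_Collect_imp closed_Collect_all closed_Collect_le
          closed_Collect_const open_Collect_const continuous_intros)
    then have "compact Z" unfolding Z_def by (intro compact_Int_closed) auto
    moreover have "continuous_on Z (nderiv s \<phi>)"
      using away_regular[OF _ assms] isCont_nderiv_\<phi>
      by (intro continuous_at_imp_continuous_on) (auto simp: Z_def)
    ultimately have "bounded (nderiv s \<phi> ` Z)"
      using compact_continuous_image compact_imp_bounded by blast
    then obtain M where "\<forall>y\<in>nderiv s \<phi> ` Z. norm y \<le> M" unfolding bounded_iff by blast
    then have M: "\<bar>nderiv s \<phi> x\<bar> \<le> M" if "x \<in> Z" for x using that by auto
    have "\<bar>nderiv s \<phi> x\<bar> \<le> max M 0" if "away \<delta> s x" for x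
    proof (cases "x \<in> {0..real m}")
      case True
      then show ?thesis using M[of x] that by (simp add: Z_def)
    qed (use nderiv_\<phi>_outside[of x s] in auto)
    then show ?thesis by blast
  qed
  then obtain M where M: "\<And>s x. away \<delta> s x \<Longrightarrow> \<bar>nderiv s \<phi> x\<bar> \<le> M s" by metis
  have "\<bar>nderiv s \<phi> x\<bar> \<le> 1 + (\<Sum>s<m. \<bar>M s\<bar>)" if "away \<delta> s x" for s x
  proof -
    have "\<bar>M s\<bar> \<le> (\<Sum>s<m. \<bar>M s\<bar>)"
      using that by (intro member_le_sum[of s _ "\<lambda>s. \<bar>M s\<bar>"]) (auto simp: away_def)
    then show ?thesis using M[OF that] by linarith
  qed
  moreover have "1 + (\<Sum>s<m. \<bar>M s\<bar>) > 0" by (intro add_pos_nonneg sum_nonneg) auto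
  ultimately show ?thesis by blast
qed

lemma spline_deriv_lift_bound:
  assumes "0 < \<delta>"
  shows "\<exists>M>0. \<forall>c s x. away \<delta> s x \<longrightarrow> cmod (spline_deriv m s (lift c) x) \<le> M * (\<Sum>l\<in>near x. cmod (c l))"
proof -
  obtain M where M: "M > 0" "\<And>s x. away \<delta> s x \<Longrightarrow> \<bar>nderiv s \<phi> x\<bar> \<le> M"
    using nderiv_\<phi>_bounded[OF assms] by blast
  have "cmod (spline_deriv m s (lift c) x) \<le> M * (\<Sum>l\<in>near x. cmod (c l))" if "away \<delta> s x" for c s x
  proof -
    have "cmod (spline_deriv m s (lift c) x) = cmod (\<Sum>l\<in>near x. c l * complex_of_real (nderiv s \<phi> (x - of_int l)))"
      by (subst spline_deriv_lift[OF near_window away_regular[OF that assms]]) (rule refl)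
    also have "\<dots> \<le> (\<Sum>l\<in>near x. M * cmod (c l))"
    proof (rule sum_norm_le)
      fix l
      show "cmod (c l * complex_of_real (nderiv s \<phi> (x - of_int l))) \<le> M * cmod (c l)"
        using mult_right_mono[OF M(2)[OF away_shift[OF that, of l]], of "cmod (c l)"]
        by (simp add: norm_mult mult.commute)
    qed
    finally show ?thesis by (simp add: sum_distrib_left)
  qed
  with M(1) show ?thesis by blast
qed

text \<open>The derivative bound for order 0: since \<open>m \<ge> 2\<close>, this order differs
  from m - 1, and \<open>away\<close> puts no restriction on the point.\<close>

lemma lift_bound: "\<exists>M>0. \<forall>c x. cmod (lift c x) \<le> M * (\<Sum>l\<in>near x. cmod (c l))"
proof -
  have "away 1 0 x" for x using m2 by (auto simp: away_def)
  moreover have "spline_deriv m 0 (lift c) x = lift c x" for c x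
    using m2 by (simp add: spline_deriv_def)
  ultimately show ?thesis using spline_deriv_lift_bound[of 1] by (metis zero_less_one)
qed

text \<open>The indices are exactly those of the shifts active on (0, 1); every other unit interval
  is reduced to this one by translation.\<close>

definition unit_sum :: "(int \<Rightarrow> complex) \<Rightarrow> real \<Rightarrow> complex" where
  "unit_sum b x = (\<Sum>l\<in>{1 - int m..0}. b l * complex_of_real (\<phi> (x - of_int l)))"

lemma unit_sum_continuous_on: "continuous_on S (unit_sum b)"
  unfolding unit_sum_def[abs_def]
  by (intro continuous_intros continuous_on_compose2[OF \<phi>_continuous_on[of UNIV]]) auto

lemma unit_sum_eq_0:
  assumes "\<And>x. x \<in> {0<..<1} \<Longrightarrow> unit_sum b x = 0" "l \<in> {1 - int m..0}"
  shows "b l = 0"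
proof -
  have r: "d l = 0" if "\<And>x. x \<in> {0<..<1} \<Longrightarrow> spl {1 - int m..0} d x = 0" for d
    by (rule spl_local_independence[where \<alpha> = 0 and \<beta> = 1 and n = 0, OF _ _ _ that])
      (use assms(2) in auto)
  have "Re (b l) = 0" "Im (b l) = 0"
    by (rule r; use arg_cong[OF assms(1), of _ Re] arg_cong[OF assms(1), of _ Im] in
        \<open>simp add: unit_sum_def spl_def\<close>)+
  then show ?thesis by (simp add: complex_eq_iff)
qed

definition unit_int :: "real \<Rightarrow> (int \<Rightarrow> complex) \<Rightarrow> ennreal" where
  "unit_int q b = (\<integral>\<^sup>+x. ennreal (cmod (unit_sum b x) powr q) * indicator {0..<1} x \<partial>lborel)"

lemma unit_int_measurable: 
  "(\<lambda>x. ennreal (cmod (unit_sum b x) powr q) * indicator {0..<1} x) \<in> borel_measurable borel"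
proof -
  have [measurable]: "unit_sum b \<in> borel_measurable borel"
    by (rule borel_measurable_continuous_onI[OF unit_sum_continuous_on])
  show ?thesis by measurable
qed

text \<open>Equivalence of sizes on a finite-dimensional space, by compactness of the unit sphere;
  it holds for all \<open>q > 0\<close>, as only homogeneity is used and no triangle inequality. A
  limit of counterexamples has integral 0 by Fatou, so it vanishes on (0, 1) by continuity, and
  local independence makes all its coefficients 0.\<close>

lemma unit_int_lower:
  assumes q: "0 < q"
  shows "\<exists>C>0. \<forall>b. ennreal ((\<Sum>l\<in>{1 - int m..0}. cmod (b l)) powr q) \<le> ennreal C * unit_int q b"
proof (rule ccontr)
  let ?A = "{1 - int m..0}"
  assume neg: "\<not> ?thesis"
  have "\<exists>b. ennreal ((\<Sum>l\<in>?A. cmod (b l)) powr q) > ennreal (real n + 1) * unit_int q b" for n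
    using neg[unfolded not_ex, rule_format, of "real n + 1"] by (force simp: not_le)
  then obtain b where b: "\<And>n. ennreal ((\<Sum>l\<in>?A. cmod (b n l)) powr q) > ennreal (real n + 1) * unit_int q (b n)"
    by metis
  define M where "M n = (\<Sum>l\<in>?A. cmod (b n l))" for n
  have M0: "M n \<ge> 0" for n unfolding M_def by (intro sum_nonneg) auto
  have Mpos: "M n > 0" for n
  proof -
    have "M n \<noteq> 0"
    proof
      assume "M n = 0"
      then show False using b[of n] unfolding M_def[symmetric] by simp
    qed
    then show ?thesis using M0[of n] by linarith
  qed
  define d where "d n l = b n l / of_real (M n)" for n l
  have d1: "(\<Sum>l\<in>?A. cmod (d n l)) = 1" for n
  proof -
    have "(\<Sum>l\<in>?A. cmod (d n l)) = (\<Sum>l\<in>?A. cmod (b n l) / M n)"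
      using Mpos[of n] by (simp add: d_def norm_divide)
    also have "\<dots> = M n / M n" unfolding sum_divide_distrib[symmetric] M_def ..
    finally show ?thesis using Mpos[of n] by simp
  qed
  have small: "ennreal (real n + 1) * unit_int q (d n) < 1" for n
  proof -
    have us: "unit_sum (b n) x = of_real (M n) * unit_sum (d n) x" for x
      using Mpos[of n] unfolding unit_sum_def sum_distrib_left by (intro sum.cong) (auto simp: d_def)
    have "unit_int q (b n) = (\<integral>\<^sup>+x. ennreal (M n powr q) * (ennreal (cmod (unit_sum (d n) x) powr q) * indicator {0..<1} x) \<partial>lborel)"
      unfolding unit_int_def us using Mpos[of n]
      by (intro nn_integral_cong) (auto simp: norm_mult powr_mult ennreal_mult split: split_indicator)
    also have "\<dots> = ennreal (M n powr q) * unit_int q (d n)"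
      unfolding unit_int_def using unit_int_measurable by (intro nn_integral_cmult) auto
    finally have e: "unit_int q (b n) = ennreal (M n powr q) * unit_int q (d n)" .
    have "ennreal (M n powr q) * (ennreal (real n + 1) * unit_int q (d n)) < ennreal (M n powr q) * 1"
      using b[of n] unfolding e M_def[symmetric] by (simp add: mult.left_commute)
    then show ?thesis using Mpos[of n]
      by (metis linorder_not_less mult_left_mono zero_le)
  qed
  have "\<exists>r d'. strict_mono r \<and> (\<forall>l\<in>?A. (\<lambda>n. d (r n) l) \<longlonglongrightarrow> d' l)"
  proof (rule finite_family_convergent_subsequence[where X = "\<lambda>l n. d n l"])
    show "bounded (range (\<lambda>n. d n l))" if "l \<in> ?A" for l
    proof (rule boundedI[of _ 1])
      fix z assume "z \<in> range (\<lambda>n. d n l)"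
      then obtain n where z: "z = d n l" by blast
      have "cmod (d n l) \<le> (\<Sum>l\<in>?A. cmod (d n l))" using that by (intro member_le_sum) auto
      then show "norm z \<le> 1" unfolding d1 z .
    qed
  qed simp
  then obtain r d' where r: "strict_mono r" "\<forall>l\<in>?A. (\<lambda>n. d (r n) l) \<longlonglongrightarrow> d' l"
    by (elim exE conjE)
  have "unit_int q d' = 0" unfolding unit_int_def
  proof (rule nn_integral_limit_eq_0)
    show "(\<lambda>x. ennreal (cmod (unit_sum (d (r n)) x) powr q) * indicator {0..<1} x) \<in> borel_measurable lborel" for n
      using unit_int_measurable by simp
    fix x
    have "(\<lambda>n. unit_sum (d (r n)) x) \<longlonglongrightarrow> unit_sum d' x"
      unfolding unit_sum_def using r(2) by (intro tendsto_sum tendsto_mult tendsto_const) auto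
    then have "(\<lambda>n. cmod (unit_sum (d (r n)) x) powr q) \<longlonglongrightarrow> cmod (unit_sum d' x) powr q"
      using q by (intro tendsto_powr' tendsto_norm tendsto_const) auto
    then show "(\<lambda>n. ennreal (cmod (unit_sum (d (r n)) x) powr q) * indicator {0..<1} x) \<longlonglongrightarrow>
        ennreal (cmod (unit_sum d' x) powr q) * indicator {0..<1} x"
      by (cases "x \<in> {0..<1::real}") (auto intro!: tendsto_ennrealI)
  next
    have "unit_int q (d (r n)) \<le> ennreal (1 / (real n + 1))" for n
    proof -
      have "ennreal (real n + 1) * unit_int q (d (r n)) \<le> ennreal (real (r n) + 1) * unit_int q (d (r n))"
        using seq_suble[OF r(1), of n] by (intro mult_right_mono ennreal_leI) auto
      also have "\<dots> \<le> 1" using small[of "r n"] by simp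
      finally have "ennreal (1 / (real n + 1)) * (ennreal (real n + 1) * unit_int q (d (r n))) \<le> ennreal (1 / (real n + 1)) * 1"
        by (intro mult_left_mono) auto
      moreover have "ennreal (1 / (real n + 1)) * ennreal (real n + 1) = 1"
        by (subst ennreal_mult[symmetric]) auto
      ultimately show ?thesis by (simp add: mult.assoc[symmetric])
    qed
    note le = this
    have "(\<lambda>n. ennreal (1 / (real n + 1))) \<longlonglongrightarrow> ennreal 0"
      by (intro tendsto_ennrealI) (use LIMSEQ_inverse_real_of_nat in \<open>simp add: inverse_eq_divide add.commute\<close>)
    then have "(\<lambda>n. ennreal (1 / (real n + 1))) \<longlonglongrightarrow> 0" by (simp only: ennreal_0)
    then have "(\<lambda>n. unit_int q (d (r n))) \<longlonglongrightarrow> 0"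
      by (rule tendsto_sandwich[OF always_eventually always_eventually tendsto_const, rotated 2])
        (use le in \<open>blast intro: zero_le\<close>)+
    then show "(\<lambda>n. \<integral>\<^sup>+ x. ennreal (cmod (unit_sum (d (r n)) x) powr q) * indicator {0..<1} x \<partial>lborel) \<longlonglongrightarrow> 0"
      unfolding unit_int_def .
  qed
  then have "AE x in lborel. ennreal (cmod (unit_sum d' x) powr q) * indicator {0..<1} x = 0"
    unfolding unit_int_def using unit_int_measurable by (subst (asm) nn_integral_0_iff_AE) auto
  then have "AE x in lborel. x \<in> {0<..<1} \<longrightarrow> unit_sum d' x = 0"
    by eventually_elim (auto simp: ennreal_eq_0_iff split: split_indicator_asm)
  from AE_zero_open_interval[OF this unit_sum_continuous_on]
  have "d' l = 0" if "l \<in> ?A" for l using unit_sum_eq_0[OF _ that] by blast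
  moreover have "(\<lambda>n. \<Sum>l\<in>?A. cmod (d (r n) l)) \<longlonglongrightarrow> (\<Sum>l\<in>?A. cmod (d' l))"
    using r(2) by (intro tendsto_sum tendsto_norm) auto
  ultimately show False unfolding d1 using LIMSEQ_unique[OF tendsto_const] by fastforce
qed

text \<open>Translation by \<open>n\<close> turns the series on \<open>[n, n + 1)\<close> into
  \<open>unit_sum b\<close>, where \<open>c n\<close> appears as \<open>b 0\<close>.\<close>

lemma lift_lower:
  assumes q: "0 < q"
  shows "\<exists>C>0. \<forall>c n. ennreal (cmod (c n) powr q) \<le>
    ennreal C * (\<integral>\<^sup>+x. ennreal (cmod (lift c x) powr q) * indicator {of_int n..<of_int n + 1} x \<partial>lborel)"
proof -
  obtain C where C: "C > 0"
    "\<And>b. ennreal ((\<Sum>l\<in>{1 - int m..0}. cmod (b l)) powr q) \<le> ennreal C * unit_int q b"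
    using unit_int_lower[OF q] by blast
  have "ennreal (cmod (c n) powr q) \<le>
    ennreal C * (\<integral>\<^sup>+x. ennreal (cmod (lift c x) powr q) * indicator {of_int n..<of_int n + 1} x \<partial>lborel)" for c n
  proof -
    define b where "b l = c (l + n)" for l
    have [measurable]: "lift c \<in> borel_measurable borel"
      by (rule borel_measurable_continuous_onI[OF lift_continuous_on])
    \<comment> \<open>The factor 1 prepares the affine substitution in the last step.\<close>
    have e: "lift c (of_int n + 1 * x) = unit_sum b x" if "x \<in> {0..<1}" for x
    proof -
      have "lift c (of_int n + x) = (\<Sum>l\<in>{1 - int m + n..n}. c l * complex_of_real (\<phi> (of_int n + x - of_int l)))"
      proof (rule lift_eq_sum)
        fix l :: int assume "of_int l < of_int n + x" "of_int n + x < of_int l + real m"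
        then have "real_of_int l < of_int (n + 1)" "real_of_int n < of_int (l + int m)" using that by auto
        then show "l \<in> {1 - int m + n..n}" unfolding of_int_less_iff by simp
      qed simp
      also have "\<dots> = unit_sum b x" unfolding unit_sum_def b_def
        by (rule sum.reindex_bij_witness[of _ "\<lambda>l. l + n" "\<lambda>l. l - n"]) (auto simp: algebra_simps)
      finally show ?thesis by simp
    qed
    have "cmod (c n) \<le> (\<Sum>l\<in>{1 - int m..0}. cmod (b l))"
      using m2 member_le_sum[of 0 "{1 - int m..0}" "\<lambda>l. cmod (b l)"] by (simp add: b_def)
    then have "ennreal (cmod (c n) powr q) \<le> ennreal ((\<Sum>l\<in>{1 - int m..0}. cmod (b l)) powr q)"
      using q by (intro ennreal_leI powr_mono2) auto
    also have "\<dots> \<le> ennreal C * unit_int q b" by (rule C(2))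
    also have "unit_int q b = (\<integral>\<^sup>+x. ennreal (cmod (lift c (of_int n + 1 * x)) powr q) * indicator {of_int n..<of_int n + 1} (of_int n + 1 * x) \<partial>lborel)"
      unfolding unit_int_def by (intro nn_integral_cong) (auto simp: e[simplified] split: split_indicator)
    also have "\<dots> = (\<integral>\<^sup>+x. ennreal (cmod (lift c x) powr q) * indicator {of_int n..<of_int n + 1} x \<partial>lborel)"
      by (subst (2) nn_integral_real_affine[of _ 1 "of_int n"]) auto
    finally show ?thesis .
  qed
  with C(1) show ?thesis by blast
qed

end

section \<open>Summation over windows\<close>

lemma separated_sequence_growth:
  fixes x :: "int \<Rightarrow> real"
  assumes "\<And>j. x j + e \<le> x (j + 1)"
  shows "x j + e * real n \<le> x (j + int n)"
proof (induction n)
  case (Suc n)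
  then show ?case using assms[of "j + int n"] by (simp add: algebra_simps)
qed simp

text \<open>Separation makes the sequence unbounded in both directions. The indices are integers, so
  the least one beyond \<open>t\<close> is sought by counting upwards from an index
  \<open>lo\<close> on the left of \<open>t\<close>.\<close>

lemma separated_sequence_floor:
  fixes x :: "int \<Rightarrow> real"
  assumes e: "0 < e" and sep: "\<And>j. x j + e \<le> x (j + 1)"
  obtains i where "x i \<le> t" "t < x (i + 1)"
proof -
  obtain n1 :: nat where n1: "(x 0 - t) / e \<le> real n1" using real_arch_simple by blast
  define lo where "lo = - int n1"
  have "x lo \<le> t"
    using separated_sequence_growth[of x e lo n1, OF sep] n1 e by (simp add: lo_def field_simps)
  obtain n2 :: nat where n2: "(t - x lo) / e < real n2" using reals_Archimedean2 by blast
  have ex: "t < x (lo + int n2)"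
    using separated_sequence_growth[of x e lo n2, OF sep] n2 e by (simp add: field_simps)
  define n where "n = (LEAST n. t < x (lo + int n))"
  have n: "t < x (lo + int n)" unfolding n_def using ex by (rule LeastI)
  then have "n \<noteq> 0" using \<open>x lo \<le> t\<close> by (intro notI) simp
  then obtain k where k: "n = Suc k" by (cases n) auto
  have "x (lo + int k) \<le> t" using not_less_Least[of k "\<lambda>n. t < x (lo + int n)"]
    unfolding n_def[symmetric] k by simp
  moreover have "t < x (lo + int k + 1)" using n by (simp add: k add.commute add.left_commute)
  ultimately show ?thesis by (rule that)
qed

context peb
begin

text \<open>The order of the quantifiers is the point: \<open>b\<close>, \<open>W\<close> and
  \<open>J\<close> are determined by \<open>m\<close>, \<open>\<rho>\<close> and \<open>e\<close>,
  before \<open>\<eta>\<close> is given, so \<open>\<eta>\<close> can be chosen in terms of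
  \<open>W\<close>. In the proof the index of the statement is called \<open>H\<close>, and
  \<open>K\<close> is the fixed position in the window to which uniqueness applies.\<close>

lemma window_estimate:
  fixes x :: "int \<Rightarrow> real" and \<mu> :: "real \<Rightarrow> nat"
  assumes \<rho>: "0 < \<rho>" "\<rho> < 1" and e: "0 < e" and \<delta>: "0 < \<delta>"
    and sep: "\<And>j. x j + e \<le> x (j + 1)"
    and gap: "\<And>j. x (j + 1) - x j \<le> \<rho> * (1 + real (\<mu> (x (j + 1))))"
    and \<mu>: "\<And>j. \<mu> (x j) \<le> m - 1"
    and aw: "\<And>j n. \<mu> (x j) = m - 1 \<Longrightarrow> \<bar>x j - of_int n\<bar> \<ge> \<delta>"
  shows "\<exists>b W J. 0 \<le> W \<and> (\<forall>\<eta>>0. \<exists>C>0. \<forall>c K. \<exists>Y. finite Y \<and> card Y \<le> J \<and> Y \<subseteq> range x \<and>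
    (\<forall>t\<in>Y. \<bar>t - of_int K\<bar> \<le> b) \<and>
    cmod (c K) \<le> C * (\<Sum>t\<in>Y. \<Sum>s=0..\<mu> t. cmod (spline_deriv m s (lift c) t)) +
      \<eta> * (\<Sum>l\<in>{K - W..K + W}. cmod (c l)))"
proof -
  define K where "K = \<lceil>(real m - 1) / (1 - \<rho>)\<rceil>"
  have K: "of_int K \<ge> (real m - 1) / (1 - \<rho>)" unfolding K_def by (rule le_of_int_ceiling)
  have "0 \<le> (real m - 1) / (1 - \<rho>)" using \<rho> m2 by simp
  then have K0: "0 \<le> K" unfolding K_def by simp
  \<comment> \<open>Enough points to get from \<open>- m\<close>, the leftmost place for the first
    one, to \<open>K + 1\<close> in steps of length at least \<open>e\<close>.\<close>
  obtain J :: nat where J: "(of_int K + 1 + real m) / e \<le> real J" using real_arch_simple by blast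
  define N where "N = int (m * (J + 1))"
  \<comment> \<open>By \<open>config_bounds\<close> the points stay within \<open>N\<close> of the
    origin, so the shifts active near them have indices between \<open>- N - 1 - m\<close> and
    \<open>N + 1\<close>; the summand \<open>K\<close> places \<open>K\<close> itself in the
    window.\<close>
  define L where "L = N + 1 + int m + K"
  define A where "A = {- L..L}"
  have N0: "0 \<le> N" unfolding N_def by (rule of_nat_0_le_iff)
  then have LN: "0 \<le> L" "K \<in> A" "finite A" using K0 by (auto simp: L_def A_def)
  have main: "\<exists>Y. finite Y \<and> card Y \<le> J \<and> Y \<subseteq> range x \<and>
    (\<forall>t\<in>Y. \<bar>t - of_int H\<bar> \<le> of_int (N + K)) \<and>
    cmod (c H) \<le> C * (\<Sum>t\<in>Y. \<Sum>s=0..\<mu> t. cmod (spline_deriv m s (lift c) t)) +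
      \<eta> * (\<Sum>l\<in>{H - (L + K)..H + (L + K)}. cmod (c l))"
    if C: "\<And>y \<nu> c. config \<rho> e \<delta> K J y \<nu> \<Longrightarrow>
      cmod (c K) \<le> C * sample_vals A c J y \<nu> + \<eta> * (\<Sum>l\<in>A. cmod (c l))" and \<eta>: "0 < \<eta>"
    for C \<eta> c H
  proof -
    define T where "T = H - K"
    obtain i where i: "x i \<le> of_int T" "of_int T < x (i + 1)"
      using separated_sequence_floor[of e x "of_int T", OF e sep] by blast
    define y where "y j = x (i + int j) - of_int T" for j
    define \<nu> where "\<nu> j = 1 + \<mu> (x (i + int j))" for j
    define t where "t j = x (i + int (Suc j))" for j
    have S: "i + int (Suc j) = i + int j + 1" for j by simp
    have cfg: "config \<rho> e \<delta> K J y \<nu>"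
      unfolding config_def
    proof (intro conjI allI impI)
      \<comment> \<open>The sample after \<open>x i\<close> lies beyond \<open>T\<close> and the gap
        between them is at most \<open>m\<close>, so \<open>x i\<close> is at most \<open>m\<close>
        to the left of \<open>T\<close>.\<close>
      have "\<rho> * (1 + real (\<mu> (x (i + 1)))) \<le> 1 * real m"
        using \<rho> \<mu>[of "i + 1"] m2 by (intro mult_mono) auto
      then show y0: "- real m \<le> y 0" using i gap[of i] by (simp add: y_def)
      show "y 0 \<le> 0" using i by (simp add: y_def)
      have "of_int K + 1 + real m \<le> e * real J" using J e by (simp add: field_simps)
      then show "of_int K + 1 \<le> y J"
        using separated_sequence_growth[of x e i J, OF sep] y0 by (simp add: y_def)
      fix j
      show "y j + e \<le> y (Suc j)" using sep[of "i + int j"] unfolding y_def S by simp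
      show "y (Suc j) - y j \<le> \<rho> * real (\<nu> (Suc j))"
        using gap[of "i + int j"] unfolding y_def \<nu>_def S by simp
      show "1 \<le> \<nu> (Suc j)" by (simp add: \<nu>_def)
      show "\<nu> (Suc j) \<le> m" using \<mu>[of "i + int (Suc j)"] m2 unfolding \<nu>_def by linarith
      show "\<delta> \<le> \<bar>y (Suc j) - of_int n\<bar>" if "\<nu> (Suc j) = m" for n
      proof -
        have "\<mu> (x (i + int (Suc j))) = m - 1" using that unfolding \<nu>_def by simp
        from aw[OF this, of "n + T"] show ?thesis by (simp add: y_def algebra_simps)
      qed
    qed
    have yb: "\<bar>y j\<bar> \<le> of_int N" if "j \<le> J" for j
      using config_bounds[OF cfg \<rho> e that] unfolding N_def by (simp add: algebra_simps)
    have val: "(\<Sum>l\<in>A. c (l + T) * complex_of_real (nderiv s \<phi> (y (Suc j) - of_int l))) =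
        spline_deriv m s (lift c) (t j)" if j: "j < J" and s: "s < \<nu> (Suc j)" for j s
    proof -
      have "away \<delta> s (t j)"
        unfolding away_def t_def
      proof (intro conjI impI allI)
        have s: "s \<le> \<mu> (x (i + int (Suc j)))" using s by (simp add: \<nu>_def)
        then show "s < m" using \<mu>[of "i + int (Suc j)"] m2 by linarith
        show "\<delta> \<le> \<bar>x (i + int (Suc j)) - of_int n\<bar>" if "s = m - 1" for n
          by (rule aw) (use s that \<mu>[of "i + int (Suc j)"] in linarith)
      qed
      then have r: "regular s (t j)" using \<delta> by (rule away_regular)
      have ty: "t j = y (Suc j) + of_int T" by (simp add: t_def y_def)
      have "spline_deriv m s (lift c) (t j) = (\<Sum>l\<in>{- L + T..L + T}. c l * complex_of_real (nderiv s \<phi> (t j - of_int l)))"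
      proof (rule spline_deriv_lift[of "T - N - 1" _ "T + N + 1", OF _ _ _ _ r])
        show "of_int (T - N - 1) < t j" "t j < of_int (T + N + 1)"
          using yb[of "Suc j"] j unfolding ty by auto
        show "{T - N - 1 - int m..T + N + 1} \<subseteq> {- L + T..L + T}" using K0 by (auto simp: L_def)
      qed simp
      also have "\<dots> = (\<Sum>l\<in>A. c (l + T) * complex_of_real (nderiv s \<phi> (y (Suc j) - of_int l)))"
        by (rule sum.reindex_bij_witness[of _ "\<lambda>l. l + T" "\<lambda>l. l - T"])
          (auto simp: A_def ty algebra_simps)
      finally show ?thesis ..
    qed
    have sv: "sample_vals A (\<lambda>l. c (l + T)) J y \<nu> = (\<Sum>j<J. \<Sum>s=0..\<mu> (t j). cmod (spline_deriv m s (lift c) (t j)))"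
      unfolding sample_vals_def
    proof (rule sum.cong[OF refl])
      fix j assume j: "j \<in> {..<J}"
      have "{..<\<nu> (Suc j)} = {0..\<mu> (t j)}" by (auto simp: \<nu>_def t_def)
      then show "(\<Sum>s<\<nu> (Suc j). cmod (\<Sum>l\<in>A. c (l + T) * complex_of_real (nderiv s \<phi> (y (Suc j) - of_int l)))) =
        (\<Sum>s=0..\<mu> (t j). cmod (spline_deriv m s (lift c) (t j)))"
        using val[of j] j by (intro sum.cong) auto
    qed
    have xm: "x k < x l" if "k < l" for k l
    proof -
      define n where "n = nat (l - k)"
      have n: "l = k + int n" "n > 0" using that by (simp_all add: n_def)
      then have "0 < e * real n" using e by simp
      then show ?thesis using separated_sequence_growth[of x e k n, OF sep] n by simp
    qed
    have "inj_on t {..<J}"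
    proof (rule inj_onI)
      fix j k assume "t j = t k"
      then have "i + int (Suc j) = i + int (Suc k)" unfolding t_def using xm by (metis less_irrefl linorder_neqE)
      then show "j = k" by simp
    qed
    then have sY: "sum g (t ` {..<J}) = (\<Sum>j<J. g (t j))" for g :: "real \<Rightarrow> real"
      by (simp add: sum.reindex)
    have "(\<Sum>l\<in>A. cmod (c (l + T))) = (\<Sum>l\<in>{- L + T..L + T}. cmod (c l))"
      by (rule sum.reindex_bij_witness[of _ "\<lambda>l. l - T" "\<lambda>l. l + T"]) (auto simp: A_def)
    also have "\<dots> \<le> (\<Sum>l\<in>{H - (L + K)..H + (L + K)}. cmod (c l))"
      using K0 by (intro sum_mono2) (auto simp: T_def)
    finally have tail: "\<eta> * (\<Sum>l\<in>A. cmod (c (l + T))) \<le> \<eta> * (\<Sum>l\<in>{H - (L + K)..H + (L + K)}. cmod (c l))"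
      using \<eta> by (intro mult_left_mono) auto
    show ?thesis
    proof (intro exI[of _ "t ` {..<J}"] conjI ballI)
      show "card (t ` {..<J}) \<le> J" using card_image_le[of "{..<J}" t] by simp
      show "t ` {..<J} \<subseteq> range x" by (auto simp: t_def)
      show "\<bar>u - of_int H\<bar> \<le> of_int (N + K)" if u: "u \<in> t ` {..<J}" for u
      proof -
        obtain j where "j < J" "u = t j" using u by auto
        then have "\<bar>u - of_int T\<bar> \<le> of_int N" using yb[of "Suc j"] by (simp add: y_def t_def)
        moreover have "0 \<le> real_of_int K" using K0 by simp
        ultimately show ?thesis unfolding T_def of_int_diff of_int_add by linarith
      qed
      show "cmod (c H) \<le> C * (\<Sum>t\<in>t ` {..<J}. \<Sum>s=0..\<mu> t. cmod (spline_deriv m s (lift c) t)) +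
        \<eta> * (\<Sum>l\<in>{H - (L + K)..H + (L + K)}. cmod (c l))"
        using C[OF cfg, of "\<lambda>l. c (l + T)"] tail unfolding sv sY by (simp add: T_def)
    qed simp
  qed
  have est: "\<exists>C>0. \<forall>c H. \<exists>Y. finite Y \<and> card Y \<le> J \<and> Y \<subseteq> range x \<and>
    (\<forall>t\<in>Y. \<bar>t - of_int H\<bar> \<le> of_int (N + K)) \<and>
    cmod (c H) \<le> C * (\<Sum>t\<in>Y. \<Sum>s=0..\<mu> t. cmod (spline_deriv m s (lift c) t)) +
      \<eta> * (\<Sum>l\<in>{H - (L + K)..H + (L + K)}. cmod (c l))" if \<eta>: "0 < \<eta>" for \<eta>
  proof -
    from local_estimate[OF \<rho> e \<delta> LN(3,2) K \<eta>, of J] obtain C where C: "C > 0"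
      "\<And>y \<nu> c. config \<rho> e \<delta> K J y \<nu> \<Longrightarrow>
        cmod (c K) \<le> C * sample_vals A c J y \<nu> + \<eta> * (\<Sum>l\<in>A. cmod (c l))"
      by blast
    then show ?thesis using main[OF C(2) \<eta>] by (intro exI[of _ C] conjI allI)
  qed
  have nonneg: "0 \<le> L + K" using LN K0 by simp
  show ?thesis
    by (rule exI[of _ "of_int (N + K)"], rule exI[of _ "L + K"], rule exI[of _ J],
        rule conjI[OF nonneg], intro allI impI, rule est)
qed

end

text \<open>On a separated family the floor of \<open>f a / e\<close> is injective, and its values
  lie in an integer interval whose length is bounded independently of \<open>t\<close>. The map
  \<open>f\<close> allows for real samples as well as integer indices.\<close>

lemma separated_card:
  fixes f :: "'a \<Rightarrow> real"
  assumes e: "0 < e" and sep: "\<And>a a'. a \<in> S \<Longrightarrow> a' \<in> S \<Longrightarrow> \<bar>f a - f a'\<bar> < e \<Longrightarrow> a = a'"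
  shows "\<exists>D. \<forall>t. finite {a \<in> S. \<bar>f a - t\<bar> \<le> b} \<and> card {a \<in> S. \<bar>f a - t\<bar> \<le> b} \<le> D"
proof -
  define D where "D = nat (\<lceil>2 * b / e\<rceil> + 2)"
  have "finite {a \<in> S. \<bar>f a - t\<bar> \<le> b} \<and> card {a \<in> S. \<bar>f a - t\<bar> \<le> b} \<le> D" for t
  proof -
    let ?B = "{a \<in> S. \<bar>f a - t\<bar> \<le> b}" and ?g = "\<lambda>a. \<lfloor>f a / e\<rfloor>"
    have inj: "inj_on ?g ?B"
    proof (rule inj_onI)
      fix a a' assume a: "a \<in> ?B" "a' \<in> ?B" and eq: "\<lfloor>f a / e\<rfloor> = \<lfloor>f a' / e\<rfloor>"
      have "\<bar>f a / e - f a' / e\<bar> < 1" using eq by linarith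
      then have "\<bar>f a - f a'\<bar> < e" using e by (simp add: diff_divide_distrib[symmetric])
      then show "a = a'" using sep a by blast
    qed
    have sub: "?g ` ?B \<subseteq> {\<lfloor>(t - b) / e\<rfloor>..\<lfloor>(t + b) / e\<rfloor>}"
      using e by (auto intro!: floor_mono divide_right_mono)
    have "\<lfloor>(t + b) / e\<rfloor> - \<lfloor>(t - b) / e\<rfloor> + 1 \<le> \<lceil>2 * b / e\<rceil> + 2"
    proof -
      have "(t + b) / e = (t - b) / e + 2 * b / e" by (simp add: add_divide_distrib[symmetric])
      then show ?thesis by linarith
    qed
    then have "card {\<lfloor>(t - b) / e\<rfloor>..\<lfloor>(t + b) / e\<rfloor>} \<le> D" unfolding D_def card_atLeastAtMost_int
      by (intro nat_mono) linarith
    moreover have "card ?B \<le> card {\<lfloor>(t - b) / e\<rfloor>..\<lfloor>(t + b) / e\<rfloor>}"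
      by (rule card_inj_on_le[OF inj sub]) simp
    moreover have "finite ?B" by (rule inj_on_finite[OF inj sub]) simp
    ultimately show ?thesis by simp
  qed
  then show ?thesis by blast
qed

text \<open>Turns sums into integrals over counting measure, where the order of integration can be
  exchanged; both sides are suprema of finite sums.\<close>

lemma infsum_eq_nn_integral:
  fixes f :: "'a \<Rightarrow> ennreal"
  assumes "countable A"
  shows "(\<Sum>\<^sub>\<infinity>x\<in>A. f x) = (\<integral>\<^sup>+x. f x \<partial>count_space A)"
proof (rule antisym)
  have i: "(\<Sum>\<^sub>\<infinity>x\<in>A. f x) = (SUP F\<in>{F. finite F \<and> F \<subseteq> A}. sum f F)"
    by (rule nonneg_infsum_complete) simp
  show "(\<Sum>\<^sub>\<infinity>x\<in>A. f x) \<le> (\<integral>\<^sup>+x. f x \<partial>count_space A)" unfolding i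
  proof (rule SUP_least)
    fix F assume F: "F \<in> {F. finite F \<and> F \<subseteq> A}"
    then have "sum f F = (\<integral>\<^sup>+x. f x * indicator F x \<partial>count_space A)"
      by (subst nn_integral_count_space'[of F]) auto
    also have "\<dots> \<le> (\<integral>\<^sup>+x. f x \<partial>count_space A)"
      by (intro nn_integral_mono) (simp split: split_indicator)
    finally show "sum f F \<le> (\<integral>\<^sup>+x. f x \<partial>count_space A)" .
  qed
  show "(\<integral>\<^sup>+x. f x \<partial>count_space A) \<le> (\<Sum>\<^sub>\<infinity>x\<in>A. f x)"
  proof (cases "finite A")
    case True
    then show ?thesis by (simp add: nn_integral_count_space_finite)
  next
    case False
    define g where "g = from_nat_into A"
    have g: "bij_betw g UNIV A" unfolding g_def by (rule bij_betw_from_nat_into[OF assms False])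
    then have "(\<integral>\<^sup>+x. f x \<partial>count_space A) = (\<integral>\<^sup>+n. f (g n) \<partial>count_space UNIV)"
      by (rule nn_integral_bij_count_space[symmetric])
    also have "\<dots> = (\<Sum>n. f (g n))" by (rule nn_integral_count_space_nat)
    also have "\<dots> = (SUP n. \<Sum>i<n. f (g i))" by (rule suminf_eq_SUP)
    also have "\<dots> \<le> (\<Sum>\<^sub>\<infinity>x\<in>A. f x)" unfolding i
    proof (rule SUP_least)
      fix n :: nat
      have "inj_on g {..<n}" using g by (auto simp: bij_betw_def intro: inj_on_subset)
      then have "(\<Sum>i<n. f (g i)) = sum f (g ` {..<n})" by (simp add: sum.reindex)
      also have "\<dots> \<le> (SUP F\<in>{F. finite F \<and> F \<subseteq> A}. sum f F)"
        using g by (intro SUP_upper) (auto simp: bij_betw_def)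
      finally show "(\<Sum>i<n. f (g i)) \<le> (SUP F\<in>{F. finite F \<and> F \<subseteq> A}. sum f F)" .
    qed
    finally show ?thesis .
  qed
qed

text \<open>Schur's test for a 0-1 kernel.\<close>

lemma nn_integral_sum_bounded_overlap:
  fixes g :: "'a \<Rightarrow> ennreal"
  assumes "countable A" "countable B"
    and N: "\<And>b. b \<in> B \<Longrightarrow> finite (N b) \<and> N b \<subseteq> A"
    and D: "\<And>a. a \<in> A \<Longrightarrow> finite {b \<in> B. a \<in> N b} \<and> card {b \<in> B. a \<in> N b} \<le> D"
  shows "(\<integral>\<^sup>+b. (\<Sum>a\<in>N b. g a) \<partial>count_space B) \<le> of_nat D * (\<integral>\<^sup>+a. g a \<partial>count_space A)"
proof -
  have "(\<integral>\<^sup>+b. (\<Sum>a\<in>N b. g a) \<partial>count_space B) =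
      (\<integral>\<^sup>+b. \<integral>\<^sup>+a. g a * indicator (N b) a \<partial>count_space A \<partial>count_space B)"
  proof (rule nn_integral_cong)
    fix b assume "b \<in> space (count_space B)"
    then have b: "finite (N b)" "N b \<subseteq> A" using N by auto
    then show "(\<Sum>a\<in>N b. g a) = (\<integral>\<^sup>+a. g a * indicator (N b) a \<partial>count_space A)"
      by (subst nn_integral_count_space'[of "N b"]) auto
  qed
  also have "\<dots> = (\<integral>\<^sup>+a. \<integral>\<^sup>+b. g a * indicator (N b) a \<partial>count_space B \<partial>count_space A)"
    by (rule nn_integral_count_space_nn_integral[OF assms(1)]) simp
  also have "\<dots> \<le> (\<integral>\<^sup>+a. of_nat D * g a \<partial>count_space A)"
  proof (rule nn_integral_mono)
    fix a assume "a \<in> space (count_space A)"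
    then have a: "finite {b \<in> B. a \<in> N b}" "card {b \<in> B. a \<in> N b} \<le> D" using D by auto
    have "(\<integral>\<^sup>+b. g a * indicator (N b) a \<partial>count_space B) = (\<Sum>b\<in>{b \<in> B. a \<in> N b}. g a * indicator (N b) a)"
      by (rule nn_integral_count_space'[OF a(1)]) auto
    also have "\<dots> = of_nat (card {b \<in> B. a \<in> N b}) * g a" by simp
    also have "\<dots> \<le> of_nat D * g a" using a(2) by (intro mult_right_mono) auto
    finally show "(\<integral>\<^sup>+b. g a * indicator (N b) a \<partial>count_space B) \<le> of_nat D * g a" .
  qed
  also have "\<dots> = of_nat D * (\<integral>\<^sup>+a. g a \<partial>count_space A)" by (rule nn_integral_cmult) simp
  finally show ?thesis .
qed

lemma nn_integral_unit_intervals: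
  fixes g :: "real \<Rightarrow> ennreal"
  assumes [measurable]: "g \<in> borel_measurable borel"
  shows "(\<integral>\<^sup>+x. g x \<partial>lborel) =
    (\<integral>\<^sup>+n. \<integral>\<^sup>+x. g x * indicator {of_int n..<of_int n + 1} x \<partial>lborel \<partial>count_space (UNIV :: int set))"
proof -
  have "g x = (\<integral>\<^sup>+n. g x * indicator {of_int n..<of_int n + 1} x \<partial>count_space (UNIV :: int set))" for x
  proof -
    have "(\<integral>\<^sup>+n. g x * indicator {of_int n..<of_int n + 1} x \<partial>count_space (UNIV :: int set)) =
      (\<Sum>n\<in>{\<lfloor>x\<rfloor>}. g x * indicator {of_int n..<of_int n + 1} x)"
    proof (rule nn_integral_count_space')
      fix n :: int assume "n \<notin> {\<lfloor>x\<rfloor>}"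
      then have "x \<notin> {of_int n..<of_int n + 1}" using floor_unique[of n x] by auto
      then show "g x * indicator {of_int n..<of_int n + 1} x = 0" by simp
    qed auto
    also have "\<dots> = g x" by (simp add: indicator_def) 
    finally show ?thesis ..
  qed
  then have "(\<integral>\<^sup>+x. g x \<partial>lborel) = (\<integral>\<^sup>+x. \<integral>\<^sup>+n. g x * indicator {of_int n..<of_int n + 1} x \<partial>count_space (UNIV :: int set) \<partial>lborel)"
    by simp
  also have "\<dots> = (\<integral>\<^sup>+n. \<integral>\<^sup>+x. g x * indicator {of_int n..<of_int n + 1} x \<partial>lborel \<partial>count_space (UNIV :: int set))"
    by (rule nn_integral_count_space_nn_integral) auto
  finally show ?thesis .
qed

text \<open>Finiteness of \<open>T\<close> is essential: an infinite \<open>T\<close> satisfies the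
  second premise whatever \<open>U\<close> is.\<close>

lemma ennreal_absorb_half:
  fixes T U :: ennreal
  assumes "T < \<infinity>" "T \<le> U + ennreal (1 / 2) * T"
  shows "T \<le> 2 * U"
proof (cases U)
  case (real u)
  obtain t where t: "T = ennreal t" "0 \<le> t" using assms(1) by (cases T) auto
  have "U + ennreal (1 / 2) * T = ennreal (u + 1 / 2 * t)"
    unfolding real t(1) using real t by (subst ennreal_mult[symmetric]) (auto simp: ennreal_plus)
  then have "t \<le> u + 1 / 2 * t" using real t assms(2) by (metis add_nonneg_nonneg ennreal_le_iff mult_nonneg_nonneg zero_le_divide_1_iff zero_le_numeral)
  then have "ennreal t \<le> ennreal (2 * u)" by (intro ennreal_leI) simp
  then show ?thesis using real t by (simp add: ennreal_mult)
qed simp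

context peb
begin

section \<open>Coefficients against the norm, finite exponent\<close>

lemma int_overlap: "finite {n::int. l \<in> near (of_int n)} \<and> card {n::int. l \<in> near (of_int n)} \<le> m + 4"
proof -
  have "{n::int. l \<in> near (of_int n)} = {l - 2..l + 1 + int m}" by (auto simp: near_def)
  then show ?thesis by simp
qed

lemma near_cong: "x \<in> {of_int n..<of_int n + 1} \<Longrightarrow> near x = near (of_int n)"
  using floor_unique[of n x] by (simp add: near_def)

lemma near_dist: "l \<in> near x \<Longrightarrow> \<bar>x - of_int l\<bar> \<le> real m + 4"
proof -
  assume "l \<in> near x"
  then have "\<lfloor>x\<rfloor> \<le> l + 1 + int m" "l \<le> \<lfloor>x\<rfloor> + 2" by (auto simp: near_def)
  then have "real_of_int \<lfloor>x\<rfloor> \<le> of_int (l + 1 + int m)" "real_of_int l \<le> of_int (\<lfloor>x\<rfloor> + 2)"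
    by (simp_all only: of_int_le_iff)
  then show ?thesis by (simp add: abs_le_iff) linarith
qed

lemma lift_measurable [measurable]: "lift c \<in> borel_measurable borel"
  by (rule borel_measurable_continuous_onI[OF lift_continuous_on])

abbreviation lpow :: "real \<Rightarrow> (int \<Rightarrow> complex) \<Rightarrow> ennreal" where
  "lpow q c \<equiv> (\<integral>\<^sup>+l. ennreal (cmod (c l) powr q) \<partial>count_space UNIV)"

lemma powr_near_bound:
  assumes q: "0 < q" and M: "0 \<le> M" and u: "0 \<le> u" "u \<le> M * (\<Sum>l\<in>near x. cmod (c l))"
  shows "ennreal (u powr q) \<le> ennreal ((M * real (m + 4)) powr q) * (\<Sum>l\<in>near x. ennreal (cmod (c l) powr q))"
proof -
  have "u powr q \<le> (M * (\<Sum>l\<in>near x. cmod (c l))) powr q" using u q by (intro powr_mono2) auto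
  also have "\<dots> = M powr q * (\<Sum>l\<in>near x. cmod (c l)) powr q" by (rule powr_mult)
  also have "\<dots> \<le> M powr q * (real (m + 4) powr q * (\<Sum>l\<in>near x. cmod (c l) powr q))"
    using sum_powr_le[of "near x" "\<lambda>l. cmod (c l)" q] q near_window(3)[of x] unfolding card_near
    by (intro mult_left_mono) auto
  also have "\<dots> = (M * real (m + 4)) powr q * (\<Sum>l\<in>near x. cmod (c l) powr q)"
    by (simp add: powr_mult)
  finally have "ennreal (u powr q) \<le> ennreal ((M * real (m + 4)) powr q * (\<Sum>l\<in>near x. cmod (c l) powr q))"
    by (rule ennreal_leI)
  also have "\<dots> = ennreal ((M * real (m + 4)) powr q) * (\<Sum>l\<in>near x. ennreal (cmod (c l) powr q))"
    by (subst ennreal_mult) (auto intro: sum_nonneg)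
  finally show ?thesis .
qed

text \<open>On \<open>[n, n + 1)\<close> the index set \<open>near x\<close> does not change, so the
  pointwise bound is constant there and survives integration; each coefficient is seen from m + 4
  such intervals.\<close>

lemma lift_Lp_upper:
  assumes q: "0 < q"
  shows "\<exists>C>0. \<forall>c. (\<integral>\<^sup>+x. ennreal (cmod (lift c x) powr q) \<partial>lborel) \<le> ennreal C * lpow q c"
proof -
  obtain M where M: "M > 0" "\<And>c x. cmod (lift c x) \<le> M * (\<Sum>l\<in>near x. cmod (c l))"
    using lift_bound by blast
  define K where "K = (M * real (m + 4)) powr q"
  have K: "K > 0" using M by (simp add: K_def)
  have "(\<integral>\<^sup>+x. ennreal (cmod (lift c x) powr q) \<partial>lborel) \<le> ennreal (K * real (m + 4)) * lpow q c" for c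
  proof -
    have "(\<integral>\<^sup>+x. ennreal (cmod (lift c x) powr q) \<partial>lborel) =
      (\<integral>\<^sup>+n. \<integral>\<^sup>+x. ennreal (cmod (lift c x) powr q) * indicator {of_int n..<of_int n + 1} x \<partial>lborel \<partial>count_space (UNIV :: int set))"
      by (rule nn_integral_unit_intervals) measurable
    also have "\<dots> \<le> (\<integral>\<^sup>+n. ennreal K * (\<Sum>l\<in>near (of_int n). ennreal (cmod (c l) powr q)) \<partial>count_space (UNIV :: int set))"
    proof (rule nn_integral_mono)
      fix n :: int
      let ?B = "ennreal K * (\<Sum>l\<in>near (of_int n). ennreal (cmod (c l) powr q))"
      have "(\<integral>\<^sup>+x. ennreal (cmod (lift c x) powr q) * indicator {of_int n..<of_int n + 1} x \<partial>lborel) \<le>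
        (\<integral>\<^sup>+x. ?B * indicator {of_int n..<of_int n + 1 :: real} x \<partial>lborel)"
      proof (rule nn_integral_mono)
        fix x :: real
        show "ennreal (cmod (lift c x) powr q) * indicator {of_int n..<of_int n + 1} x \<le> ?B * indicator {of_int n..<of_int n + 1} x"
        proof (cases "x \<in> {of_int n..<of_int n + 1}")
          case True
          have "ennreal (cmod (lift c x) powr q) \<le> ennreal K * (\<Sum>l\<in>near x. ennreal (cmod (c l) powr q))"
            unfolding K_def by (rule powr_near_bound[OF q _ _ M(2)]) (use M in auto)
          then show ?thesis using near_cong[OF True] True by simp
        qed simp
      qed
      also have "\<dots> = ?B" by (simp add: nn_integral_cmult_indicator)
      finally show "(\<integral>\<^sup>+x. ennreal (cmod (lift c x) powr q) * indicator {of_int n..<of_int n + 1} x \<partial>lborel) \<le> ?B" .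
    qed
    also have "\<dots> = ennreal K * (\<integral>\<^sup>+n. (\<Sum>l\<in>near (of_int n). ennreal (cmod (c l) powr q)) \<partial>count_space (UNIV :: int set))"
      by (rule nn_integral_cmult) simp
    also have "\<dots> \<le> ennreal K * (of_nat (m + 4) * lpow q c)"
      by (intro mult_left_mono nn_integral_sum_bounded_overlap) (use int_overlap near_window(3) in auto)
    also have "\<dots> = ennreal (K * real (m + 4)) * lpow q c"
      using K by (simp add: ennreal_mult ennreal_of_nat_eq_real_of_nat mult.assoc del: of_nat_add)
    finally show ?thesis .
  qed
  moreover have "K * real (m + 4) > 0" using K by simp
  ultimately show ?thesis by blast
qed

lemma lift_Lp_lower:
  assumes q: "0 < q"
  shows "\<exists>C>0. \<forall>c. lpow q c \<le> ennreal C * (\<integral>\<^sup>+x. ennreal (cmod (lift c x) powr q) \<partial>lborel)"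
proof -
  obtain C where C: "C > 0" "\<And>c n. ennreal (cmod (c n) powr q) \<le>
    ennreal C * (\<integral>\<^sup>+x. ennreal (cmod (lift c x) powr q) * indicator {of_int n..<of_int n + 1} x \<partial>lborel)"
    using lift_lower[OF q] by blast
  have "lpow q c \<le> ennreal C * (\<integral>\<^sup>+x. ennreal (cmod (lift c x) powr q) \<partial>lborel)" for c
  proof -
    have "lpow q c \<le> (\<integral>\<^sup>+n. ennreal C * (\<integral>\<^sup>+x. ennreal (cmod (lift c x) powr q) * indicator {of_int n..<of_int n + 1} x \<partial>lborel) \<partial>count_space (UNIV :: int set))"
      by (intro nn_integral_mono C(2))
    also have "\<dots> = ennreal C * (\<integral>\<^sup>+n. \<integral>\<^sup>+x. ennreal (cmod (lift c x) powr q) * indicator {of_int n..<of_int n + 1} x \<partial>lborel \<partial>count_space (UNIV :: int set))"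
      by (rule nn_integral_cmult) simp
    also have "\<dots> = ennreal C * (\<integral>\<^sup>+x. ennreal (cmod (lift c x) powr q) \<partial>lborel)"
      by (subst nn_integral_unit_intervals[symmetric]) auto
    finally show ?thesis .
  qed
  with C(1) show ?thesis by blast
qed

end

locale peb_sampling = peb +
  fixes x :: "int \<Rightarrow> real" and \<mu> :: "real \<Rightarrow> nat" and \<rho> e \<delta> :: real and X :: "real set"
  assumes \<rho>: "0 < \<rho>" "\<rho> < 1" and e: "0 < e" and \<delta>: "0 < \<delta>"
    and sep: "\<And>j. x j + e \<le> x (j + 1)"
    and gap: "\<And>j. x (j + 1) - x j \<le> \<rho> * (1 + real (\<mu> (x (j + 1))))"
    and \<mu>: "\<And>j. \<mu> (x j) \<le> m - 1"
    and aw: "\<And>j n. \<mu> (x j) = m - 1 \<Longrightarrow> \<bar>x j - of_int n\<bar> \<ge> \<delta>"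
    and X: "X = range x"
    and X_sep: "\<And>t u. t \<in> X \<Longrightarrow> u \<in> X \<Longrightarrow> \<bar>t - u\<bar> < e \<Longrightarrow> t = u"
begin

section \<open>Coefficients against the samples, finite exponent\<close>

lemma countable_X: "countable X"
  by (simp add: X)

lemma \<mu>_lt: "t \<in> X \<Longrightarrow> s \<le> \<mu> t \<Longrightarrow> s < m"
proof -
  assume "t \<in> X" "s \<le> \<mu> t"
  then obtain j where "s \<le> \<mu> (x j)" unfolding X by blast
  then show "s < m" using \<mu>[of j] m2 by linarith
qed

lemma away_X: "t \<in> X \<Longrightarrow> s \<le> \<mu> t \<Longrightarrow> away \<delta> s t"
  unfolding away_def
proof (intro conjI impI allI)
  fix n assume t: "t \<in> X" and s: "s \<le> \<mu> t" "s = m - 1"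
  then obtain j where j: "t = x j" by (auto simp: X)
  then have "\<mu> (x j) = m - 1" using s \<mu>[of j] by simp
  then show "\<delta> \<le> \<bar>t - of_int n\<bar>" unfolding j by (rule aw)
qed (rule \<mu>_lt)

lemma sample_bound:
  "\<exists>M>0. \<forall>c t s. t \<in> X \<longrightarrow> s \<le> \<mu> t \<longrightarrow> cmod (spline_deriv m s (lift c) t) \<le> M * (\<Sum>l\<in>near t. cmod (c l))"
  using spline_deriv_lift_bound[OF \<delta>] away_X by blast

lemma X_card: "\<exists>D. \<forall>u. finite {t \<in> X. \<bar>t - u\<bar> \<le> b} \<and> card {t \<in> X. \<bar>t - u\<bar> \<le> b} \<le> D"
  by (rule separated_card[OF e]) (rule X_sep)

lemma X_overlap: "\<exists>D. \<forall>l. finite {t \<in> X. l \<in> near t} \<and> card {t \<in> X. l \<in> near t} \<le> D"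
proof -
  obtain D where D: "\<And>u. finite {t \<in> X. \<bar>t - u\<bar> \<le> real m + 4}" "\<And>u. card {t \<in> X. \<bar>t - u\<bar> \<le> real m + 4} \<le> D"
    using X_card[of "real m + 4"] by blast
  have sub: "{t \<in> X. l \<in> near t} \<subseteq> {t \<in> X. \<bar>t - of_int l\<bar> \<le> real m + 4}" for l
    using near_dist by blast
  show ?thesis
    using finite_subset[OF sub D(1)] order_trans[OF card_mono[OF D(1) sub] D(2)] by blast
qed

definition hsum :: "real \<Rightarrow> (int \<Rightarrow> complex) \<Rightarrow> real \<Rightarrow> ennreal" where
  "hsum q c t = (\<Sum>s=0..\<mu> t. ennreal (cmod (spline_deriv m s (lift c) t) powr q))"

text \<open>Separation bounds the number of samples that see a given coefficient, and each sample
  has at most \<open>m\<close> derivatives. Writing \<open>D + 1\<close> keeps the constant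
  positive.\<close>

lemma sample_lp_upper:
  assumes q: "0 < q"
  shows "\<exists>C>0. \<forall>c. (\<integral>\<^sup>+t. hsum q c t \<partial>count_space X) \<le> ennreal C * lpow q c"
proof -
  obtain M where M: "M > 0"
    "\<And>c t s. t \<in> X \<Longrightarrow> s \<le> \<mu> t \<Longrightarrow> cmod (spline_deriv m s (lift c) t) \<le> M * (\<Sum>l\<in>near t. cmod (c l))"
    using sample_bound by blast
  obtain D where D: "\<And>l. finite {t \<in> X. l \<in> near t} \<and> card {t \<in> X. l \<in> near t} \<le> D"
    using X_overlap by blast
  define K where "K = (M * real (m + 4)) powr q"
  have K: "K > 0" using M by (simp add: K_def)
  have "(\<integral>\<^sup>+t. hsum q c t \<partial>count_space X) \<le> ennreal (real m * K * real (D + 1)) * lpow q c" for c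
  proof -
    have "(\<integral>\<^sup>+t. hsum q c t \<partial>count_space X) \<le>
      (\<integral>\<^sup>+t. ennreal (real m * K) * (\<Sum>l\<in>near t. ennreal (cmod (c l) powr q)) \<partial>count_space X)"
    proof (rule nn_integral_mono)
      fix t assume "t \<in> space (count_space X)"
      then have t: "t \<in> X" by simp
      have "hsum q c t \<le> (\<Sum>s=0..\<mu> t. ennreal K * (\<Sum>l\<in>near t. ennreal (cmod (c l) powr q)))"
        unfolding hsum_def K_def using M t q by (intro sum_mono powr_near_bound) auto
      also have "\<dots> = of_nat (Suc (\<mu> t)) * (ennreal K * (\<Sum>l\<in>near t. ennreal (cmod (c l) powr q)))"
        by simp
      also have "\<dots> \<le> of_nat m * (ennreal K * (\<Sum>l\<in>near t. ennreal (cmod (c l) powr q)))"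
        using \<mu>_lt[OF t order_refl] by (intro mult_right_mono of_nat_mono) auto
      also have "\<dots> = ennreal (real m * K) * (\<Sum>l\<in>near t. ennreal (cmod (c l) powr q))"
        using K by (simp add: ennreal_mult ennreal_of_nat_eq_real_of_nat mult.assoc)
      finally show "hsum q c t \<le> ennreal (real m * K) * (\<Sum>l\<in>near t. ennreal (cmod (c l) powr q))" .
    qed
    also have "\<dots> = ennreal (real m * K) * (\<integral>\<^sup>+t. (\<Sum>l\<in>near t. ennreal (cmod (c l) powr q)) \<partial>count_space X)"
      by (rule nn_integral_cmult) simp
    also have "\<dots> \<le> ennreal (real m * K) * (of_nat (D + 1) * lpow q c)"
      by (intro mult_left_mono nn_integral_sum_bounded_overlap)
        (use D near_window(3) countable_X in \<open>auto simp: le_Suc_eq\<close>)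
    also have "\<dots> = ennreal (real m * K * real (D + 1)) * lpow q c"
      using K by (simp add: ennreal_mult ennreal_of_nat_eq_real_of_nat mult.assoc del: of_nat_add)
    finally show ?thesis .
  qed
  moreover have "real m * K * real (D + 1) > 0" using K m2 by simp
  ultimately show ?thesis by blast
qed

text \<open>The contribution of \<open>\<eta>\<close> in the window estimate is absorbed into the left-hand side.\<close>

lemma sample_lp_lower:
  assumes q: "0 < q"
  shows "\<exists>C>0. \<forall>c. lpow q c < \<infinity> \<longrightarrow> lpow q c \<le> ennreal C * (\<integral>\<^sup>+t. hsum q c t \<partial>count_space X)"
proof -
  obtain b W J where W: "0 \<le> W" and est: "\<And>\<eta>. \<eta> > 0 \<Longrightarrow> \<exists>C>0. \<forall>c K. \<exists>Y. finite Y \<and> card Y \<le> J \<and> Y \<subseteq> range x \<and>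
    (\<forall>t\<in>Y. \<bar>t - of_int K\<bar> \<le> b) \<and>
    cmod (c K) \<le> C * (\<Sum>t\<in>Y. \<Sum>s=0..\<mu> t. cmod (spline_deriv m s (lift c) t)) +
      \<eta> * (\<Sum>l\<in>{K - W..K + W}. cmod (c l))"
    using window_estimate[where x = x and \<mu> = \<mu>, OF \<rho> e \<delta> sep gap \<mu> aw] by blast
  define k where "k = nat (2 * W + 1)"
  have k: "real k > 0" "card {K - W..K + W} = k" for K using W by (auto simp: k_def)
  \<comment> \<open>Summation over all \<open>K\<close> counts each coefficient \<open>k\<close>
    times; this choice gives the factor \<open>1 / (2 * k)\<close> at each \<open>K\<close>, hence
    1/2 in total.\<close>
  define \<eta> where "\<eta> = (1 / (2 * real k)) powr (1 / q) / (2 * real k)"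
  have \<eta>: "\<eta> > 0" "2 powr q * (\<eta> powr q * real k powr q) = 1 / (2 * real k)"
  proof -
    show "\<eta> > 0" using k by (simp add: \<eta>_def)
    have "2 powr q * (\<eta> powr q * real k powr q) = (2 * (\<eta> * real k)) powr q" by (simp only: powr_mult)
    also have "2 * (\<eta> * real k) = (1 / (2 * real k)) powr (1 / q)" using k by (simp add: \<eta>_def)
    also have "\<dots> powr q = 1 / (2 * real k)" using q k by (simp add: powr_powr)
    finally show "2 powr q * (\<eta> powr q * real k powr q) = 1 / (2 * real k)" .
  qed
  obtain C where C: "C > 0" and est: "\<And>c K. \<exists>Y. finite Y \<and> card Y \<le> J \<and> Y \<subseteq> range x \<and>
    (\<forall>t\<in>Y. \<bar>t - of_int K\<bar> \<le> b) \<and>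
    cmod (c K) \<le> C * (\<Sum>t\<in>Y. \<Sum>s=0..\<mu> t. cmod (spline_deriv m s (lift c) t)) +
      \<eta> * (\<Sum>l\<in>{K - W..K + W}. cmod (c l))"
    using est[OF \<eta>(1)] by blast
  \<comment> \<open>\<open>2 powr q\<close> splits the two terms of the window estimate; the other
    factors come from the sums over the points and over the derivatives. \<open>J + 1\<close> keeps
    \<open>Q\<close> positive also for \<open>J = 0\<close>.\<close>
  define Q where "Q = 2 powr q * (C powr q * (real (J + 1) powr q * real m powr q))"
  have Q: "Q > 0" using C m2 by (simp add: Q_def)
  obtain D1 where D1: "\<And>u. finite {t \<in> X. \<bar>t - u\<bar> \<le> b}" "\<And>u. card {t \<in> X. \<bar>t - u\<bar> \<le> b} \<le> D1"
    using X_card[of b] by blast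
  have "\<exists>D. \<forall>u. finite {K \<in> (UNIV :: int set). \<bar>of_int K - u\<bar> \<le> b} \<and> card {K \<in> (UNIV :: int set). \<bar>of_int K - u\<bar> \<le> b} \<le> D"
    by (rule separated_card[OF zero_less_one]) linarith
  then obtain D where D: "\<And>u. finite {K \<in> (UNIV :: int set). \<bar>of_int K - u\<bar> \<le> b}"
    "\<And>u. card {K \<in> (UNIV :: int set). \<bar>of_int K - u\<bar> \<le> b} \<le> D" by blast
  have point: "ennreal (cmod (c K) powr q) \<le>
      ennreal Q * (\<Sum>t\<in>{t \<in> X. \<bar>t - of_int K\<bar> \<le> b}. hsum q c t) +
      ennreal (1 / (2 * real k)) * (\<Sum>l\<in>{K - W..K + W}. ennreal (cmod (c l) powr q))" for c K
  proof -
    let ?d = "\<lambda>s t. cmod (spline_deriv m s (lift c) t)"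
    obtain Y where Y: "finite Y" "card Y \<le> J" "Y \<subseteq> X" "\<forall>t\<in>Y. \<bar>t - of_int K\<bar> \<le> b"
      "cmod (c K) \<le> C * (\<Sum>t\<in>Y. \<Sum>s=0..\<mu> t. ?d s t) + \<eta> * (\<Sum>l\<in>{K - W..K + W}. cmod (c l))"
      using est[of K c] unfolding X by blast
    define S where "S = (\<Sum>t\<in>Y. \<Sum>s=0..\<mu> t. ?d s t)"
    define N where "N = (\<Sum>l\<in>{K - W..K + W}. cmod (c l))"
    have SN: "0 \<le> S" "0 \<le> N" unfolding S_def N_def by (intro sum_nonneg; simp)+
    have "S powr q \<le> real (card Y) powr q * (\<Sum>t\<in>Y. (\<Sum>s=0..\<mu> t. ?d s t) powr q)"
      unfolding S_def using Y q by (intro sum_powr_le) (auto intro: sum_nonneg)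
    also have "\<dots> \<le> real (J + 1) powr q * (\<Sum>t\<in>Y. real m powr q * (\<Sum>s=0..\<mu> t. ?d s t powr q))"
    proof (intro mult_mono sum_mono)
      fix t assume "t \<in> Y"
      then have "\<mu> t < m" using \<mu>_lt Y by blast
      have "(\<Sum>s=0..\<mu> t. ?d s t) powr q \<le> real (card {0..\<mu> t}) powr q * (\<Sum>s=0..\<mu> t. ?d s t powr q)"
        using q by (intro sum_powr_le) auto
      also have "\<dots> \<le> real m powr q * (\<Sum>s=0..\<mu> t. ?d s t powr q)"
        using q \<open>\<mu> t < m\<close> by (intro mult_right_mono powr_mono2 sum_nonneg) auto
      finally show "(\<Sum>s=0..\<mu> t. ?d s t) powr q \<le> real m powr q * (\<Sum>s=0..\<mu> t. ?d s t powr q)" .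
    next
      show "real (card Y) powr q \<le> real (J + 1) powr q" using Y q by (intro powr_mono2) auto
    qed (auto intro!: sum_nonneg)
    also have "\<dots> = real (J + 1) powr q * real m powr q * (\<Sum>t\<in>Y. \<Sum>s=0..\<mu> t. ?d s t powr q)"
      by (simp add: sum_distrib_left mult.assoc)
    finally have S: "S powr q \<le> real (J + 1) powr q * real m powr q * (\<Sum>t\<in>Y. \<Sum>s=0..\<mu> t. ?d s t powr q)" .
    have N: "N powr q \<le> real k powr q * (\<Sum>l\<in>{K - W..K + W}. cmod (c l) powr q)"
      unfolding N_def using sum_powr_le[of "{K - W..K + W}" "\<lambda>l. cmod (c l)" q] q k(2)[of K] by auto
    have "cmod (c K) powr q \<le> (C * S + \<eta> * N) powr q"
      using Y(5) q unfolding S_def N_def by (intro powr_mono2) auto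
    also have "\<dots> \<le> 2 powr q * ((C * S) powr q + (\<eta> * N) powr q)"
      using sum_powr_le[of "UNIV :: bool set" "\<lambda>b. if b then C * S else \<eta> * N" q] q C \<eta>(1) SN
      by (simp add: UNIV_bool add.commute)
    also have "\<dots> = 2 powr q * (C powr q * S powr q) + 2 powr q * (\<eta> powr q * N powr q)"
      by (simp add: powr_mult distrib_left)
    also have "\<dots> \<le> 2 powr q * (C powr q * (real (J + 1) powr q * real m powr q * (\<Sum>t\<in>Y. \<Sum>s=0..\<mu> t. ?d s t powr q))) +
        2 powr q * (\<eta> powr q * (real k powr q * (\<Sum>l\<in>{K - W..K + W}. cmod (c l) powr q)))"
      using S N by (intro add_mono mult_left_mono) auto
    also have "\<dots> = Q * (\<Sum>t\<in>Y. \<Sum>s=0..\<mu> t. ?d s t powr q) +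
        2 powr q * (\<eta> powr q * real k powr q) * (\<Sum>l\<in>{K - W..K + W}. cmod (c l) powr q)"
      by (simp add: Q_def mult.assoc)
    also have "\<dots> = Q * (\<Sum>t\<in>Y. \<Sum>s=0..\<mu> t. ?d s t powr q) +
        1 / (2 * real k) * (\<Sum>l\<in>{K - W..K + W}. cmod (c l) powr q)"
      unfolding \<eta>(2) ..
    finally have "ennreal (cmod (c K) powr q) \<le> ennreal (Q * (\<Sum>t\<in>Y. \<Sum>s=0..\<mu> t. ?d s t powr q) +
        1 / (2 * real k) * (\<Sum>l\<in>{K - W..K + W}. cmod (c l) powr q))"
      by (rule ennreal_leI)
    also have "\<dots> = ennreal (Q * (\<Sum>t\<in>Y. \<Sum>s=0..\<mu> t. ?d s t powr q)) +
        ennreal (1 / (2 * real k) * (\<Sum>l\<in>{K - W..K + W}. cmod (c l) powr q))"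
      using Q by (intro ennreal_plus mult_nonneg_nonneg sum_nonneg) auto
    also have "ennreal (1 / (2 * real k) * (\<Sum>l\<in>{K - W..K + W}. cmod (c l) powr q)) =
        ennreal (1 / (2 * real k)) * (\<Sum>l\<in>{K - W..K + W}. ennreal (cmod (c l) powr q))"
      by (subst ennreal_mult) (auto intro: sum_nonneg)
    also have "ennreal (Q * (\<Sum>t\<in>Y. \<Sum>s=0..\<mu> t. ?d s t powr q)) = ennreal Q * (\<Sum>t\<in>Y. hsum q c t)"
    proof -
      have "hsum q c t = ennreal (\<Sum>s=0..\<mu> t. ?d s t powr q)" for t
        unfolding hsum_def by (rule sum_ennreal) simp
      then have "(\<Sum>t\<in>Y. hsum q c t) = (\<Sum>t\<in>Y. ennreal (\<Sum>s=0..\<mu> t. ?d s t powr q))" by simp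
      also have "\<dots> = ennreal (\<Sum>t\<in>Y. \<Sum>s=0..\<mu> t. ?d s t powr q)"
        by (rule sum_ennreal) (simp add: sum_nonneg)
      finally show ?thesis using Q by (simp add: ennreal_mult sum_nonneg)
    qed
    \<comment> \<open>\<open>Y\<close> depends on \<open>c\<close>; all samples within
      \<open>b\<close> of \<open>K\<close> form an index set that does not, and whose overlap can be
      counted.\<close>
    also have "(\<Sum>t\<in>Y. hsum q c t) \<le> (\<Sum>t\<in>{t \<in> X. \<bar>t - of_int K\<bar> \<le> b}. hsum q c t)"
      using Y D1(1) by (intro sum_mono2) auto
    finally show ?thesis by (simp add: add_right_mono mult_left_mono)
  qed
  have "lpow q c \<le> ennreal (2 * (Q * real (D + 1))) * (\<integral>\<^sup>+t. hsum q c t \<partial>count_space X)" if fin: "lpow q c < \<infinity>" for c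
  proof -
    have "lpow q c \<le> (\<integral>\<^sup>+K. ennreal Q * (\<Sum>t\<in>{t \<in> X. \<bar>t - of_int K\<bar> \<le> b}. hsum q c t) +
      ennreal (1 / (2 * real k)) * (\<Sum>l\<in>{K - W..K + W}. ennreal (cmod (c l) powr q)) \<partial>count_space (UNIV :: int set))"
      by (intro nn_integral_mono point)
    also have "\<dots> = ennreal Q * (\<integral>\<^sup>+K. (\<Sum>t\<in>{t \<in> X. \<bar>t - of_int K\<bar> \<le> b}. hsum q c t) \<partial>count_space (UNIV :: int set)) +
      ennreal (1 / (2 * real k)) * (\<integral>\<^sup>+K. (\<Sum>l\<in>{K - W..K + W}. ennreal (cmod (c l) powr q)) \<partial>count_space (UNIV :: int set))"
      by (subst nn_integral_add) (auto simp: nn_integral_cmult)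
    also have "\<dots> \<le> ennreal Q * (of_nat (D + 1) * (\<integral>\<^sup>+t. hsum q c t \<partial>count_space X)) +
      ennreal (1 / (2 * real k)) * (of_nat k * lpow q c)"
    proof (intro add_mono mult_left_mono nn_integral_sum_bounded_overlap)
      fix t assume t: "t \<in> X"
      have e: "{K \<in> UNIV. t \<in> {t \<in> X. \<bar>t - of_int K\<bar> \<le> b}} = {K \<in> UNIV. \<bar>of_int K - t\<bar> \<le> b}"
        using t by (auto simp: abs_minus_commute)
      show "finite {K \<in> UNIV. t \<in> {t \<in> X. \<bar>t - of_int K\<bar> \<le> b}} \<and>
         card {K \<in> UNIV. t \<in> {t \<in> X. \<bar>t - of_int K\<bar> \<le> b}} \<le> D + 1"
        unfolding e using D(1)[of t] le_SucI[OF D(2)[of t]] unfolding Suc_eq_plus1 by blast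
    next
      fix l :: int
      have e: "{K \<in> UNIV. l \<in> {K - W..K + W}} = {l - W..l + W}" by auto
      show "finite {K \<in> UNIV. l \<in> {K - W..K + W}} \<and> card {K \<in> UNIV. l \<in> {K - W..K + W}} \<le> k"
        unfolding e k by simp
    qed (use D1 countable_X in auto)
    also have "ennreal (1 / (2 * real k)) * (of_nat k * lpow q c) = ennreal (1 / 2) * lpow q c"
    proof -
      have "ennreal (1 / (2 * real k)) * of_nat k = ennreal (1 / (2 * real k) * real k)"
        unfolding ennreal_of_nat_eq_real_of_nat by (rule ennreal_mult[symmetric]) auto
      also have "1 / (2 * real k) * real k = 1 / 2" using k by simp
      finally show ?thesis by (simp only: mult.assoc[symmetric])
    qed
    finally have "lpow q c \<le> 2 * (ennreal Q * (of_nat (D + 1) * (\<integral>\<^sup>+t. hsum q c t \<partial>count_space X)))"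
      using fin by (intro ennreal_absorb_half)
    also have "\<dots> = ennreal (2 * (Q * real (D + 1))) * (\<integral>\<^sup>+t. hsum q c t \<partial>count_space X)"
      using Q by (simp add: ennreal_mult ennreal_of_nat_eq_real_of_nat mult.assoc del: of_nat_add)
    finally show ?thesis .
  qed
  moreover have "2 * (Q * real (D + 1)) > 0" using Q by simp
  ultimately show ?thesis by blast
qed

end

section \<open>The supremum norm and the theorem\<close>

lemma sum_le_card_SUP:
  fixes g :: "'a \<Rightarrow> ennreal"
  shows "(\<Sum>l\<in>N. g l) \<le> of_nat (card N) * (SUP l. g l)"
  using sum_bounded_above[of N g "SUP l. g l"] by (simp add: SUP_upper)

context peb_sampling
begin

abbreviation csup :: "(int \<Rightarrow> complex) \<Rightarrow> ennreal" where
  "csup c \<equiv> (SUP l. ennreal (cmod (c l)))"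

abbreviation ssup :: "(int \<Rightarrow> complex) \<Rightarrow> ennreal" where
  "ssup c \<equiv> (SUP t\<in>X. SUP s\<in>{0..\<mu> t}. ennreal (cmod (spline_deriv m s (lift c) t)))"

lemma near_csup_bound:
  assumes "0 \<le> M" "u \<le> M * (\<Sum>l\<in>near y. cmod (c l))"
  shows "ennreal u \<le> ennreal (M * real (m + 4)) * csup c"
proof -
  have "ennreal u \<le> ennreal M * ennreal (\<Sum>l\<in>near y. cmod (c l))"
    using assms by (subst ennreal_mult[symmetric]) (auto intro: sum_nonneg ennreal_leI)
  also have "ennreal (\<Sum>l\<in>near y. cmod (c l)) = (\<Sum>l\<in>near y. ennreal (cmod (c l)))"
    by (rule sum_ennreal[symmetric]) simp
  also have "\<dots> \<le> of_nat (m + 4) * csup c"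
    using sum_le_card_SUP[of "\<lambda>l. ennreal (cmod (c l))" "near y"] unfolding card_near .
  also have "ennreal M * (of_nat (m + 4) * csup c) = ennreal (M * real (m + 4)) * csup c"
    using assms(1) by (simp add: ennreal_mult ennreal_of_nat_eq_real_of_nat mult.assoc del: of_nat_add)
  finally show ?thesis by (simp add: mult_left_mono)
qed

lemma lift_esssup_upper: "\<exists>C>0. \<forall>c. esssup lborel (\<lambda>x. ennreal (cmod (lift c x))) \<le> ennreal C * csup c"
proof -
  obtain M where M: "M > 0" "\<And>c x. cmod (lift c x) \<le> M * (\<Sum>l\<in>near x. cmod (c l))"
    using lift_bound by blast
  have "esssup lborel (\<lambda>x. ennreal (cmod (lift c x))) \<le> ennreal (M * real (m + 4)) * csup c" for c
  proof (rule esssup_I)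
    show "(\<lambda>x. ennreal (cmod (lift c x))) \<in> borel_measurable lborel" by measurable
    show "AE x in lborel. ennreal (cmod (lift c x)) \<le> ennreal (M * real (m + 4)) * csup c"
      by (intro always_eventually allI near_csup_bound[OF _ M(2)]) (use M in simp)
  qed
  moreover have "M * real (m + 4) > 0" using M by simp
  ultimately show ?thesis by blast
qed

text \<open>The local lower bound with exponent 1: the integral over a unit interval is at most the
  essential supremum.\<close>

lemma lift_esssup_lower: "\<exists>C>0. \<forall>c. csup c \<le> ennreal C * esssup lborel (\<lambda>x. ennreal (cmod (lift c x)))"
proof -
  obtain C where C: "C > 0" "\<And>c n. ennreal (cmod (c n) powr 1) \<le>
    ennreal C * (\<integral>\<^sup>+x. ennreal (cmod (lift c x) powr 1) * indicator {of_int n..<of_int n + 1} x \<partial>lborel)"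
    using lift_lower[of 1] by force
  have "csup c \<le> ennreal C * esssup lborel (\<lambda>x. ennreal (cmod (lift c x)))" for c
  proof (rule SUP_least)
    fix n :: int
    let ?E = "esssup lborel (\<lambda>x. ennreal (cmod (lift c x)))"
    have "AE x in lborel. ennreal (cmod (lift c x) powr 1) * indicator {of_int n..<of_int n + 1} x \<le>
        ?E * indicator {of_int n..<of_int n + 1 :: real} x"
      using esssup_AE[of "\<lambda>x. ennreal (cmod (lift c x))" lborel]
      by eventually_elim (simp add: mult_right_mono)
    then have "(\<integral>\<^sup>+x. ennreal (cmod (lift c x) powr 1) * indicator {of_int n..<of_int n + 1} x \<partial>lborel) \<le>
        (\<integral>\<^sup>+x. ?E * indicator {of_int n..<of_int n + 1 :: real} x \<partial>lborel)"
      by (rule nn_integral_mono_AE)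
    also have "\<dots> = ?E" by (simp add: nn_integral_cmult_indicator)
    finally have "ennreal C * (\<integral>\<^sup>+x. ennreal (cmod (lift c x) powr 1) * indicator {of_int n..<of_int n + 1} x \<partial>lborel) \<le> ennreal C * ?E"
      by (rule mult_left_mono) simp
    then show "ennreal (cmod (c n)) \<le> ennreal C * ?E" using C(2)[of c n] by simp
  qed
  with C(1) show ?thesis by blast
qed

lemma sample_sup_upper: "\<exists>C>0. \<forall>c. ssup c \<le> ennreal C * csup c"
proof -
  obtain M where M: "M > 0"
    "\<And>c t s. t \<in> X \<Longrightarrow> s \<le> \<mu> t \<Longrightarrow> cmod (spline_deriv m s (lift c) t) \<le> M * (\<Sum>l\<in>near t. cmod (c l))"
    using sample_bound by blast
  have "ssup c \<le> ennreal (M * real (m + 4)) * csup c" for c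
    by (intro SUP_least near_csup_bound[OF _ M(2)]) (use M in auto)
  moreover have "M * real (m + 4) > 0" using M by simp
  ultimately show ?thesis by blast
qed

lemma sample_sup_lower: "\<exists>C>0. \<forall>c. csup c < \<infinity> \<longrightarrow> csup c \<le> ennreal C * ssup c"
proof -
  obtain b W J where W: "0 \<le> W" and est: "\<And>\<eta>. \<eta> > 0 \<Longrightarrow> \<exists>C>0. \<forall>c K. \<exists>Y. finite Y \<and> card Y \<le> J \<and> Y \<subseteq> range x \<and>
    (\<forall>t\<in>Y. \<bar>t - of_int K\<bar> \<le> b) \<and>
    cmod (c K) \<le> C * (\<Sum>t\<in>Y. \<Sum>s=0..\<mu> t. cmod (spline_deriv m s (lift c) t)) +
      \<eta> * (\<Sum>l\<in>{K - W..K + W}. cmod (c l))"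
    using window_estimate[where x = x and \<mu> = \<mu>, OF \<rho> e \<delta> sep gap \<mu> aw] by blast
  define k where "k = nat (2 * W + 1)"
  have k: "real k > 0" "card {K - W..K + W} = k" for K using W by (auto simp: k_def)
  \<comment> \<open>The window holds \<open>k\<close> coefficients, so the second term is at most
    \<open>\<eta> * k = 1 / 2\<close> times the supremum.\<close>
  define \<eta> where "\<eta> = 1 / (2 * real k)"
  have \<eta>: "\<eta> > 0" using k by (simp add: \<eta>_def)
  obtain C where C: "C > 0" and est: "\<And>c K. \<exists>Y. finite Y \<and> card Y \<le> J \<and> Y \<subseteq> range x \<and>
    (\<forall>t\<in>Y. \<bar>t - of_int K\<bar> \<le> b) \<and>
    cmod (c K) \<le> C * (\<Sum>t\<in>Y. \<Sum>s=0..\<mu> t. cmod (spline_deriv m s (lift c) t)) +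
      \<eta> * (\<Sum>l\<in>{K - W..K + W}. cmod (c l))"
    using est[OF \<eta>] by blast
  have "csup c \<le> ennreal (2 * (C * real ((J + 1) * m))) * ssup c" if fin: "csup c < \<infinity>" for c
  proof -
    let ?d = "\<lambda>s t. cmod (spline_deriv m s (lift c) t)"
    have "csup c \<le> ennreal C * (of_nat ((J + 1) * m) * ssup c) + ennreal (1 / 2) * csup c"
    proof (rule SUP_least)
      fix K :: int
      obtain Y where Y: "finite Y" "card Y \<le> J" "Y \<subseteq> X"
        "cmod (c K) \<le> C * (\<Sum>t\<in>Y. \<Sum>s=0..\<mu> t. ?d s t) + \<eta> * (\<Sum>l\<in>{K - W..K + W}. cmod (c l))"
        using est[of K c] unfolding X by blast
      have "ennreal (cmod (c K)) \<le> ennreal (C * (\<Sum>t\<in>Y. \<Sum>s=0..\<mu> t. ?d s t) + \<eta> * (\<Sum>l\<in>{K - W..K + W}. cmod (c l)))"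
        using Y(4) by (rule ennreal_leI)
      also have "\<dots> = ennreal C * ennreal (\<Sum>t\<in>Y. \<Sum>s=0..\<mu> t. ?d s t) + ennreal \<eta> * ennreal (\<Sum>l\<in>{K - W..K + W}. cmod (c l))"
        using C \<eta> by (subst ennreal_plus) (auto simp: ennreal_mult sum_nonneg intro!: mult_nonneg_nonneg)
      also have "\<dots> \<le> ennreal C * (of_nat ((J + 1) * m) * ssup c) + ennreal \<eta> * (of_nat k * csup c)"
      proof (intro add_mono mult_left_mono)
        have "ennreal (\<Sum>t\<in>Y. \<Sum>s=0..\<mu> t. ?d s t) = (\<Sum>t\<in>Y. \<Sum>s=0..\<mu> t. ennreal (?d s t))"
          by (simp add: sum_ennreal sum_nonneg)
        also have "\<dots> \<le> (\<Sum>t\<in>Y. of_nat m * ssup c)"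
        proof (rule sum_mono)
          fix t assume "t \<in> Y"
          then have t: "t \<in> X" using Y by blast
          have "(\<Sum>s=0..\<mu> t. ennreal (?d s t)) \<le> (\<Sum>s=0..\<mu> t. ssup c)"
            by (intro sum_mono SUP_upper2[OF t] SUP_upper) auto
          also have "\<dots> = of_nat (Suc (\<mu> t)) * ssup c" by simp
          also have "\<dots> \<le> of_nat m * ssup c"
            using \<mu>_lt[OF t order_refl] by (intro mult_right_mono of_nat_mono) auto
          finally show "(\<Sum>s=0..\<mu> t. ennreal (?d s t)) \<le> of_nat m * ssup c" .
        qed
        also have "\<dots> = of_nat (card Y) * (of_nat m * ssup c)" by simp
        also have "\<dots> \<le> of_nat (J + 1) * (of_nat m * ssup c)"
          using Y by (intro mult_right_mono of_nat_mono) auto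
        also have "\<dots> = of_nat ((J + 1) * m) * ssup c" by (simp only: of_nat_mult mult.assoc)
        finally show "ennreal (\<Sum>t\<in>Y. \<Sum>s=0..\<mu> t. ?d s t) \<le> of_nat ((J + 1) * m) * ssup c" .
        show "ennreal (\<Sum>l\<in>{K - W..K + W}. cmod (c l)) \<le> of_nat k * csup c"
          using sum_le_card_SUP[of "\<lambda>l. ennreal (cmod (c l))" "{K - W..K + W}"] unfolding k(2)
          by (simp add: sum_ennreal)
      qed auto
      also have "ennreal \<eta> * (of_nat k * csup c) = ennreal (1 / 2) * csup c"
      proof -
        have "ennreal \<eta> * of_nat k = ennreal (\<eta> * real k)"
          unfolding ennreal_of_nat_eq_real_of_nat using \<eta> by (intro ennreal_mult[symmetric]) auto
        also have "\<eta> * real k = 1 / 2" using k by (simp add: \<eta>_def)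
        finally show ?thesis by (simp only: mult.assoc[symmetric])
      qed
      finally show "ennreal (cmod (c K)) \<le> ennreal C * (of_nat ((J + 1) * m) * ssup c) + ennreal (1 / 2) * csup c" .
    qed
    then have "csup c \<le> 2 * (ennreal C * (of_nat ((J + 1) * m) * ssup c))"
      using fin by (intro ennreal_absorb_half)
    also have "\<dots> = ennreal (2 * (C * real ((J + 1) * m))) * ssup c"
      using C by (simp add: ennreal_mult ennreal_of_nat_eq_real_of_nat mult.assoc del: of_nat_add of_nat_mult)
    finally show ?thesis .
  qed
  moreover have "2 * (C * real ((J + 1) * m)) > 0"
    using C m2 by (intro mult_pos_pos) (auto simp del: of_nat_mult mult_Suc)
  ultimately show ?thesis by blast
qed

text \<open>Norm and samples are both compared with a size \<open>T\<close> of the coefficients, so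
  that finite and infinite \<open>p\<close> share this step. The lower sampling constant is the
  reciprocal of the product of the constants in samples to coefficients to norm.\<close>

lemma sampling_setI:
  fixes T :: "(int \<Rightarrow> complex) \<Rightarrow> ennreal"
  assumes a: "a1 > 0" "a2 > 0" "a3 > 0" "a4 > 0"
    and 1: "\<And>c. in_lp p c \<Longrightarrow> T c \<le> ennreal a1 * sample_sum p m X \<mu> (lift c)"
    and 2: "\<And>c. in_lp p c \<Longrightarrow> sample_sum p m X \<mu> (lift c) \<le> ennreal a2 * T c"
    and 3: "\<And>c. in_lp p c \<Longrightarrow> T c \<le> ennreal a3 * Lp_norm_pow p (lift c)"
    and 4: "\<And>c. in_lp p c \<Longrightarrow> Lp_norm_pow p (lift c) \<le> ennreal a4 * T c"
  shows "sampling_set p m \<phi> X \<mu>"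
  unfolding sampling_set_def
proof (intro exI conjI ballI)
  show "0 < 1 / (a4 * a1)" "0 < a2 * a3" using a by simp_all
  fix f assume "f \<in> shift_inv_space p \<phi>"
  then obtain c where c: "in_lp p c" "f = lift c"
    unfolding shift_inv_space_def lift_def[abs_def] by blast
  let ?S = "sample_sum p m X \<mu> (lift c)" and ?L = "Lp_norm_pow p (lift c)"
  have "?L \<le> ennreal a4 * (ennreal a1 * ?S)"
    using order_trans[OF 4[OF c(1)] mult_left_mono[OF 1[OF c(1)], of "ennreal a4"]] by simp
  also have "\<dots> = ennreal (a4 * a1) * ?S" using a by (simp add: ennreal_mult mult.assoc)
  finally have "ennreal (1 / (a4 * a1)) * ?L \<le> ennreal (1 / (a4 * a1)) * (ennreal (a4 * a1) * ?S)"
    by (rule mult_left_mono) simp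
  also have "\<dots> = ennreal (1 / (a4 * a1) * (a4 * a1)) * ?S"
    using a by (simp only: ennreal_mult mult.assoc zero_le_divide_1_iff mult_nonneg_nonneg less_imp_le)
  also have "1 / (a4 * a1) * (a4 * a1) = 1" using a by simp
  finally show "ennreal (1 / (a4 * a1)) * Lp_norm_pow p f \<le> sample_sum p m X \<mu> f" unfolding c by simp
  have "?S \<le> ennreal a2 * (ennreal a3 * ?L)"
    using order_trans[OF 2[OF c(1)] mult_left_mono[OF 3[OF c(1)], of "ennreal a2"]] by simp
  also have "\<dots> = ennreal (a2 * a3) * ?L" using a by (simp add: ennreal_mult mult.assoc)
  finally show "sample_sum p m X \<mu> f \<le> ennreal (a2 * a3) * Lp_norm_pow p f" unfolding c .
qed

text \<open>Supplies the finiteness without which half of the coefficient norm could not be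
  absorbed.\<close>

lemma in_lp_lpow_finite:
  assumes "in_lp p c" "p \<noteq> \<infinity>"
  shows "lpow (enn2real p) c < \<infinity>"
proof -
  let ?f = "\<lambda>l. cmod (c l) powr enn2real p"
  have s: "?f summable_on UNIV" using assms by (simp add: in_lp_def)
  have "lpow (enn2real p) c = (\<Sum>\<^sub>\<infinity>l. ennreal (?f l))"
    by (rule infsum_eq_nn_integral[symmetric]) simp
  also have "\<dots> = (SUP F\<in>{F. finite F \<and> F \<subseteq> UNIV}. (\<Sum>l\<in>F. ennreal (?f l)))"
    by (rule nonneg_infsum_complete) simp
  also have "\<dots> = (SUP F\<in>{F. finite F \<and> F \<subseteq> UNIV}. ennreal (sum ?f F))"
    by (intro SUP_cong refl sum_ennreal) auto
  also have "\<dots> = ennreal (infsum ?f UNIV)"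
    by (rule infsum_nonneg_is_SUPREMUM_ennreal[OF s, symmetric]) simp
  finally show ?thesis by simp
qed

lemma is_sampling_set:
  assumes p: "1 \<le> p"
  shows "sampling_set p m \<phi> X \<mu>"
proof (cases "p = \<infinity>")
  case True
  have S: "sample_sum p m X \<mu> (lift c) = ssup c" for c using True by (simp add: sample_sum_def)
  have L: "Lp_norm_pow p (lift c) = esssup lborel (\<lambda>x. ennreal (cmod (lift c x)))" for c
    using True by (simp add: Lp_norm_pow_def)
  have fin: "csup c < \<infinity>" if "in_lp p c" for c
  proof -
    have "bounded (range c)" using that True by (simp add: in_lp_def)
    then obtain B where "\<forall>y\<in>range c. norm y \<le> B" unfolding bounded_iff by blast
    then have "csup c \<le> ennreal B" by (intro SUP_least ennreal_leI) auto
    then show ?thesis by (simp add: le_less_trans)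
  qed
  obtain a1 where "a1 > 0" "\<And>c. csup c < \<infinity> \<Longrightarrow> csup c \<le> ennreal a1 * ssup c" using sample_sup_lower by blast
  moreover obtain a2 where "a2 > 0" "\<And>c. ssup c \<le> ennreal a2 * csup c" using sample_sup_upper by blast
  moreover obtain a3 where "a3 > 0" "\<And>c. csup c \<le> ennreal a3 * esssup lborel (\<lambda>x. ennreal (cmod (lift c x)))"
    using lift_esssup_lower by blast
  moreover obtain a4 where "a4 > 0" "\<And>c. esssup lborel (\<lambda>x. ennreal (cmod (lift c x))) \<le> ennreal a4 * csup c"
    using lift_esssup_upper by blast
  ultimately show ?thesis using fin unfolding S[symmetric] L[symmetric]
    by (intro sampling_setI[of a1 a2 a3 a4 p csup]) auto
next
  case False
  define q where "q = enn2real p"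
  have "p < top" using False by (simp add: less_top)
  then have "ennreal q = p" unfolding q_def by (rule ennreal_enn2real)
  then have q: "0 < q" using p by (cases "0 < q") (auto simp: not_less ennreal_neg)
  have S: "sample_sum p m X \<mu> (lift c) = (\<integral>\<^sup>+t. hsum q c t \<partial>count_space X)" for c
    using False infsum_eq_nn_integral[OF countable_X] by (simp add: sample_sum_def hsum_def q_def)
  have L: "Lp_norm_pow p (lift c) = (\<integral>\<^sup>+x. ennreal (cmod (lift c x) powr q) \<partial>lborel)" for c
    using False by (simp add: Lp_norm_pow_def q_def)
  have fin: "lpow q c < \<infinity>" if "in_lp p c" for c
    unfolding q_def by (rule in_lp_lpow_finite[OF that False])
  obtain a1 where "a1 > 0" "\<And>c. lpow q c < \<infinity> \<Longrightarrow> lpow q c \<le> ennreal a1 * (\<integral>\<^sup>+t. hsum q c t \<partial>count_space X)"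
    using sample_lp_lower[OF q] by blast
  moreover obtain a2 where "a2 > 0" "\<And>c. (\<integral>\<^sup>+t. hsum q c t \<partial>count_space X) \<le> ennreal a2 * lpow q c"
    using sample_lp_upper[OF q] by blast
  moreover obtain a3 where "a3 > 0" "\<And>c. lpow q c \<le> ennreal a3 * (\<integral>\<^sup>+x. ennreal (cmod (lift c x) powr q) \<partial>lborel)"
    using lift_Lp_lower[OF q] by blast
  moreover obtain a4 where "a4 > 0" "\<And>c. (\<integral>\<^sup>+x. ennreal (cmod (lift c x) powr q) \<partial>lborel) \<le> ennreal a4 * lpow q c"
    using lift_Lp_upper[OF q] by blast
  ultimately show ?thesis using fin unfolding S[symmetric] L[symmetric]
    by (intro sampling_setI[of a1 a2 a3 a4 p "lpow q"]) auto
qed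

end

section \<open>From the hypotheses to the constants\<close>

lemma max_gap_bound:
  assumes "max_gap x \<mu> < 1"
  obtains \<rho> where "0 < \<rho>" "\<rho> < 1" "\<And>j. x (j + 1) - x j \<le> \<rho> * (1 + real (\<mu> (x (j + 1))))"
proof -
  obtain r where r: "max_gap x \<mu> < ereal r" "ereal r < 1" using ereal_dense2[OF assms] by blast
  \<comment> \<open>The strict inequality leaves room for \<open>r\<close> below 1; the maximum with
    1/2 makes the constant positive.\<close>
  define \<rho> where "\<rho> = max r (1 / 2)"
  have "x (j + 1) - x j \<le> \<rho> * (1 + real (\<mu> (x (j + 1))))" for j
  proof -
    have "ereal ((x (j + 1) - x j) / (1 + real (\<mu> (x (j + 1))))) \<le> max_gap x \<mu>"
      unfolding max_gap_def by (intro max.coboundedI2 SUP_upper) simp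
    also have "\<dots> < ereal r" by (rule r)
    finally have "(x (j + 1) - x j) / (1 + real (\<mu> (x (j + 1)))) < r" by simp
    then have "(x (j + 1) - x j) / (1 + real (\<mu> (x (j + 1)))) \<le> \<rho>" by (simp add: \<rho>_def)
    then show ?thesis by (simp add: pos_divide_le_eq)
  qed
  moreover have "0 < \<rho>" "\<rho> < 1" using r by (simp_all add: \<rho>_def one_ereal_def)
  ultimately show ?thesis using that by blast
qed

theorem theorem6p3:
  fixes m :: nat and w :: "nat \<Rightarrow> real \<Rightarrow> real" and \<phi> :: "real \<Rightarrow> real"
    and X :: "real set" and x :: "int \<Rightarrow> real" and \<mu> :: "real \<Rightarrow> nat" and p :: ennreal
  assumes "m \<ge> 2"
    and "PEB_spline m w \<phi>"
    and "uniform_discrete X"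
    and "strict_mono x" and "range x = X"
    and "\<mu> \<in> X \<rightarrow> {0..m - 1}"
    and "{y \<in> X. \<mu> y = m - 1} = {} \<or> setdist {y \<in> X. \<mu> y = m - 1} \<int> > 0"
    and "max_gap x \<mu> < 1"
    and "1 \<le> p"
  shows "sampling_set p m \<phi> X \<mu>"
proof -
  obtain \<rho> where \<rho>: "0 < \<rho>" "\<rho> < 1" "\<And>j. x (j + 1) - x j \<le> \<rho> * (1 + real (\<mu> (x (j + 1))))"
    using max_gap_bound[OF assms(8)] by blast
  obtain e where e: "0 < e" "\<And>t u. t \<in> X \<Longrightarrow> u \<in> X \<Longrightarrow> dist t u < e \<Longrightarrow> t = u"
    using assms(3) unfolding uniform_discrete_def by blast
  have sep: "x j + e \<le> x (j + 1)" for j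
  proof -
    have "x j < x (j + 1)" using assms(4) by (simp add: strict_mono_less)
    moreover have "\<not> dist (x j) (x (j + 1)) < e" using e(2)[of "x j" "x (j + 1)"] assms(5) calculation by auto
    ultimately show ?thesis by (simp add: dist_real_def)
  qed
  \<comment> \<open>If no sample has multiplicity m - 1, any positive value will do, since
    \<open>aw\<close> is then vacuous.\<close>
  define \<delta> where "\<delta> = (if {y \<in> X. \<mu> y = m - 1} = {} then 1 else setdist {y \<in> X. \<mu> y = m - 1} \<int>)"
  have \<delta>: "0 < \<delta>" using assms(7) by (auto simp: \<delta>_def)
  have aw: "\<delta> \<le> \<bar>x j - of_int n\<bar>" if "\<mu> (x j) = m - 1" for j n
  proof -
    have j: "x j \<in> {y \<in> X. \<mu> y = m - 1}" using that assms(5) by auto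
    then have "\<delta> = setdist {y \<in> X. \<mu> y = m - 1} \<int>" unfolding \<delta>_def by auto
    also have "\<dots> \<le> dist (x j) (of_int n)" by (rule setdist_le_dist[OF j]) simp
    finally show ?thesis by (simp add: dist_real_def)
  qed
  interpret peb_sampling m w \<phi> x \<mu> \<rho> e \<delta> X
  proof
    show "\<mu> (x j) \<le> m - 1" for j using assms(5,6) by auto
    show "t = u" if "t \<in> X" "u \<in> X" "\<bar>t - u\<bar> < e" for t u
      using e(2)[OF that(1,2)] that(3) by (simp add: dist_real_def)
  qed (use assms \<rho> e sep \<delta> aw in auto)
  show ?thesis by (rule is_sampling_set[OF assms(9)])
qed

end
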